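(* Let $F$ be a field of characteristic $p \neq 0$ and let $\mathfrak{F}$ be a locally defined formation of soluble Leibniz algebras over $F$, that is, $\mathfrak{F} = \mathrm{Loc}(\mathfrak{K})$ for some formation $\mathfrak{K}$ of soluble Leibniz algebras over $F$. Then there exists a unique formation $\mathfrak{K}_0$ of soluble Lie algebras over $F$ with $\mathfrak{F} = \mathrm{Loc}(\mathfrak{K}_0)$.
   Context: All algebras are finite-dimensional over the field $F$. A (left) Leibniz algebra over $F$ is a linear algebra $L$ in which, for every $a \in L$, the left multiplication $d_a : L \to L$, $d_a(x) = ax$, is a derivation. A Lie algebra is in particular a Leibniz algebra. "Ideal" means two-sided ideal. A formation of soluble Leibniz (respectively Lie) algebras over $F$ is a non-empty class $\mathfrak{K}$ of soluble Leibniz (respectively Lie) algebras over $F$, closed under isomorphism, such that (i) if $L \in \mathfrak{K}$ and $A$ is an ideal of $L$, then $L/A \in \mathfrak{K}$; (ii) if $A_1, A_2$ are ideals of a Leibniz (respectively Lie) algebra $L$ with $L/A_1, L/A_2 \in \mathfrak{K}$, then $L/(A_1 \cap A_2) \in \mathfrak{K}$. A formation of soluble Lie algebras is also a formation of soluble Leibniz algebras. A chief factor of $L$ is a quotient $H/K$ where $K \subsetneq H$ are ideals of $L$ with no ideal of $L$ strictly between them. Its centraliser is $\mathcal{C}_L(H/K) = \{x \in L \mid xh \in K \text{ and } hx \in K \text{ for all } h \in H\}$, an ideal of $L$. For a formation $\mathfrak{K}$ of soluble Leibniz algebras (possibly consisting only of Lie algebras), $\mathrm{Loc}(\mathfrak{K})$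 is the class of all soluble Leibniz algebras $L$ over $F$ such that $L/\mathcal{C}_L(H/K) \in \mathfrak{K}$ for every chief factor $H/K$ of $L$. *)

theory Defs
  imports "HOL-Algebra.QuotRing" "HOL-Algebra.Multiplicative_Group" "Jordan_Normal_Form.Missing_VectorSpace"
begin

section \<open>Finite-dimensional algebras\<close>

text \<open>
  The ground field is a structure \<open>F\<close> satisfying \<^locale>\<open>field\<close>. A (not necessarily associative or
  unital) algebra over \<open>F\<close> is carried by the record type \<^type>\<open>module\<close>: its fields \<open>carrier\<close>, \<open>add\<close>,
  \<open>zero\<close>, \<open>smult\<close> give the vector space and \<open>mult\<close> gives the product. The field \<open>one\<close> of that record
  has no meaning here and no definition below depends on it.
\<close>

locale fd_algebra = vectorspace F L
  for F and L +
  assumes prod_closed: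
      "\<lbrakk>x \<in> carrier L; y \<in> carrier L\<rbrakk> \<Longrightarrow> x \<otimes>\<^bsub>L\<^esub> y \<in> carrier L"
    and prod_add_left:
      "\<lbrakk>x \<in> carrier L; y \<in> carrier L; z \<in> carrier L\<rbrakk>
        \<Longrightarrow> (x \<oplus>\<^bsub>L\<^esub> y) \<otimes>\<^bsub>L\<^esub> z = (x \<otimes>\<^bsub>L\<^esub> z) \<oplus>\<^bsub>L\<^esub> (y \<otimes>\<^bsub>L\<^esub> z)"
    and prod_add_right:
      "\<lbrakk>x \<in> carrier L; y \<in> carrier L; z \<in> carrier L\<rbrakk>
        \<Longrightarrow> x \<otimes>\<^bsub>L\<^esub> (y \<oplus>\<^bsub>L\<^esub> z) = (x \<otimes>\<^bsub>L\<^esub> y) \<oplus>\<^bsub>L\<^esub> (x \<otimes>\<^bsub>L\<^esub> z)"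
    and prod_smult_left:
      "\<lbrakk>c \<in> carrier F; x \<in> carrier L; y \<in> carrier L\<rbrakk>
        \<Longrightarrow> (c \<odot>\<^bsub>L\<^esub> x) \<otimes>\<^bsub>L\<^esub> y = c \<odot>\<^bsub>L\<^esub> (x \<otimes>\<^bsub>L\<^esub> y)"
    and prod_smult_right:
      "\<lbrakk>c \<in> carrier F; x \<in> carrier L; y \<in> carrier L\<rbrakk>
        \<Longrightarrow> x \<otimes>\<^bsub>L\<^esub> (c \<odot>\<^bsub>L\<^esub> y) = c \<odot>\<^bsub>L\<^esub> (x \<otimes>\<^bsub>L\<^esub> y)"
    and finite_dimensional: "fin_dim"

definition derivation :: "('a, 'm) ring_scheme \<Rightarrow> ('a, 'b) module \<Rightarrow> ('b \<Rightarrow> 'b) \<Rightarrow> bool"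
  where "derivation F L d \<longleftrightarrow>
    d \<in> module_hom F L L \<and>
    (\<forall>x\<in>carrier L. \<forall>y\<in>carrier L. d (x \<otimes>\<^bsub>L\<^esub> y) = (d x \<otimes>\<^bsub>L\<^esub> y) \<oplus>\<^bsub>L\<^esub> (x \<otimes>\<^bsub>L\<^esub> d y))"

locale leibniz_algebra = fd_algebra F L
  for F and L :: "('a, 'b) module" +
  assumes left_mult_derivation: "a \<in> carrier L \<Longrightarrow> derivation F L (\<lambda>x. a \<otimes>\<^bsub>L\<^esub> x)"

locale lie_algebra = fd_algebra F L
  for F and L :: "('a, 'b) module" +
  assumes alternating: "x \<in> carrier L \<Longrightarrow> x \<otimes>\<^bsub>L\<^esub> x = \<zero>\<^bsub>L\<^esub>"
    and jacobi: "\<lbrakk>x \<in> carrier L; y \<in> carrier L; z \<in> carrier L\<rbrakk> \<Longrightarrow>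
      (x \<otimes>\<^bsub>L\<^esub> (y \<otimes>\<^bsub>L\<^esub> z)) \<oplus>\<^bsub>L\<^esub> (y \<otimes>\<^bsub>L\<^esub> (z \<otimes>\<^bsub>L\<^esub> x)) \<oplus>\<^bsub>L\<^esub> (z \<otimes>\<^bsub>L\<^esub> (x \<otimes>\<^bsub>L\<^esub> y)) = \<zero>\<^bsub>L\<^esub>"

definition algebra_isomorphic ::
    "('a, 'm) ring_scheme \<Rightarrow> ('a, 'b) module \<Rightarrow> ('a, 'c) module \<Rightarrow> bool"
  where "algebra_isomorphic F L M \<longleftrightarrow>
    (\<exists>f. f \<in> module_hom F L M \<and> bij_betw f (carrier L) (carrier M) \<and>
      (\<forall>x\<in>carrier L. \<forall>y\<in>carrier L. f (x \<otimes>\<^bsub>L\<^esub> y) = f x \<otimes>\<^bsub>M\<^esub> f y))"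

definition algebra_ideal :: "('a, 'm) ring_scheme \<Rightarrow> ('a, 'b) module \<Rightarrow> 'b set \<Rightarrow> bool"
  where "algebra_ideal F L A \<longleftrightarrow>
    subspace F A L \<and> (\<forall>x\<in>carrier L. \<forall>a\<in>A. x \<otimes>\<^bsub>L\<^esub> a \<in> A \<and> a \<otimes>\<^bsub>L\<^esub> x \<in> A)"

text \<open>
  The cosets of \<open>A\<close> with the operations of \<^const>\<open>FactRing\<close>, together with the scalar multiplication
  \<open>c (A + x) = A + c x\<close>.
\<close>

definition quotient_algebra :: "('a, 'b) module \<Rightarrow> 'b set \<Rightarrow> ('a, 'b set) module"
  where "quotient_algebra L A =
    \<lparr>carrier = a_rcosets\<^bsub>L\<^esub> A, mult = rcoset_mult L A, one = A +>\<^bsub>L\<^esub> \<one>\<^bsub>L\<^esub>,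
     zero = A, add = set_add L, smult = (\<lambda>c C. \<Union>x\<in>C. A +>\<^bsub>L\<^esub> (c \<odot>\<^bsub>L\<^esub> x))\<rparr>"

primrec derived_series :: "('a, 'm) ring_scheme \<Rightarrow> ('a, 'b) module \<Rightarrow> nat \<Rightarrow> 'b set"
  where
    "derived_series F L 0 = carrier L"
  | "derived_series F L (Suc n) =
      module.span F L {x \<otimes>\<^bsub>L\<^esub> y | x y. x \<in> derived_series F L n \<and> y \<in> derived_series F L n}"

definition soluble :: "('a, 'm) ring_scheme \<Rightarrow> ('a, 'b) module \<Rightarrow> bool"
  where "soluble F L \<longleftrightarrow> (\<exists>n. derived_series F L n = {\<zero>\<^bsub>L\<^esub>})"


section \<open>Chief factors\<close>

text \<open>\<open>chief_factor F L H K\<close> says that \<open>H/K\<close> is a chief factor of \<open>L\<close>.\<close>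

definition chief_factor :: "('a, 'm) ring_scheme \<Rightarrow> ('a, 'b) module \<Rightarrow> 'b set \<Rightarrow> 'b set \<Rightarrow> bool"
  where "chief_factor F L H K \<longleftrightarrow>
    algebra_ideal F L H \<and> algebra_ideal F L K \<and> K \<subset> H \<and>
    \<not> (\<exists>J. algebra_ideal F L J \<and> K \<subset> J \<and> J \<subset> H)"

definition factor_centraliser :: "('a, 'b) module \<Rightarrow> 'b set \<Rightarrow> 'b set \<Rightarrow> 'b set"
  where "factor_centraliser L H K =
    {x \<in> carrier L. \<forall>h\<in>H. x \<otimes>\<^bsub>L\<^esub> h \<in> K \<and> h \<otimes>\<^bsub>L\<^esub> x \<in> K}"


section \<open>Formations\<close>

text \<open>
  A class of finite-dimensional algebras that is closed under isomorphism is represented by its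
  members whose elements have type \<^typ>\<open>nat \<Rightarrow> 'a\<close>, where \<^typ>\<open>'a\<close> is the type of scalars. By the
  theorem \<open>ex_isomorphic_fd_algebra\<close> below every finite-dimensional algebra has an isomorphic copy
  of this type, so nothing is lost. Algebras with elements of another type, such as quotients, belong
  to the class if they are isomorphic to a member.
\<close>

type_synonym 'a alg = "('a, nat \<Rightarrow> 'a) module"

definition in_class :: "('a, 'm) ring_scheme \<Rightarrow> 'a alg set \<Rightarrow> ('a, 'b) module \<Rightarrow> bool"
  where "in_class F \<KK> L \<longleftrightarrow> (\<exists>M\<in>\<KK>. algebra_isomorphic F L M)"

text \<open>
  The parameter \<open>\<A>\<close> is the kind of algebra considered, Leibniz or Lie. It also restricts the
  ambient algebra \<open>L\<close> in condition (ii), the last conjunct; that \<open>L\<close> is not assumed soluble.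
\<close>

definition formation_of_soluble :: "('a alg \<Rightarrow> bool) \<Rightarrow> ('a, 'm) ring_scheme \<Rightarrow> 'a alg set \<Rightarrow> bool"
  where "formation_of_soluble \<A> F \<KK> \<longleftrightarrow>
    \<KK> \<noteq> {} \<and>
    (\<forall>L\<in>\<KK>. \<A> L \<and> soluble F L) \<and>
    (\<forall>L\<in>\<KK>. \<forall>M. \<A> M \<and> algebra_isomorphic F L M \<longrightarrow> M \<in> \<KK>) \<and>
    (\<forall>L\<in>\<KK>. \<forall>A. algebra_ideal F L A \<longrightarrow> in_class F \<KK> (quotient_algebra L A)) \<and>
    (\<forall>L A\<^sub>1 A\<^sub>2. \<A> L \<and> algebra_ideal F L A\<^sub>1 \<and> algebra_ideal F L A\<^sub>2 \<and>
      in_class F \<KK> (quotient_algebra L A\<^sub>1) \<and> in_class F \<KK> (quotient_algebra L A\<^sub>2) \<longrightarrow>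
      in_class F \<KK> (quotient_algebra L (A\<^sub>1 \<inter> A\<^sub>2)))"

definition leibniz_formation :: "('a, 'm) ring_scheme \<Rightarrow> 'a alg set \<Rightarrow> bool"
  where "leibniz_formation F = formation_of_soluble (leibniz_algebra F) F"

definition lie_formation :: "('a, 'm) ring_scheme \<Rightarrow> 'a alg set \<Rightarrow> bool"
  where "lie_formation F = formation_of_soluble (lie_algebra F) F"

definition Loc :: "('a, 'm) ring_scheme \<Rightarrow> 'a alg set \<Rightarrow> 'a alg set"
  where "Loc F \<KK> =
    {L. leibniz_algebra F L \<and> soluble F L \<and>
      (\<forall>H K. chief_factor F L H K \<longrightarrow>
        in_class F \<KK> (quotient_algebra L (factor_centraliser L H K)))}"

text \<open>
  The additive order of \<open>1\<close>; \<^const>\<open>group.ord\<close> is \<open>0\<close> on elements of infinite order.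
\<close>

definition ring_characteristic :: "('a, 'm) ring_scheme \<Rightarrow> nat"
  where "ring_characteristic R = group.ord (add_monoid R) \<one>\<^bsub>R\<^esub>"


section \<open>The choice of \<^typ>\<open>'a alg\<close> is no restriction\<close>

theorem ex_isomorphic_fd_algebra:
  fixes F :: "('a, 'm) ring_scheme" and L :: "('a, 'b) module"
  assumes "fd_algebra F L"
  shows "\<exists>M :: 'a alg. fd_algebra F M \<and> algebra_isomorphic F L M"
proof -
  interpret L: fd_algebra F L by fact
  obtain S where S: "finite S" "S \<subseteq> carrier L" "L.span S = carrier L"
    using L.finite_dimensional unfolding L.fin_dim_def by auto
  obtain h :: "nat \<Rightarrow> 'b" where h: "bij_betw h {..<card S} S"
    using S(1) ex_bij_betw_nat_finite atLeast0LessThan by metis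
  have "\<forall>x\<in>carrier L. \<exists>a. a \<in> S \<rightarrow> carrier F \<and> x = L.lincomb a S"
  proof
    fix x assume "x \<in> carrier L"
    then have "x \<in> {L.lincomb a S | a. a \<in> S \<rightarrow> carrier F}"
      using S(3) L.finite_span[OF S(1,2)] by simp
    then show "\<exists>a. a \<in> S \<rightarrow> carrier F \<and> x = L.lincomb a S" by blast
  qed
  from bchoice[OF this] obtain a
    where a: "\<forall>x\<in>carrier L. a x \<in> S \<rightarrow> carrier F \<and> x = L.lincomb (a x) S" ..
  define \<phi> where "\<phi> x = a x \<circ> h" for x
  define g where "g = inv_into (carrier L) \<phi>"
  have inj: "inj_on \<phi> (carrier L)"
  proof (rule inj_onI)
    fix x y assume xy: "x \<in> carrier L" "y \<in> carrier L" "\<phi> x = \<phi> y"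
    have "a x s = a y s" if "s \<in> S" for s
    proof -
      have "s \<in> h ` {..<card S}" unfolding bij_betw_imp_surj_on[OF h] by (rule that)
      then obtain n where "s = h n" by (rule imageE)
      then show ?thesis using fun_cong[OF xy(3), of n] by (simp add: \<phi>_def)
    qed
    moreover have "a y \<in> S \<rightarrow> carrier F" using a xy(2) by blast
    ultimately have "L.lincomb (a x) S = L.lincomb (a y) S"
      unfolding L.lincomb_def using S(2)
      by (intro L.M.finsum_cong') (auto simp: Pi_def)
    with bspec[OF a xy(1)] bspec[OF a xy(2)] show "x = y" by argo
  qed
  have [simp]: "g (\<phi> x) = x" if "x \<in> carrier L" for x
    using inj that by (simp add: g_def)
  define M :: "'a alg" where "M = \<lparr>carrier = \<phi> ` carrier L, mult = (\<lambda>u v. \<phi> (g u \<otimes>\<^bsub>L\<^esub> g v)),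
    one = undefined, zero = \<phi> \<zero>\<^bsub>L\<^esub>, add = (\<lambda>u v. \<phi> (g u \<oplus>\<^bsub>L\<^esub> g v)),
    smult = (\<lambda>c u. \<phi> (c \<odot>\<^bsub>L\<^esub> g u))\<rparr>"
  note [simp] = L.prod_closed
  have "abelian_group M"
  proof (rule abelian_groupI)
    show "\<exists>y\<in>carrier M. y \<oplus>\<^bsub>M\<^esub> x = \<zero>\<^bsub>M\<^esub>" if "x \<in> carrier M" for x
    proof -
      have "x \<in> \<phi> ` carrier L" using that by (simp add: M_def)
      then obtain z where z: "x = \<phi> z" "z \<in> carrier L" by (rule imageE)
      then show ?thesis
        by (intro bexI[of _ "\<phi> (\<ominus>\<^bsub>L\<^esub> z)"]) (auto simp: M_def L.M.l_neg)
    qed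
  qed (auto simp: M_def L.M.a_ac)
  then have "module F M"
    by (intro moduleI L.R.is_cring)
      (auto simp: M_def L.smult_l_distr L.smult_r_distr L.smult_assoc1)
  then interpret M: vectorspace F M
    by (intro vectorspace.intro L.field_axioms)
  have hom: "\<phi> \<in> module_hom F L M"
    by (auto simp: module_hom_def M_def)
  have "linear_map F L M \<phi>"
    by (intro linear_map.intro mod_hom.intro mod_hom_axioms.intro L.vectorspace_axioms
      M.vectorspace_axioms L.module_axioms M.module_axioms hom)
  then have "M.fin_dim"
    by (rule linear_map.surj_fin_dim[OF _ L.finite_dimensional]) (simp add: M_def)
  then have "fd_algebra F M"
    by (intro fd_algebra.intro fd_algebra_axioms.intro M.vectorspace_axioms)
      (auto simp: M_def L.prod_add_left L.prod_add_right L.prod_smult_left L.prod_smult_right)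
  moreover have "algebra_isomorphic F L M"
    unfolding algebra_isomorphic_def using hom inj
    by (auto intro!: exI[of _ \<phi>] simp: M_def bij_betw_def)
  ultimately show ?thesis by blast
qed

end

theory Submission
  imports Defs "HOL-Computational_Algebra.Primes"
begin

text \<open>
  For existence, the point is that if \<open>H/K\<close> is a chief factor of a Leibniz algebra
  \<open>L\<close>, then \<open>L/C\<^sub>L(H/K)\<close> is a Lie algebra
  (\<open>square_centralises_chief_factor\<close>). Hence only the Lie algebras in a formation
  \<open>\<KK>\<close> matter for \<open>Loc \<KK>\<close>, and they form a formation
  \<open>\<KK>\<^sub>0\<close> of Lie algebras.

  Uniqueness means that a Lie formation \<open>\<KK>\<close> can be recovered from \<open>Loc \<KK>\<close>. Let
  \<open>L \<in> \<KK>\<close> and let \<open>W\<close> be any finite-dimensional \<open>L\<close>-module. The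
  split extension \<open>X\<close> of \<open>W\<close> by \<open>L\<close> lies in \<open>Loc \<KK>\<close>,
  since the abelian ideal \<open>W\<close> centralises every chief factor, so that
  \<open>X/C\<^sub>X(H/K)\<close> is a quotient of \<open>L\<close> (\<open>extension_in_Loc\<close>). If
  \<open>\<KK>'\<close> is another Lie formation with \<open>Loc \<KK> \<subseteq> Loc \<KK>'\<close>, all these
  quotients of \<open>L\<close> lie in \<open>\<KK>'\<close>. If \<open>a \<in> L\<close> acts on
  \<open>W\<close> by an operator that is not nilpotent, then some chief factor of \<open>X\<close> is not
  centralised by \<open>a\<close>: otherwise powers of \<open>a\<close> would move \<open>X\<close> down a chief
  series to \<open>0\<close>. So once every \<open>a \<noteq> 0\<close> acts in a non-nilpotent way on some
  module, the ideals \<open>J\<close> of \<open>L\<close> with \<open>L/J \<in> \<KK>'\<close> intersect in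
  \<open>0\<close>, and \<open>L \<in> \<KK>'\<close> because \<open>\<KK>'\<close> is closed under subdirect
  products (\<open>lie_formation_mono_Loc\<close>).

  The existence of such modules is where the characteristic enters
  (\<open>ex_nonnilpotent_representation\<close>); over the complex numbers, for instance, the derived algebra
  of a soluble Lie algebra always acts nilpotently. The module is built by induction along subalgebras \<open>M
  \<subset> N\<close> of codimension one, with \<open>M\<close> an ideal and \<open>N = M + F x\<close>. If
  \<open>a \<notin> M\<close>, the projection of \<open>N\<close> onto \<open>N/M\<close> is a one-dimensional
  representation in which \<open>a\<close> acts as a non-zero scalar. If \<open>a \<in> M\<close>, an
  \<open>M\<close>-module \<open>V\<close> is coinduced to \<open>N\<close>: on divided power series
  \<open>w(t)\<close> with coefficients in \<open>V\<close>, let \<open>x\<close> act as \<open>d/dt\<close> and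
  \<open>m \<in> M\<close> as multiplication by \<open>exp (t D) m\<close>, where \<open>D = ad x\<close>. Like
  \<open>d/dt\<close> itself, its iterates of order \<open>p\<^sup>i\<close> obey the product rule for this
  action, because the characteristic is \<open>p\<close>. The powers of \<open>D\<close> with exponents
  \<open>p\<^sup>i\<close> satisfy a linear relation, and the same combination of powers of \<open>d/dt\<close>
  then commutes with \<open>M\<close>. Its kernel is a finite-dimensional \<open>N\<close>-module that maps onto
  \<open>V\<close> by \<open>t = 0\<close>.
\<close>

section \<open>Linear algebra\<close>

lemma module_homI:
  assumes "\<And>x. x \<in> carrier M \<Longrightarrow> f x \<in> carrier N"
    and "\<And>x y. x \<in> carrier M \<Longrightarrow> y \<in> carrier M \<Longrightarrow> f (x \<oplus>\<^bsub>M\<^esub> y) = f x \<oplus>\<^bsub>N\<^esub> f y"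
    and "\<And>c x. c \<in> carrier R \<Longrightarrow> x \<in> carrier M \<Longrightarrow> f (c \<odot>\<^bsub>M\<^esub> x) = c \<odot>\<^bsub>N\<^esub> f x"
  shows "f \<in> module_hom R M N"
  using assms by (auto simp: module_hom_def)

lemma module_hom_mem: "f \<in> module_hom R M N \<Longrightarrow> x \<in> carrier M \<Longrightarrow> f x \<in> carrier N"
  by (auto simp: module_hom_def)

lemma module_hom_comp:
  assumes "f \<in> module_hom R M N" and "g \<in> module_hom R N P"
  shows "g \<circ> f \<in> module_hom R M P"
  using assms by (auto simp: module_hom_def Pi_def)

lemma linear_mapI:
  assumes "vectorspace K U" and "vectorspace K V" and "f \<in> module_hom K U V"
  shows "linear_map K U V f"
  using assms by (simp add: linear_map_def mod_hom_def mod_hom_axioms_def vectorspace_def)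

lemma (in linear_map) T_finsum:
  assumes "finite A" and "g \<in> A \<rightarrow> carrier V"
  shows "T (finsum V g A) = (\<Oplus>\<^bsub>W\<^esub>i\<in>A. T (g i))"
  using assms by (induction A rule: finite_induct) (simp_all add: Pi_def)

definition scalar_module :: "('a, 'b) ring_scheme \<Rightarrow> ('a, 'a) module"
  where "scalar_module F = \<lparr>carrier = carrier F, monoid.mult = (\<lambda>x y. x \<otimes>\<^bsub>F\<^esub> y), one = \<one>\<^bsub>F\<^esub>,
    zero = \<zero>\<^bsub>F\<^esub>, add = add F, smult = (\<lambda>c x. c \<otimes>\<^bsub>F\<^esub> x)\<rparr>"

lemma scalar_module_simps [simp]:
  "carrier (scalar_module F) = carrier F"
  "\<zero>\<^bsub>scalar_module F\<^esub> = \<zero>\<^bsub>F\<^esub>"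
  "x \<oplus>\<^bsub>scalar_module F\<^esub> y = x \<oplus>\<^bsub>F\<^esub> y"
  "c \<odot>\<^bsub>scalar_module F\<^esub> x = c \<otimes>\<^bsub>F\<^esub> x"
  by (simp_all add: scalar_module_def)

context vectorspace
begin

lemma subspaceI:
  assumes "W \<subseteq> carrier V" and "\<zero>\<^bsub>V\<^esub> \<in> W"
    and "\<And>x y. x \<in> W \<Longrightarrow> y \<in> W \<Longrightarrow> x \<oplus>\<^bsub>V\<^esub> y \<in> W"
    and "\<And>c x. c \<in> carrier K \<Longrightarrow> x \<in> W \<Longrightarrow> c \<odot>\<^bsub>V\<^esub> x \<in> W"
  shows "subspace K W V"
  by (intro subspace.intro vectorspace_axioms submodule.intro module_axioms) (use assms in auto)

lemma subspace_subset: "subspace K W V \<Longrightarrow> W \<subseteq> carrier V"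
  and subspace_zero: "subspace K W V \<Longrightarrow> \<zero>\<^bsub>V\<^esub> \<in> W"
  and subspace_add: "subspace K W V \<Longrightarrow> x \<in> W \<Longrightarrow> y \<in> W \<Longrightarrow> x \<oplus>\<^bsub>V\<^esub> y \<in> W"
  and subspace_smult: "subspace K W V \<Longrightarrow> c \<in> carrier K \<Longrightarrow> x \<in> W \<Longrightarrow> c \<odot>\<^bsub>V\<^esub> x \<in> W"
  by (auto simp: subspace_def submodule_def)

lemma subspace_mem: "subspace K W V \<Longrightarrow> x \<in> W \<Longrightarrow> x \<in> carrier V"
  using subspace_subset by blast

lemma subspace_neg: "subspace K W V \<Longrightarrow> x \<in> W \<Longrightarrow> \<ominus>\<^bsub>V\<^esub> x \<in> W"
  using subspace_smult[of W "\<ominus>\<^bsub>K\<^esub> \<one>\<^bsub>K\<^esub>" x] subspace_mem[of W x] smult_minus_1[of x] by simp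

lemma subspace_minus: "subspace K W V \<Longrightarrow> x \<in> W \<Longrightarrow> y \<in> W \<Longrightarrow> x \<ominus>\<^bsub>V\<^esub> y \<in> W"
  by (simp add: a_minus_def subspace_add subspace_neg)

lemma subspace_carrier: "subspace K (carrier V) V"
  by (rule subspaceI) auto

lemma subspace_zero_space: "subspace K {\<zero>\<^bsub>V\<^esub>} V"
  by (rule subspaceI) auto

lemma subspace_Int:
  assumes "subspace K A V" and "subspace K B V"
  shows "subspace K (A \<inter> B) V"
  using assms by (intro subspaceI) (auto simp: subspace_zero subspace_add subspace_smult dest: subspace_mem)

lemma span_subset_subspace: "subspace K W V \<Longrightarrow> S \<subseteq> W \<Longrightarrow> span S \<subseteq> W"
  by (simp add: span_is_subset)

lemma span_generators: "S \<subseteq> carrier V \<Longrightarrow> x \<in> S \<Longrightarrow> x \<in> span S"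
  using in_own_span by blast

lemma add_minus_cancel [simp]: "x \<in> carrier V \<Longrightarrow> y \<in> carrier V \<Longrightarrow> (x \<ominus>\<^bsub>V\<^esub> y) \<oplus>\<^bsub>V\<^esub> y = x"
  by (simp add: a_minus_def M.a_assoc M.l_neg)

lemma minus_add_cancel_middle:
  assumes "x \<in> carrier V" "y \<in> carrier V" "z \<in> carrier V"
  shows "(x \<ominus>\<^bsub>V\<^esub> y) \<oplus>\<^bsub>V\<^esub> (y \<ominus>\<^bsub>V\<^esub> z) = x \<ominus>\<^bsub>V\<^esub> z"
  using assms by (simp add: a_minus_def M.a_assoc M.r_neg1)

lemma minus_self [simp]: "x \<in> carrier V \<Longrightarrow> x \<ominus>\<^bsub>V\<^esub> x = \<zero>\<^bsub>V\<^esub>"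
  by (simp add: a_minus_def M.r_neg)

lemma minus_zero_right [simp]: "x \<in> carrier V \<Longrightarrow> x \<ominus>\<^bsub>V\<^esub> \<zero>\<^bsub>V\<^esub> = x"
  by (simp add: a_minus_def M.add.inv_one)

text \<open>The largest size of an independent subset plays the role of the dimension of a subspace; for
  the arguments below it only matters that it is strictly monotone and bounded.\<close>

lemma ex_dimension_function:
  assumes "fin_dim"
  obtains \<mu> :: "'c set \<Rightarrow> nat"
  where "\<And>A B. subspace K A V \<Longrightarrow> subspace K B V \<Longrightarrow> A \<subset> B \<Longrightarrow> \<mu> A < \<mu> B"
    and "\<And>A. subspace K A V \<Longrightarrow> \<mu> A \<le> dim"
    and "\<And>A. subspace K A V \<Longrightarrow> \<exists>S. finite S \<and> S \<subseteq> A \<and> A = span S"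
proof -
  \<comment> \<open>The dimension function sends \<open>A\<close> to the maximum of \<open>N A\<close>.\<close>
  define N where "N A = card ` {S. S \<subseteq> A \<and> lin_indpt S}" for A
  have N: "finite (N A)" "\<forall>n\<in>N A. n \<le> dim" if "subspace K A V" for A
  proof -
    have "N A \<subseteq> {..dim}"
      using li_le_dim(2)[OF assms] subspace_subset[OF that] by (auto simp: N_def)
    then show "finite (N A)" "\<forall>n\<in>N A. n \<le> dim"
      using finite_subset by auto
  qed
  have "lin_indpt {}" by (auto simp: lin_dep_def)
  then have ne: "N A \<noteq> {}" for A by (auto simp: N_def)
  have wit: "\<exists>S. S \<subseteq> A \<and> lin_indpt S \<and> card S = Max (N A)" if "subspace K A V" for A
    using Max_in[OF N(1)[OF that] ne] by (auto simp: N_def)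
  have ext: "Max (N A) < card S'" if A: "subspace K A V" and S: "S \<subseteq> A" "lin_indpt S" "card S = Max (N A)"
    and v: "v \<in> carrier V" "v \<notin> span S" "S' = insert v S" for A S S' v
  proof -
    have SV: "S \<subseteq> carrier V" using S(1) subspace_subset[OF A] by blast
    have "v \<notin> S" using span_generators[OF SV] v(2) by blast
    then show ?thesis using li_le_dim(1)[OF assms SV S(2)] S(3) v(3) by simp
  qed
  have indep: "lin_indpt (insert v S)" if A: "subspace K A V" and S: "S \<subseteq> A" "lin_indpt S"
    and v: "v \<in> carrier V" "v \<notin> span S" for A S v
  proof -
    have SV: "S \<subseteq> carrier V" using S(1) subspace_subset[OF A] by blast
    have "v \<notin> S" using span_generators[OF SV] v(2) by blast
    then show ?thesis using lin_dep_iff_in_span[OF SV S(2) v(1)] v(2) by simp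
  qed
  have strict: "Max (N A) < Max (N B)" if A: "subspace K A V" and B: "subspace K B V" and AB: "A \<subset> B" for A B
  proof -
    obtain S where S: "S \<subseteq> A" "lin_indpt S" "card S = Max (N A)" using wit[OF A] by blast
    obtain v where v: "v \<in> B" "v \<notin> A" using AB by blast
    have v': "v \<in> carrier V" "v \<notin> span S"
      using v subspace_mem[OF B] span_subset_subspace[OF A S(1)] by auto
    have "insert v S \<subseteq> B" using S(1) AB v(1) by blast
    then have "card (insert v S) \<in> N B" using indep[OF A S(1,2) v'] by (auto simp: N_def)
    then have "card (insert v S) \<le> Max (N B)" using Max_ge[OF N(1)[OF B]] by blast
    with ext[OF A S v' refl] show ?thesis by linarith
  qed
  have gen: "\<exists>S. finite S \<and> S \<subseteq> A \<and> A = span S" if A: "subspace K A V" for A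
  proof -
    obtain S where S: "S \<subseteq> A" "lin_indpt S" "card S = Max (N A)" using wit[OF A] by blast
    have SV: "S \<subseteq> carrier V" using S(1) subspace_subset[OF A] by blast
    have "v \<in> span S" if v: "v \<in> A" for v
    proof (rule ccontr)
      assume nv: "v \<notin> span S"
      have vV: "v \<in> carrier V" using v subspace_mem[OF A] by blast
      have "card (insert v S) \<in> N A"
        using indep[OF A S(1,2) vV nv] S(1) v by (auto simp: N_def)
      then have "card (insert v S) \<le> Max (N A)" using Max_ge[OF N(1)[OF A]] by blast
      with ext[OF A S vV nv refl] show False by linarith
    qed
    then show ?thesis
      using li_le_dim(1)[OF assms SV S(2)] S(1) span_subset_subspace[OF A S(1)] by blast
  qed
  show thesis
  proof (rule that[of "\<lambda>A. Max (N A)"])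
    show "Max (N A) \<le> dim" if "subspace K A V" for A
      using Max_in[OF N(1)[OF that] ne] N(2)[OF that] by blast
  qed (use strict gen in blast)+
qed

lemma ex_minimal_subspace:
  assumes "fin_dim" and "P A" and "\<And>A. P A \<Longrightarrow> subspace K A V"
  obtains B where "P B" and "B \<subseteq> A" and "\<And>C. P C \<Longrightarrow> \<not> C \<subset> B"
proof -
  obtain \<mu> :: "'c set \<Rightarrow> nat"
    where \<mu>: "\<And>A B. subspace K A V \<Longrightarrow> subspace K B V \<Longrightarrow> A \<subset> B \<Longrightarrow> \<mu> A < \<mu> B"
    using ex_dimension_function[OF assms(1)] by metis
  obtain B where B: "P B \<and> B \<subseteq> A" "\<And>C. P C \<and> C \<subseteq> A \<Longrightarrow> \<mu> B \<le> \<mu> C"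
    using ex_has_least_nat[of "\<lambda>B. P B \<and> B \<subseteq> A" A \<mu>] assms(2) by blast
  show thesis
  proof (rule that[of B])
    fix C assume C: "P C"
    show "\<not> C \<subset> B"
    proof
      assume "C \<subset> B"
      then show False using \<mu>[of C B] assms(3) C B by fastforce
    qed
  qed (use B in auto)
qed

lemma ex_maximal_subspace:
  assumes "fin_dim" and "P A" and "\<And>A. P A \<Longrightarrow> subspace K A V"
  obtains B where "P B" and "A \<subseteq> B" and "\<And>C. P C \<Longrightarrow> \<not> B \<subset> C"
proof -
  obtain \<mu> :: "'c set \<Rightarrow> nat"
    where \<mu>: "\<And>A B. subspace K A V \<Longrightarrow> subspace K B V \<Longrightarrow> A \<subset> B \<Longrightarrow> \<mu> A < \<mu> B"
      "\<And>A. subspace K A V \<Longrightarrow> \<mu> A \<le> dim"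
    using ex_dimension_function[OF assms(1)] by metis
  obtain B where B: "P B \<and> A \<subseteq> B" "\<And>C. P C \<and> A \<subseteq> C \<Longrightarrow> dim - \<mu> B \<le> dim - \<mu> C"
    using ex_has_least_nat[of "\<lambda>B. P B \<and> A \<subseteq> B" A "\<lambda>B. dim - \<mu> B"] assms(2) by blast
  show thesis
  proof (rule that[of B])
    fix C assume C: "P C"
    show "\<not> B \<subset> C"
    proof
      assume *: "B \<subset> C"
      then have "\<mu> B < \<mu> C" "\<mu> C \<le> dim" using \<mu> assms(3) B C by auto
      moreover have "dim - \<mu> B \<le> dim - \<mu> C" using B C * by blast
      ultimately show False by linarith
    qed
  qed (use B in auto)
qed

lemma finite_dimensional_subspace:
  assumes "fin_dim" and "subspace K A V"
  obtains S where "finite S" and "S \<subseteq> A" and "A = span S"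
proof -
  obtain \<mu> :: "'c set \<Rightarrow> nat" where "\<And>A. subspace K A V \<Longrightarrow> \<exists>S. finite S \<and> S \<subseteq> A \<and> A = span S"
    using ex_dimension_function[OF assms(1)] by metis
  then show thesis using that assms(2) by blast
qed

lemma subspace_linear_combinations:
  assumes u: "u \<in> {..<r} \<rightarrow> carrier V"
  shows "subspace K {\<Oplus>\<^bsub>V\<^esub>i\<in>{..<r::nat}. c i \<odot>\<^bsub>V\<^esub> u i | c. c \<in> {..<r} \<rightarrow> carrier K} V"
    (is "subspace K ?T V")
proof (rule subspaceI)
  have cl: "(\<lambda>i. c i \<odot>\<^bsub>V\<^esub> u i) \<in> {..<r} \<rightarrow> carrier V" if "c \<in> {..<r} \<rightarrow> carrier K" for c
    using that u by (auto simp: Pi_def)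
  show "?T \<subseteq> carrier V" using cl by (auto intro!: M.finsum_closed)
  have "(\<Oplus>\<^bsub>V\<^esub>i\<in>{..<r}. \<zero>\<^bsub>K\<^esub> \<odot>\<^bsub>V\<^esub> u i) = (\<Oplus>\<^bsub>V\<^esub>i\<in>{..<r}. \<zero>\<^bsub>V\<^esub>)"
    using u by (intro M.finsum_cong') (auto simp: Pi_def)
  then have "\<zero>\<^bsub>V\<^esub> = (\<Oplus>\<^bsub>V\<^esub>i\<in>{..<r}. (\<lambda>i. \<zero>\<^bsub>K\<^esub>) i \<odot>\<^bsub>V\<^esub> u i)" by simp
  then show "\<zero>\<^bsub>V\<^esub> \<in> ?T" by (intro CollectI exI[of _ "\<lambda>i. \<zero>\<^bsub>K\<^esub>"]) auto
next
  fix x y assume "x \<in> ?T" "y \<in> ?T"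
  then obtain c d where cd: "c \<in> {..<r} \<rightarrow> carrier K" "d \<in> {..<r} \<rightarrow> carrier K"
    "x = (\<Oplus>\<^bsub>V\<^esub>i\<in>{..<r}. c i \<odot>\<^bsub>V\<^esub> u i)" "y = (\<Oplus>\<^bsub>V\<^esub>i\<in>{..<r}. d i \<odot>\<^bsub>V\<^esub> u i)" by blast
  have "x \<oplus>\<^bsub>V\<^esub> y = (\<Oplus>\<^bsub>V\<^esub>i\<in>{..<r}. c i \<odot>\<^bsub>V\<^esub> u i \<oplus>\<^bsub>V\<^esub> d i \<odot>\<^bsub>V\<^esub> u i)"
    unfolding cd(3,4) using cd(1,2) u by (subst M.finsum_addf) (auto simp: Pi_def)
  also have "\<dots> = (\<Oplus>\<^bsub>V\<^esub>i\<in>{..<r}. (\<lambda>i. c i \<oplus>\<^bsub>K\<^esub> d i) i \<odot>\<^bsub>V\<^esub> u i)"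
    using cd(1,2) u by (intro M.finsum_cong') (auto simp: Pi_def smult_l_distr)
  finally have "x \<oplus>\<^bsub>V\<^esub> y = (\<Oplus>\<^bsub>V\<^esub>i\<in>{..<r}. (\<lambda>i. c i \<oplus>\<^bsub>K\<^esub> d i) i \<odot>\<^bsub>V\<^esub> u i)" .
  moreover have "(\<lambda>i. c i \<oplus>\<^bsub>K\<^esub> d i) \<in> {..<r} \<rightarrow> carrier K" using cd(1,2) by (auto simp: Pi_def)
  ultimately show "x \<oplus>\<^bsub>V\<^esub> y \<in> ?T"
    by (intro CollectI exI[of _ "\<lambda>i. c i \<oplus>\<^bsub>K\<^esub> d i"] conjI)
next
  fix a x assume a: "a \<in> carrier K" and "x \<in> ?T"
  then obtain c where c: "c \<in> {..<r} \<rightarrow> carrier K" "x = (\<Oplus>\<^bsub>V\<^esub>i\<in>{..<r}. c i \<odot>\<^bsub>V\<^esub> u i)" by blast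
  have "a \<odot>\<^bsub>V\<^esub> x = (\<Oplus>\<^bsub>V\<^esub>i\<in>{..<r}. a \<odot>\<^bsub>V\<^esub> (c i \<odot>\<^bsub>V\<^esub> u i))"
    unfolding c(2) using a c(1) u by (subst finsum_smult_ldistr) (auto simp: Pi_def)
  also have "\<dots> = (\<Oplus>\<^bsub>V\<^esub>i\<in>{..<r}. (\<lambda>i. a \<otimes>\<^bsub>K\<^esub> c i) i \<odot>\<^bsub>V\<^esub> u i)"
    using a c(1) u by (intro M.finsum_cong') (auto simp: Pi_def smult_assoc1)
  finally have "a \<odot>\<^bsub>V\<^esub> x = (\<Oplus>\<^bsub>V\<^esub>i\<in>{..<r}. (\<lambda>i. a \<otimes>\<^bsub>K\<^esub> c i) i \<odot>\<^bsub>V\<^esub> u i)" .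
  moreover have "(\<lambda>i. a \<otimes>\<^bsub>K\<^esub> c i) \<in> {..<r} \<rightarrow> carrier K" using a c(1) by (auto simp: Pi_def)
  ultimately show "a \<odot>\<^bsub>V\<^esub> x \<in> ?T"
    by (intro CollectI exI[of _ "\<lambda>i. a \<otimes>\<^bsub>K\<^esub> c i"] conjI)
qed

text \<open>The spans of the initial segments of the sequence cannot grow forever.\<close>

lemma ex_linear_recurrence:
  fixes u :: "nat \<Rightarrow> 'c"
  assumes fd: "fin_dim" and u: "\<And>i. u i \<in> carrier V"
  obtains r c where "c \<in> {..<r} \<rightarrow> carrier K" and "u r = (\<Oplus>\<^bsub>V\<^esub>i\<in>{..<r::nat}. c i \<odot>\<^bsub>V\<^esub> u i)"
proof -
  obtain \<mu> :: "'c set \<Rightarrow> nat"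
    where \<mu>: "\<And>A B. subspace K A V \<Longrightarrow> subspace K B V \<Longrightarrow> A \<subset> B \<Longrightarrow> \<mu> A < \<mu> B"
      "\<And>A. subspace K A V \<Longrightarrow> \<mu> A \<le> dim"
    using ex_dimension_function[OF assms(1)] by metis
  have uV: "u ` {..<r} \<subseteq> carrier V" for r using u by auto
  have "\<exists>r. u r \<in> span (u ` {..<r})"
  proof (rule ccontr)
    assume no: "\<nexists>r. u r \<in> span (u ` {..<r})"
    have "r \<le> \<mu> (span (u ` {..<r}))" for r
    proof (induction r)
      case (Suc r)
      have "span (u ` {..<r}) \<subseteq> span (u ` {..<Suc r})" by (intro span_is_monotone) auto
      moreover have "u r \<in> span (u ` {..<Suc r})" by (rule span_generators[OF uV]) auto
      ultimately have "span (u ` {..<r}) \<subset> span (u ` {..<Suc r})" using no by blast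
      then have "\<mu> (span (u ` {..<r})) < \<mu> (span (u ` {..<Suc r}))"
        by (intro \<mu>(1) span_is_subspace uV)
      with Suc show ?case by linarith
    qed simp
    from this[of "Suc dim"] \<mu>(2)[OF span_is_subspace[OF uV]] show False
      using not_less_eq_eq order_trans by blast
  qed
  then obtain r where r: "u r \<in> span (u ` {..<r})" ..
  let ?T = "{\<Oplus>\<^bsub>V\<^esub>i\<in>{..<r}. c i \<odot>\<^bsub>V\<^esub> u i | c. c \<in> {..<r} \<rightarrow> carrier K}"
  have sub: "subspace K ?T V"
    by (rule subspace_linear_combinations) (use u in auto)
  have "u j \<in> ?T" if j: "j < r" for j
  proof -
    have "u j = (\<Oplus>\<^bsub>V\<^esub>i\<in>{..<r}. if i = j then u i else \<zero>\<^bsub>V\<^esub>)"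
      using M.finsum_singleton[of j "{..<r}" u] j u by (simp add: Pi_def eq_commute)
    also have "\<dots> = (\<Oplus>\<^bsub>V\<^esub>i\<in>{..<r}. (\<lambda>i. if i = j then \<one>\<^bsub>K\<^esub> else \<zero>\<^bsub>K\<^esub>) i \<odot>\<^bsub>V\<^esub> u i)"
      using u by (intro M.finsum_cong') (auto simp: Pi_def)
    finally have "u j = (\<Oplus>\<^bsub>V\<^esub>i\<in>{..<r}. (\<lambda>i. if i = j then \<one>\<^bsub>K\<^esub> else \<zero>\<^bsub>K\<^esub>) i \<odot>\<^bsub>V\<^esub> u i)" .
    moreover have "(\<lambda>i. if i = j then \<one>\<^bsub>K\<^esub> else \<zero>\<^bsub>K\<^esub>) \<in> {..<r} \<rightarrow> carrier K" by auto
    ultimately show ?thesis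
      by (intro CollectI exI[of _ "\<lambda>i. if i = j then \<one>\<^bsub>K\<^esub> else \<zero>\<^bsub>K\<^esub>"] conjI)
  qed
  then have "span (u ` {..<r}) \<subseteq> ?T" by (intro span_subset_subspace[OF sub]) blast
  with r that show thesis by blast
qed

lemma subspace_insert:
  assumes M: "subspace K M V" and y: "y \<in> carrier V"
  shows "subspace K {m \<oplus>\<^bsub>V\<^esub> c \<odot>\<^bsub>V\<^esub> y | m c. m \<in> M \<and> c \<in> carrier K} V" (is "subspace K ?T V")
proof (rule subspaceI)
  note mem = subspace_mem[OF M]
  show "?T \<subseteq> carrier V" using mem y by auto
  have "\<zero>\<^bsub>V\<^esub> = \<zero>\<^bsub>V\<^esub> \<oplus>\<^bsub>V\<^esub> \<zero>\<^bsub>K\<^esub> \<odot>\<^bsub>V\<^esub> y" using y by simp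
  then show "\<zero>\<^bsub>V\<^esub> \<in> ?T" using subspace_zero[OF M] by blast
next
  note mem = subspace_mem[OF M]
  fix v w assume "v \<in> ?T" "w \<in> ?T"
  then obtain m n c d where *: "m \<in> M" "n \<in> M" "c \<in> carrier K" "d \<in> carrier K"
    "v = m \<oplus>\<^bsub>V\<^esub> c \<odot>\<^bsub>V\<^esub> y" "w = n \<oplus>\<^bsub>V\<^esub> d \<odot>\<^bsub>V\<^esub> y" by blast
  then have "v \<oplus>\<^bsub>V\<^esub> w = (m \<oplus>\<^bsub>V\<^esub> n) \<oplus>\<^bsub>V\<^esub> (c \<oplus>\<^bsub>K\<^esub> d) \<odot>\<^bsub>V\<^esub> y"
    using mem y by (simp add: smult_l_distr M.a_ac)
  then show "v \<oplus>\<^bsub>V\<^esub> w \<in> ?T" using * subspace_add[OF M] by blast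
next
  note mem = subspace_mem[OF M]
  fix a v assume a: "a \<in> carrier K" and "v \<in> ?T"
  then obtain m c where *: "m \<in> M" "c \<in> carrier K" "v = m \<oplus>\<^bsub>V\<^esub> c \<odot>\<^bsub>V\<^esub> y" by blast
  then have "a \<odot>\<^bsub>V\<^esub> v = a \<odot>\<^bsub>V\<^esub> m \<oplus>\<^bsub>V\<^esub> (a \<otimes>\<^bsub>K\<^esub> c) \<odot>\<^bsub>V\<^esub> y"
    using mem y a by (simp add: smult_r_distr smult_assoc1)
  then show "a \<odot>\<^bsub>V\<^esub> v \<in> ?T" using * a subspace_smult[OF M] by blast
qed

text \<open>A subspace that is maximal among those avoiding \<open>x\<close> is a hyperplane complementary to \<open>x\<close>,
  and the coefficient of \<open>x\<close> is the required functional.\<close>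

lemma ex_separating_functional:
  assumes fd: "fin_dim" and N: "subspace K N V" and x: "x \<in> carrier V" "x \<notin> N"
  obtains l where "l \<in> module_hom K V (scalar_module K)" and "\<forall>v\<in>N. l v = \<zero>\<^bsub>K\<^esub>" and "l x = \<one>\<^bsub>K\<^esub>"
proof -
  obtain M where M: "subspace K M V \<and> x \<notin> M" and NM: "N \<subseteq> M"
    and max: "\<And>C. subspace K C V \<and> x \<notin> C \<Longrightarrow> \<not> M \<subset> C"
    using ex_maximal_subspace[OF fd, of "\<lambda>A. subspace K A V \<and> x \<notin> A" N] N x by blast
  note sub = conjunct1[OF M] and mem = subspace_mem[OF conjunct1[OF M]]
  have ex: "\<exists>m\<in>M. \<exists>c\<in>carrier K. y = m \<oplus>\<^bsub>V\<^esub> c \<odot>\<^bsub>V\<^esub> x" if y: "y \<in> carrier V" for y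
  proof (cases "y \<in> M")
    case True
    then have "y = y \<oplus>\<^bsub>V\<^esub> \<zero>\<^bsub>K\<^esub> \<odot>\<^bsub>V\<^esub> x" using y x by simp
    then show ?thesis using True by blast
  next
    case False
    let ?T = "{m \<oplus>\<^bsub>V\<^esub> c \<odot>\<^bsub>V\<^esub> y | m c. m \<in> M \<and> c \<in> carrier K}"
    have "m \<in> ?T" if "m \<in> M" for m
    proof -
      have "m = m \<oplus>\<^bsub>V\<^esub> \<zero>\<^bsub>K\<^esub> \<odot>\<^bsub>V\<^esub> y" using y mem[OF that] by simp
      then show ?thesis using that by blast
    qed
    moreover have "y = \<zero>\<^bsub>V\<^esub> \<oplus>\<^bsub>V\<^esub> \<one>\<^bsub>K\<^esub> \<odot>\<^bsub>V\<^esub> y" using y by simp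
    then have "y \<in> ?T" using subspace_zero[OF sub] by blast
    ultimately have "M \<subset> ?T" using False by blast
    then have "x \<in> ?T" using max[of ?T] subspace_insert[OF sub y] by blast
    then obtain m c where mc: "m \<in> M" "c \<in> carrier K" "x = m \<oplus>\<^bsub>V\<^esub> c \<odot>\<^bsub>V\<^esub> y" by blast
    have "c \<noteq> \<zero>\<^bsub>K\<^esub>" using M mc y mem by auto
    then have inv: "inv\<^bsub>K\<^esub> c \<in> carrier K" "inv\<^bsub>K\<^esub> c \<otimes>\<^bsub>K\<^esub> c = \<one>\<^bsub>K\<^esub>"
      using mc(2) field_Units by (auto intro: Units_l_inv)
    have "c \<odot>\<^bsub>V\<^esub> y = (\<ominus>\<^bsub>V\<^esub> m) \<oplus>\<^bsub>V\<^esub> x"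
      unfolding mc(3) using mc y mem by (simp add: M.r_neg1)
    from arg_cong[OF this, of "\<lambda>v. inv\<^bsub>K\<^esub> c \<odot>\<^bsub>V\<^esub> v"]
    have "inv\<^bsub>K\<^esub> c \<odot>\<^bsub>V\<^esub> (c \<odot>\<^bsub>V\<^esub> y) = inv\<^bsub>K\<^esub> c \<odot>\<^bsub>V\<^esub> (\<ominus>\<^bsub>V\<^esub> m) \<oplus>\<^bsub>V\<^esub> inv\<^bsub>K\<^esub> c \<odot>\<^bsub>V\<^esub> x"
      unfolding smult_r_distr[OF inv(1) M.a_inv_closed[OF mem[OF mc(1)]] x(1)] .
    then have "y = inv\<^bsub>K\<^esub> c \<odot>\<^bsub>V\<^esub> (\<ominus>\<^bsub>V\<^esub> m) \<oplus>\<^bsub>V\<^esub> inv\<^bsub>K\<^esub> c \<odot>\<^bsub>V\<^esub> x"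
      using inv mc y by (simp flip: smult_assoc1)
    moreover have "inv\<^bsub>K\<^esub> c \<odot>\<^bsub>V\<^esub> (\<ominus>\<^bsub>V\<^esub> m) \<in> M"
      using inv mc subspace_smult[OF sub] subspace_neg[OF sub] by blast
    ultimately show ?thesis using inv by blast
  qed
  have uniq: "c = d" if *: "m \<in> M" "n \<in> M" "c \<in> carrier K" "d \<in> carrier K"
    "m \<oplus>\<^bsub>V\<^esub> c \<odot>\<^bsub>V\<^esub> x = n \<oplus>\<^bsub>V\<^esub> d \<odot>\<^bsub>V\<^esub> x" for m n c d
  proof (rule ccontr)
    assume "c \<noteq> d"
    then have "c \<ominus>\<^bsub>K\<^esub> d \<noteq> \<zero>\<^bsub>K\<^esub>" using *(3,4) by simp
    then have inv: "inv\<^bsub>K\<^esub> (c \<ominus>\<^bsub>K\<^esub> d) \<in> carrier K" "inv\<^bsub>K\<^esub> (c \<ominus>\<^bsub>K\<^esub> d) \<otimes>\<^bsub>K\<^esub> (c \<ominus>\<^bsub>K\<^esub> d) = \<one>\<^bsub>K\<^esub>"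
      using *(3,4) field_Units by (auto intro: Units_l_inv)
    have "(c \<ominus>\<^bsub>K\<^esub> d) \<odot>\<^bsub>V\<^esub> x = c \<odot>\<^bsub>V\<^esub> x \<ominus>\<^bsub>V\<^esub> d \<odot>\<^bsub>V\<^esub> x"
      using *(3,4) x by (simp add: a_minus_def smult_l_distr smult_l_minus)
    also have "c \<odot>\<^bsub>V\<^esub> x = (\<ominus>\<^bsub>V\<^esub> m) \<oplus>\<^bsub>V\<^esub> (n \<oplus>\<^bsub>V\<^esub> d \<odot>\<^bsub>V\<^esub> x)"
      unfolding *(5)[symmetric] using *(1,3) x mem by (simp add: M.r_neg1)
    also have "(\<ominus>\<^bsub>V\<^esub> m) \<oplus>\<^bsub>V\<^esub> (n \<oplus>\<^bsub>V\<^esub> d \<odot>\<^bsub>V\<^esub> x) \<ominus>\<^bsub>V\<^esub> d \<odot>\<^bsub>V\<^esub> x = n \<ominus>\<^bsub>V\<^esub> m"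
      using * x mem by (simp add: a_minus_def M.a_ac M.r_neg)
    finally have "(c \<ominus>\<^bsub>K\<^esub> d) \<odot>\<^bsub>V\<^esub> x \<in> M" using subspace_minus[OF sub *(2,1)] by simp
    then have "inv\<^bsub>K\<^esub> (c \<ominus>\<^bsub>K\<^esub> d) \<odot>\<^bsub>V\<^esub> ((c \<ominus>\<^bsub>K\<^esub> d) \<odot>\<^bsub>V\<^esub> x) \<in> M"
      using inv(1) subspace_smult[OF sub] by blast
    also have "inv\<^bsub>K\<^esub> (c \<ominus>\<^bsub>K\<^esub> d) \<odot>\<^bsub>V\<^esub> ((c \<ominus>\<^bsub>K\<^esub> d) \<odot>\<^bsub>V\<^esub> x) = x"
      using inv *(3,4) x(1) smult_assoc1[OF inv(1) _ x(1), of "c \<ominus>\<^bsub>K\<^esub> d"] by simp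
    finally show False using M by blast
  qed
  define l where "l y = (SOME c. c \<in> carrier K \<and> (\<exists>m\<in>M. y = m \<oplus>\<^bsub>V\<^esub> c \<odot>\<^bsub>V\<^esub> x))" for y
  have l: "l y \<in> carrier K" "\<exists>m\<in>M. y = m \<oplus>\<^bsub>V\<^esub> l y \<odot>\<^bsub>V\<^esub> x" if "y \<in> carrier V" for y
  proof -
    have "l y \<in> carrier K \<and> (\<exists>m\<in>M. y = m \<oplus>\<^bsub>V\<^esub> l y \<odot>\<^bsub>V\<^esub> x)"
      unfolding l_def by (rule someI_ex) (use ex[OF that] in blast)
    then show "l y \<in> carrier K" "\<exists>m\<in>M. y = m \<oplus>\<^bsub>V\<^esub> l y \<odot>\<^bsub>V\<^esub> x" by auto
  qed
  have leq: "l y = c" if "m \<in> M" "c \<in> carrier K" "y = m \<oplus>\<^bsub>V\<^esub> c \<odot>\<^bsub>V\<^esub> x" for y m c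
  proof -
    have "y \<in> carrier V" using that mem x by auto
    from l[OF this] that uniq show ?thesis by metis
  qed
  show thesis
  proof (intro that[of l] module_homI ballI, unfold scalar_module_simps)
    show "l v \<in> carrier K" if "v \<in> carrier V" for v by (rule l(1)[OF that])
  next
    fix v w assume v: "v \<in> carrier V" and w: "w \<in> carrier V"
    from l(2)[OF v] obtain m where m: "m \<in> M" "v = m \<oplus>\<^bsub>V\<^esub> l v \<odot>\<^bsub>V\<^esub> x" ..
    from l(2)[OF w] obtain n where n: "n \<in> M" "w = n \<oplus>\<^bsub>V\<^esub> l w \<odot>\<^bsub>V\<^esub> x" ..
    have "v \<oplus>\<^bsub>V\<^esub> w = (m \<oplus>\<^bsub>V\<^esub> l v \<odot>\<^bsub>V\<^esub> x) \<oplus>\<^bsub>V\<^esub> (n \<oplus>\<^bsub>V\<^esub> l w \<odot>\<^bsub>V\<^esub> x)"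
      using m(2) n(2) by simp
    also have "\<dots> = (m \<oplus>\<^bsub>V\<^esub> n) \<oplus>\<^bsub>V\<^esub> (l v \<oplus>\<^bsub>K\<^esub> l w) \<odot>\<^bsub>V\<^esub> x"
      using mem[OF m(1)] mem[OF n(1)] l(1)[OF v] l(1)[OF w] x(1)
      by (simp add: smult_l_distr M.a_ac)
    finally show "l (v \<oplus>\<^bsub>V\<^esub> w) = l v \<oplus>\<^bsub>K\<^esub> l w"
      by (rule leq[rotated 2]) (use m(1) n(1) l(1)[OF v] l(1)[OF w] subspace_add[OF sub] in auto)
  next
    fix c v assume c: "c \<in> carrier K" and v: "v \<in> carrier V"
    from l(2)[OF v] obtain m where m: "m \<in> M" "v = m \<oplus>\<^bsub>V\<^esub> l v \<odot>\<^bsub>V\<^esub> x" ..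
    have "c \<odot>\<^bsub>V\<^esub> v = c \<odot>\<^bsub>V\<^esub> (m \<oplus>\<^bsub>V\<^esub> l v \<odot>\<^bsub>V\<^esub> x)" using m(2) by simp
    also have "\<dots> = c \<odot>\<^bsub>V\<^esub> m \<oplus>\<^bsub>V\<^esub> (c \<otimes>\<^bsub>K\<^esub> l v) \<odot>\<^bsub>V\<^esub> x"
      using mem[OF m(1)] l(1)[OF v] c x(1) by (simp add: smult_r_distr smult_assoc1)
    finally show "l (c \<odot>\<^bsub>V\<^esub> v) = c \<otimes>\<^bsub>K\<^esub> l v"
      by (rule leq[rotated 2]) (use m(1) l(1)[OF v] c subspace_smult[OF sub] in auto)
  next
    fix v assume v: "v \<in> N"
    then have "v \<in> M" using NM by blast
    moreover from this have "v = v \<oplus>\<^bsub>V\<^esub> \<zero>\<^bsub>K\<^esub> \<odot>\<^bsub>V\<^esub> x" using mem x by simp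
    ultimately show "l v = \<zero>\<^bsub>K\<^esub>" by (intro leq) auto
  next
    have "x = \<zero>\<^bsub>V\<^esub> \<oplus>\<^bsub>V\<^esub> \<one>\<^bsub>K\<^esub> \<odot>\<^bsub>V\<^esub> x" using x by simp
    then show "l x = \<one>\<^bsub>K\<^esub>" by (intro leq[OF subspace_zero[OF sub]]) auto
  qed
qed

end

lemma (in linear_map) image_subspace:
  assumes Y: "subspace K Y V"
  shows "subspace K (T ` Y) W"
proof (rule W.subspaceI)
  note mem = V.subspace_mem[OF Y]
  show "T ` Y \<subseteq> carrier W" using mem by auto
  show "\<zero>\<^bsub>W\<^esub> \<in> T ` Y" using V.subspace_zero[OF Y] T0_is_0 by (metis image_eqI)
next
  note mem = V.subspace_mem[OF Y]
  fix x y assume "x \<in> T ` Y" "y \<in> T ` Y"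
  then obtain a b where "a \<in> Y" "b \<in> Y" "x = T a" "y = T b" by blast
  then show "x \<oplus>\<^bsub>W\<^esub> y \<in> T ` Y"
    using V.subspace_add[OF Y, of a b] mem by (intro image_eqI[of _ _ "a \<oplus>\<^bsub>V\<^esub> b"]) auto
next
  note mem = V.subspace_mem[OF Y]
  fix c x assume "c \<in> carrier K" "x \<in> T ` Y"
  then obtain a where "a \<in> Y" "x = T a" by blast
  then show "c \<odot>\<^bsub>W\<^esub> x \<in> T ` Y"
    using V.subspace_smult[OF Y \<open>c \<in> _\<close>, of a] mem \<open>c \<in> _\<close>
    by (intro image_eqI[of _ _ "c \<odot>\<^bsub>V\<^esub> a"]) auto
qed

lemma (in linear_map) image_span_subset:
  assumes "B \<subseteq> carrier V"
  shows "W.module.span (T ` B) \<subseteq> T ` V.module.span B"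
  by (rule W.span_subset_subspace[OF image_subspace[OF V.span_is_subspace[OF assms]]])
    (use V.span_generators[OF assms] in blast)

lemma (in linear_map) preimage_subspace:
  assumes "subspace K Z W"
  shows "subspace K {v \<in> carrier V. T v \<in> Z} V"
  by (rule V.subspaceI)
    (use W.subspace_zero[OF assms] W.subspace_add[OF assms] W.subspace_smult[OF assms] in auto)

lemma (in linear_map) image_span_in_span_image:
  assumes "B \<subseteq> carrier V" and "v \<in> V.module.span B"
  shows "T v \<in> W.module.span (T ` B)"
proof -
  have TB: "T ` B \<subseteq> carrier W" using assms(1) by auto
  have "V.module.span B \<subseteq> {v \<in> carrier V. T v \<in> W.module.span (T ` B)}"
    by (rule V.span_subset_subspace[OF preimage_subspace[OF W.span_is_subspace[OF TB]]])
      (use assms(1) W.span_generators[OF TB] in auto)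
  then show ?thesis using assms(2) by blast
qed

text \<open>A finite spanning set of the kernel on \<open>Y\<close> is completed by preimages of a finite spanning set
  of the image of \<open>Y\<close>.\<close>

lemma (in linear_map) finitely_spanned_by_kernel:
  assumes fd: "W.fin_dim" and Y: "subspace K Y V"
    and A: "finite A" "A \<subseteq> Y" "{y \<in> Y. T y = \<zero>\<^bsub>W\<^esub>} = V.module.span A"
  obtains S where "finite S" and "S \<subseteq> Y" and "Y = V.module.span S"
proof -
  note mem = V.subspace_mem[OF Y]
  obtain C where C: "finite C" "C \<subseteq> T ` Y" "T ` Y = W.module.span C"
    using W.finite_dimensional_subspace[OF fd image_subspace[OF Y]] by metis
  then obtain B where B: "B \<subseteq> Y" "finite B" "C = T ` B"
    using finite_subset_image by metis
  have BV: "B \<subseteq> carrier V" and AV: "A \<subseteq> carrier V" using B(1) A(2) mem by auto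
  then have ABV: "A \<union> B \<subseteq> carrier V" by blast
  have sub: "subspace K (V.module.span (A \<union> B)) V" by (rule V.span_is_subspace[OF ABV])
  have "y \<in> V.module.span (A \<union> B)" if y: "y \<in> Y" for y
  proof -
    have "T y \<in> T ` V.module.span B" using y C(3) B(3) image_span_subset[OF BV] by blast
    then obtain b where b: "b \<in> V.module.span B" "T y = T b" by blast
    have bY: "b \<in> Y" using b(1) V.span_subset_subspace[OF Y B(1)] by blast
    have "T (y \<ominus>\<^bsub>V\<^esub> b) = \<zero>\<^bsub>W\<^esub>" using b(2) y bY mem by (simp add: W.minus_self)
    then have "y \<ominus>\<^bsub>V\<^esub> b \<in> V.module.span A" using A(3) V.subspace_minus[OF Y y bY] by blast
    then have "y \<ominus>\<^bsub>V\<^esub> b \<in> V.module.span (A \<union> B)" "b \<in> V.module.span (A \<union> B)"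
      using subsetD[OF V.module.span_is_monotone[OF Un_upper1]]
        subsetD[OF V.module.span_is_monotone[OF Un_upper2] b(1)] by blast+
    then have "(y \<ominus>\<^bsub>V\<^esub> b) \<oplus>\<^bsub>V\<^esub> b \<in> V.module.span (A \<union> B)" by (rule V.subspace_add[OF sub])
    then show ?thesis using mem[OF y] mem[OF bY] by simp
  qed
  then show thesis
    using that[of "A \<union> B"] A(1,2) B(1,2) V.span_subset_subspace[OF Y, of "A \<union> B"] by blast
qed

section \<open>Spaces of sequences\<close>

definition seq_module :: "('a, 'b, 'c) module_scheme \<Rightarrow> ('a, nat \<Rightarrow> 'b) module"
  where "seq_module V = \<lparr>carrier = {w. \<forall>k. w k \<in> carrier V}, monoid.mult = (\<lambda>v w k. \<zero>\<^bsub>V\<^esub>),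
    one = (\<lambda>k. \<zero>\<^bsub>V\<^esub>), zero = (\<lambda>k. \<zero>\<^bsub>V\<^esub>), add = (\<lambda>v w k. v k \<oplus>\<^bsub>V\<^esub> w k),
    smult = (\<lambda>c w k. c \<odot>\<^bsub>V\<^esub> w k)\<rparr>"

lemma seq_module_simps [simp]:
  "w \<in> carrier (seq_module V) \<longleftrightarrow> (\<forall>k. w k \<in> carrier V)"
  "\<zero>\<^bsub>seq_module V\<^esub> = (\<lambda>k. \<zero>\<^bsub>V\<^esub>)"
  "v \<oplus>\<^bsub>seq_module V\<^esub> w = (\<lambda>k. v k \<oplus>\<^bsub>V\<^esub> w k)"
  "c \<odot>\<^bsub>seq_module V\<^esub> w = (\<lambda>k. c \<odot>\<^bsub>V\<^esub> w k)"
  by (simp_all add: seq_module_def)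

context vectorspace
begin

lemma fin_dim_subspaceI:
  assumes "subspace K Y V" and "finite S" and "S \<subseteq> Y" and "Y = span S"
  shows "vectorspace.fin_dim K (vs Y)"
proof -
  interpret Y: vectorspace K "vs Y" by (rule subspace_is_vs[OF assms(1)])
  have "Y.span S = span S" by (rule span_li_not_depend(1)[OF assms(3)]) (use assms(1) in simp)
  then show ?thesis unfolding Y.fin_dim_def using assms(2-4) by auto
qed

lemma seq_vectorspace: "vectorspace K (seq_module V)"
proof -
  have "abelian_group (seq_module V)"
  proof (rule abelian_groupI)
    show "\<exists>y\<in>carrier (seq_module V). y \<oplus>\<^bsub>seq_module V\<^esub> w = \<zero>\<^bsub>seq_module V\<^esub>"
      if "w \<in> carrier (seq_module V)" for w
      by (rule bexI[of _ "\<lambda>k. \<ominus>\<^bsub>V\<^esub> w k"]) (use that in \<open>auto simp: M.l_neg\<close>)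
  qed (auto simp: M.a_ac)
  then have "module K (seq_module V)"
    by (intro moduleI R.is_cring) (auto simp: smult_l_distr smult_r_distr smult_assoc1)
  then show ?thesis by (intro vectorspace.intro field_axioms)
qed

lemma eval_linear_map: "linear_map K (seq_module V) V (\<lambda>w. w k)"
  by (intro linear_mapI seq_vectorspace vectorspace_axioms module_homI) auto

text \<open>Finite-dimensionality of recurrent sequences: evaluation at \<open>N\<close> is a linear map into a
  finite-dimensional space, and the sequences in its kernel are determined by one value fewer.\<close>

lemma seq_subspace_finitely_spanned:
  assumes "fin_dim" and "subspace K Y (seq_module V)"
    and "\<And>w. w \<in> Y \<Longrightarrow> (\<And>k. k < N \<Longrightarrow> w k = \<zero>\<^bsub>V\<^esub>) \<Longrightarrow> w = (\<lambda>k. \<zero>\<^bsub>V\<^esub>)"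
  shows "\<exists>S. finite S \<and> S \<subseteq> Y \<and> Y = LinearCombinations.module.span K (seq_module V) S"
  using assms(2,3)
proof (induction N arbitrary: Y)
  case 0
  interpret S: vectorspace K "seq_module V" by (rule seq_vectorspace)
  have "w = \<zero>\<^bsub>seq_module V\<^esub>" if "w \<in> Y" for w using 0(2)[OF that] by simp
  then have "Y = {\<zero>\<^bsub>seq_module V\<^esub>}" using S.subspace_zero[OF 0(1)] by blast
  then show ?case using S.span_empty by (intro exI[of _ "{}"]) simp
next
  case (Suc N)
  interpret S: vectorspace K "seq_module V" by (rule seq_vectorspace)
  interpret e: linear_map K "seq_module V" V "\<lambda>w. w N" by (rule eval_linear_map)
  have sub: "subspace K {w \<in> Y. w N = \<zero>\<^bsub>V\<^esub>} (seq_module V)"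
    by (rule S.subspaceI)
      (use S.subspace_mem[OF Suc.prems(1)] S.subspace_zero[OF Suc.prems(1)]
        S.subspace_add[OF Suc.prems(1)] S.subspace_smult[OF Suc.prems(1)] in \<open>auto\<close>)
  have "\<exists>A. finite A \<and> A \<subseteq> {w \<in> Y. w N = \<zero>\<^bsub>V\<^esub>} \<and> {w \<in> Y. w N = \<zero>\<^bsub>V\<^esub>} = S.span A"
  proof (rule Suc.IH[OF sub])
    fix w assume "w \<in> {w \<in> Y. w N = \<zero>\<^bsub>V\<^esub>}" "\<And>k. k < N \<Longrightarrow> w k = \<zero>\<^bsub>V\<^esub>"
    then show "w = (\<lambda>k. \<zero>\<^bsub>V\<^esub>)" by (intro Suc.prems(2)) (auto simp: less_Suc_eq)
  qed
  then obtain A where "finite A" "A \<subseteq> Y" "{w \<in> Y. w N = \<zero>\<^bsub>V\<^esub>} = S.span A" by blast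
  from e.finitely_spanned_by_kernel[OF assms(1) Suc.prems(1) this] show ?case by metis
qed

lemma seq_subspace_fin_dim:
  assumes "fin_dim" and "subspace K Y (seq_module V)"
    and "\<And>w. w \<in> Y \<Longrightarrow> (\<And>k. k < N \<Longrightarrow> w k = \<zero>\<^bsub>V\<^esub>) \<Longrightarrow> w = (\<lambda>k. \<zero>\<^bsub>V\<^esub>)"
  shows "vectorspace.fin_dim K ((seq_module V)\<lparr>carrier := Y\<rparr>)"
proof -
  obtain S where "finite S" "S \<subseteq> Y" "Y = LinearCombinations.module.span K (seq_module V) S"
    using seq_subspace_finitely_spanned[OF assms] by metis
  then show ?thesis by (rule vectorspace.fin_dim_subspaceI[OF seq_vectorspace assms(2)])
qed

text \<open>The operators restricted to a finite spanning set form a sequence in a finite-dimensional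
  space of functions, and a linear relation there holds everywhere by linearity.\<close>

lemma ex_operator_recurrence:
  fixes f :: "nat \<Rightarrow> 'c \<Rightarrow> 'c"
  assumes fd: "fin_dim" and f: "\<And>i. f i \<in> module_hom K V V"
  obtains r c where "c \<in> {..<r} \<rightarrow> carrier K"
    and "\<And>v. v \<in> carrier V \<Longrightarrow> f r v = (\<Oplus>\<^bsub>V\<^esub>i\<in>{..<r::nat}. c i \<odot>\<^bsub>V\<^esub> f i v)"
proof -
  interpret S: vectorspace K "seq_module V" by (rule seq_vectorspace)
  obtain B where B: "finite B" "B \<subseteq> carrier V" "span B = carrier V"
    using fd unfolding fin_dim_def by blast
  obtain h :: "nat \<Rightarrow> 'c" where h: "bij_betw h {..<card B} B"
    using B(1) ex_bij_betw_nat_finite atLeast0LessThan by metis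
  define Y where "Y = {w. (\<forall>k. w k \<in> carrier V) \<and> (\<forall>k\<ge>card B. w k = \<zero>\<^bsub>V\<^esub>)}"
  have Y: "subspace K Y (seq_module V)"
    by (rule S.subspaceI) (auto simp: Y_def)
  interpret Y: vectorspace K "(seq_module V)\<lparr>carrier := Y\<rparr>" by (rule S.subspace_is_vs[OF Y])
  have fdY: "Y.fin_dim"
  proof (rule seq_subspace_fin_dim[OF fd Y])
    fix w assume "w \<in> Y" "\<And>k. k < card B \<Longrightarrow> w k = \<zero>\<^bsub>V\<^esub>"
    then show "w = (\<lambda>k. \<zero>\<^bsub>V\<^esub>)" by (intro ext) (metis (mono_tags, lifting) Y_def mem_Collect_eq not_le)
  qed
  \<comment> \<open>\<open>u i\<close> lists the values of \<open>f i\<close> on the spanning set \<open>B\<close>.\<close>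
  define u where "u i = (\<lambda>k. if k < card B then f i (h k) else \<zero>\<^bsub>V\<^esub>)" for i
  have hB: "h k \<in> carrier V" if "k < card B" for k
    using bij_betwE[OF h] that B(2) by auto
  have u: "u i \<in> carrier ((seq_module V)\<lparr>carrier := Y\<rparr>)" for i
    using module_hom_mem[OF f] hB by (auto simp: u_def Y_def)
  obtain r c where c: "c \<in> {..<r} \<rightarrow> carrier K"
    "u r = finsum ((seq_module V)\<lparr>carrier := Y\<rparr>) (\<lambda>i. c i \<odot>\<^bsub>(seq_module V)\<lparr>carrier := Y\<rparr>\<^esub> u i) {..<r::nat}"
    by (rule Y.ex_linear_recurrence[OF fdY u])
  have eval: "linear_map K ((seq_module V)\<lparr>carrier := Y\<rparr>) V (\<lambda>w. w k)" for k
    by (intro linear_mapI Y.vectorspace_axioms vectorspace_axioms module_homI)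
      (auto simp: Y_def)
  have on_B: "f r v = (\<Oplus>\<^bsub>V\<^esub>i\<in>{..<r}. c i \<odot>\<^bsub>V\<^esub> f i v)" if v: "v \<in> B" for v
  proof -
    obtain k where k: "k < card B" "v = h k" using v bij_betw_imp_surj_on[OF h] by auto
    have cl: "(\<lambda>i. c i \<odot>\<^bsub>(seq_module V)\<lparr>carrier := Y\<rparr>\<^esub> u i) \<in> {..<r} \<rightarrow> carrier ((seq_module V)\<lparr>carrier := Y\<rparr>)"
      using c(1) u Y.smult_closed by blast
    have "u r k = (\<Oplus>\<^bsub>V\<^esub>i\<in>{..<r}. (c i \<odot>\<^bsub>(seq_module V)\<lparr>carrier := Y\<rparr>\<^esub> u i) k)"
      unfolding c(2) by (rule linear_map.T_finsum[OF eval _ cl]) simp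
    then show ?thesis using k by (simp add: u_def)
  qed
  let ?E = "{v \<in> carrier V. f r v = (\<Oplus>\<^bsub>V\<^esub>i\<in>{..<r}. c i \<odot>\<^bsub>V\<^esub> f i v)}"
  have cf: "(\<lambda>i. c i \<odot>\<^bsub>V\<^esub> f i v) \<in> {..<r} \<rightarrow> carrier V" if "v \<in> carrier V" for v
    using c(1) module_hom_mem[OF f that] by (auto simp: Pi_def)
  note fadd = module_hom_add[OF f] and fsmult = module_hom_smult[OF f] and fmem = module_hom_mem[OF f]
  have ck: "c i \<in> carrier K" if "i < r" for i using c(1) that by auto
  have "subspace K ?E V"
  proof (rule subspaceI)
    have 0: "f i \<zero>\<^bsub>V\<^esub> = \<zero>\<^bsub>V\<^esub>" for i
      by (rule linear_map.T0_is_0[OF linear_mapI[OF vectorspace_axioms vectorspace_axioms f]])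
    have "(\<Oplus>\<^bsub>V\<^esub>i\<in>{..<r}. c i \<odot>\<^bsub>V\<^esub> f i \<zero>\<^bsub>V\<^esub>) = (\<Oplus>\<^bsub>V\<^esub>i\<in>{..<r}. \<zero>\<^bsub>V\<^esub>)"
      by (rule M.finsum_cong') (auto simp: 0 ck)
    then show "\<zero>\<^bsub>V\<^esub> \<in> ?E" by (simp add: 0)
  next
    fix v w assume v: "v \<in> ?E" and w: "w \<in> ?E"
    then have vw: "v \<in> carrier V" "w \<in> carrier V" by auto
    have "f r (v \<oplus>\<^bsub>V\<^esub> w) = (\<Oplus>\<^bsub>V\<^esub>i\<in>{..<r}. c i \<odot>\<^bsub>V\<^esub> f i v \<oplus>\<^bsub>V\<^esub> c i \<odot>\<^bsub>V\<^esub> f i w)"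
      using v w by (simp add: fadd M.finsum_addf[OF cf cf])
    also have "\<dots> = (\<Oplus>\<^bsub>V\<^esub>i\<in>{..<r}. c i \<odot>\<^bsub>V\<^esub> f i (v \<oplus>\<^bsub>V\<^esub> w))"
      by (rule M.finsum_cong') (use vw in \<open>auto simp: fadd fmem smult_r_distr ck\<close>)
    finally show "v \<oplus>\<^bsub>V\<^esub> w \<in> ?E" using vw by simp
  next
    fix a v assume a: "a \<in> carrier K" and v: "v \<in> ?E"
    then have vV: "v \<in> carrier V" by auto
    have "f r (a \<odot>\<^bsub>V\<^esub> v) = (\<Oplus>\<^bsub>V\<^esub>i\<in>{..<r}. a \<odot>\<^bsub>V\<^esub> (c i \<odot>\<^bsub>V\<^esub> f i v))"
      using v a by (simp add: fsmult finsum_smult_ldistr[OF _ a cf])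
    also have "\<dots> = (\<Oplus>\<^bsub>V\<^esub>i\<in>{..<r}. c i \<odot>\<^bsub>V\<^esub> f i (a \<odot>\<^bsub>V\<^esub> v))"
      by (rule M.finsum_cong')
        (use vV a in \<open>auto simp: fsmult fmem ck R.m_comm simp flip: smult_assoc1\<close>)
    finally show "a \<odot>\<^bsub>V\<^esub> v \<in> ?E" using a vV by simp
  qed auto
  moreover have "B \<subseteq> ?E" using on_B B(2) by blast
  ultimately have "carrier V \<subseteq> ?E" unfolding B(3)[symmetric] by (rule span_subset_subspace)
  then show thesis by (intro that[OF c(1)]) auto
qed

end

section \<open>Prime characteristic\<close>

text \<open>An array whose rows arise from each other by Pascal's rule. The rule models a derivation acting
  on a product of two factors, with \<open>a\<close> and \<open>b\<close> counting how often each factor has been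
  differentiated.\<close>

lemma (in abelian_monoid) pascal_array:
  assumes cl: "\<And>k a b. g k a b \<in> carrier G"
    and step: "\<And>k a b. g (Suc k) a b = g k (Suc a) b \<oplus> g k a (Suc b)"
  shows "g (k + n) a b = (\<Oplus>j\<in>{..n}. [(n choose j)] \<cdot> g k (a + j) (b + (n - j)))"
proof (induction n arbitrary: a b)
  case 0
  then show ?case using cl by simp
next
  case (Suc n)
  note npc = add.nat_pow_closed
  let ?t = "\<lambda>j. g k (a + j) (b + (Suc n - j))"
  have shift: "g k (Suc a + j) (b + (n - j)) = ?t (Suc j)" for j by simp
  have "g (k + Suc n) a b = g (k + n) (Suc a) b \<oplus> g (k + n) a (Suc b)"
    using step by simp
  also have "g (k + n) (Suc a) b = (\<Oplus>j\<in>{..n}. [(n choose j)] \<cdot> ?t (Suc j))"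
    unfolding Suc.IH shift ..
  also have "g (k + n) a (Suc b) = (\<Oplus>j\<in>{..n}. [(n choose j)] \<cdot> ?t j)"
    unfolding Suc.IH by (intro finsum_cong') (auto simp: cl npc Suc_diff_le)
  also have "\<dots> = (\<Oplus>j\<in>{..Suc n}. [(n choose j)] \<cdot> ?t j)"
    using cl by (subst finsum_Suc) (auto simp: npc binomial_eq_0)
  also have "\<dots> = (\<Oplus>j\<in>{..n}. [(n choose Suc j)] \<cdot> ?t (Suc j)) \<oplus> [(n choose 0)] \<cdot> ?t 0"
    using cl by (subst finsum_Suc2) (auto simp: npc)
  also have "(\<Oplus>j\<in>{..n}. [(n choose j)] \<cdot> ?t (Suc j)) \<oplus>
      ((\<Oplus>j\<in>{..n}. [(n choose Suc j)] \<cdot> ?t (Suc j)) \<oplus> [(n choose 0)] \<cdot> ?t 0) =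
      ((\<Oplus>j\<in>{..n}. [(n choose j)] \<cdot> ?t (Suc j)) \<oplus> (\<Oplus>j\<in>{..n}. [(n choose Suc j)] \<cdot> ?t (Suc j)))
        \<oplus> [(Suc n choose 0)] \<cdot> ?t 0"
    using cl by (subst a_assoc) (auto simp: npc intro!: finsum_closed)
  also have "(\<Oplus>j\<in>{..n}. [(n choose j)] \<cdot> ?t (Suc j)) \<oplus> (\<Oplus>j\<in>{..n}. [(n choose Suc j)] \<cdot> ?t (Suc j))
      = (\<Oplus>j\<in>{..n}. [(n choose j)] \<cdot> ?t (Suc j) \<oplus> [(n choose Suc j)] \<cdot> ?t (Suc j))"
    using cl by (intro finsum_addf[symmetric]) (auto simp: npc)
  also have "\<dots> = (\<Oplus>j\<in>{..n}. [(Suc n choose Suc j)] \<cdot> ?t (Suc j))"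
    using cl by (intro finsum_cong') (auto simp: npc add.nat_pow_mult)
  also have "\<dots> \<oplus> [(Suc n choose 0)] \<cdot> ?t 0 = (\<Oplus>j\<in>{..Suc n}. [(Suc n choose j)] \<cdot> ?t j)"
    using cl by (intro finsum_Suc2[symmetric]) (auto simp: npc)
  finally show ?case .
qed

text \<open>In characteristic \<open>p\<close> the inner binomial coefficients vanish, so \<open>p\<close> steps of Pascal's rule
  amount to one step of \<open>p\<close> times the width; this can be repeated.\<close>

lemma (in abelian_monoid) pascal_array_prime_power:
  fixes p :: nat
  assumes p: "prime p" and char: "\<And>x. x \<in> carrier G \<Longrightarrow> [p] \<cdot> x = \<zero>"
    and "\<And>k a b. g k a b \<in> carrier G"
    and "\<And>k a b. g (Suc k) a b = g k (Suc a) b \<oplus> g k a (Suc b)"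
  shows "g (k + p ^ i) a b = g k (a + p ^ i) b \<oplus> g k a (b + p ^ i)"
  using assms(3,4)
proof (induction i arbitrary: k a b)
  case 0
  then show ?case by simp
next
  case (Suc i)
  have base: "h (k + p) a b = h k (a + p) b \<oplus> h k a (b + p)"
    if cl: "\<And>k a b. h k a b \<in> carrier G"
      and step: "\<And>k a b. h (Suc k) a b = h k (Suc a) b \<oplus> h k a (Suc b)" for h k a b
  proof -
    have p0: "p > 0" "p \<noteq> 0" using prime_gt_0_nat[OF p] by auto
    let ?f = "\<lambda>j. [(p choose j)] \<cdot> h k (a + j) (b + (p - j))"
    have fcl: "?f j \<in> carrier G" for j by (simp add: cl add.nat_pow_closed)
    have zero: "?f j = \<zero>" if "j \<in> {..p} - {0, p}" for j
    proof -
      have "0 < j" "j < p" using that by auto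
      then have "p dvd (p choose j)" using p by (intro dvd_choose_prime) auto
      then obtain q where "p choose j = p * q" ..
      then have "?f j = [q] \<cdot> ([p] \<cdot> h k (a + j) (b + (p - j)))"
        using cl by (simp add: add.nat_pow_pow)
      then show ?thesis by (simp add: char cl)
    qed
    have "h (k + p) a b = (\<Oplus>j\<in>{..p}. ?f j)" by (rule pascal_array[where g = h]) (rule cl step)+
    also have "\<dots> = (\<Oplus>j\<in>{0, p}. ?f j)"
      by (rule add.finprod_mono_neutral_cong_right) (use fcl zero in auto)
    also have "\<dots> = ?f 0 \<oplus> ?f p"
      using p0 fcl by (subst finsum_insert) (auto simp: cl)
    also have "\<dots> = h k (a + p) b \<oplus> h k a (b + p)"
      using cl by (simp add: a_comm)
    finally show ?thesis .
  qed
  let ?q = "p ^ i"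
  \<comment> \<open>Every \<open>?q\<close>-th row and column of \<open>g\<close> obeys Pascal's rule as well.\<close>
  let ?h = "\<lambda>l c d. g (k + l * ?q) (a + c * ?q) (b + d * ?q)"
  have "?h (0 + p) 0 0 = ?h 0 (0 + p) 0 \<oplus> ?h 0 0 (0 + p)"
  proof (rule base)
    fix l c d
    show "?h (Suc l) c d = ?h l (Suc c) d \<oplus> ?h l c (Suc d)"
      using Suc.IH[OF Suc.prems, of "k + l * ?q" "a + c * ?q" "b + d * ?q"]
      by (simp add: algebra_simps)
  qed (rule Suc.prems(1))
  then show ?case by (simp add: mult.commute)
qed

context field
begin

lemma characteristic_annihilates_one:
  assumes "ring_characteristic R = p"
  shows "[n] \<cdot> \<one> = \<zero> \<longleftrightarrow> p dvd n"
  using group.pow_eq_id[OF a_group, of \<one> n] assms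
  by (simp add: ring_characteristic_def add_pow_def)

lemma characteristic_prime:
  assumes char: "ring_characteristic R = p" and "p \<noteq> 0"
  shows "prime p"
proof -
  note one = characteristic_annihilates_one[OF char]
  have "p \<noteq> 1" using one[of 1] by auto
  moreover have "p dvd a \<or> p dvd b" if "p dvd a * b" for a b
  proof -
    have "([a] \<cdot> \<one>) \<otimes> ([b] \<cdot> \<one>) = [(a * b)] \<cdot> \<one>"
      by (simp add: add_pow_ldistr add_pow_rdistr add.nat_pow_pow mult.commute)
    also have "\<dots> = \<zero>" using that one by blast
    finally show ?thesis using integral[of "[a] \<cdot> \<one>" "[b] \<cdot> \<one>"] one by auto
  qed
  ultimately show ?thesis
    using assms(2) by (intro prime_elem_nat_iff[THEN iffD1] prime_elemI) auto
qed

end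

lemma (in vectorspace) characteristic_annihilates:
  assumes "ring_characteristic K = p" and v: "v \<in> carrier V"
  shows "[p] \<cdot>\<^bsub>V\<^esub> v = \<zero>\<^bsub>V\<^esub>"
proof -
  have "[n] \<cdot>\<^bsub>V\<^esub> v = ([n] \<cdot>\<^bsub>K\<^esub> \<one>\<^bsub>K\<^esub>) \<odot>\<^bsub>V\<^esub> v" for n :: nat
    by (induction n) (use v in \<open>simp_all add: smult_l_distr\<close>)
  then show ?thesis
    using characteristic_annihilates_one[OF assms(1), of p] v by simp
qed

section \<open>Leibniz and Lie algebras\<close>

context fd_algebra
begin

declare prod_closed [simp, intro]

lemma prod_zero_left [simp]: "x \<in> carrier L \<Longrightarrow> \<zero>\<^bsub>L\<^esub> \<otimes>\<^bsub>L\<^esub> x = \<zero>\<^bsub>L\<^esub>"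
  using prod_smult_left[of "\<zero>\<^bsub>F\<^esub>" "\<zero>\<^bsub>L\<^esub>" x] by simp

lemma prod_zero_right [simp]: "x \<in> carrier L \<Longrightarrow> x \<otimes>\<^bsub>L\<^esub> \<zero>\<^bsub>L\<^esub> = \<zero>\<^bsub>L\<^esub>"
  using prod_smult_right[of "\<zero>\<^bsub>F\<^esub>" x "\<zero>\<^bsub>L\<^esub>"] by simp

lemma prod_minus_left: "x \<in> carrier L \<Longrightarrow> y \<in> carrier L \<Longrightarrow> (\<ominus>\<^bsub>L\<^esub> x) \<otimes>\<^bsub>L\<^esub> y = \<ominus>\<^bsub>L\<^esub> (x \<otimes>\<^bsub>L\<^esub> y)"
  using prod_add_left[of "\<ominus>\<^bsub>L\<^esub> x" x y] by (simp add: M.l_neg M.minus_equality)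

lemma prod_minus_right: "x \<in> carrier L \<Longrightarrow> y \<in> carrier L \<Longrightarrow> x \<otimes>\<^bsub>L\<^esub> (\<ominus>\<^bsub>L\<^esub> y) = \<ominus>\<^bsub>L\<^esub> (x \<otimes>\<^bsub>L\<^esub> y)"
  using prod_add_right[of x "\<ominus>\<^bsub>L\<^esub> y" y] by (simp add: M.l_neg M.minus_equality)

text \<open>Expanding \<open>(x + y)(x + y) = 0\<close>.\<close>

lemma alternating_imp_anticommutative:
  assumes alt: "\<forall>x\<in>carrier L. x \<otimes>\<^bsub>L\<^esub> x = \<zero>\<^bsub>L\<^esub>"
    and x: "x \<in> carrier L" and y: "y \<in> carrier L"
  shows "x \<otimes>\<^bsub>L\<^esub> y = \<ominus>\<^bsub>L\<^esub> (y \<otimes>\<^bsub>L\<^esub> x)"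
proof -
  have "(x \<oplus>\<^bsub>L\<^esub> y) \<otimes>\<^bsub>L\<^esub> (x \<oplus>\<^bsub>L\<^esub> y) = x \<otimes>\<^bsub>L\<^esub> y \<oplus>\<^bsub>L\<^esub> y \<otimes>\<^bsub>L\<^esub> x"
    using x y by (simp add: prod_add_left prod_add_right bspec[OF alt x] bspec[OF alt y] M.a_comm)
  then show ?thesis using x y bspec[OF alt, of "x \<oplus>\<^bsub>L\<^esub> y"] by (simp add: M.minus_equality)
qed

end

context lie_algebra
begin

lemma anticommutative:
  "x \<in> carrier L \<Longrightarrow> y \<in> carrier L \<Longrightarrow> x \<otimes>\<^bsub>L\<^esub> y = \<ominus>\<^bsub>L\<^esub> (y \<otimes>\<^bsub>L\<^esub> x)"
  using alternating by (intro alternating_imp_anticommutative ballI)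

lemma leibniz_rule:
  assumes x: "x \<in> carrier L" and y: "y \<in> carrier L" and z: "z \<in> carrier L"
  shows "x \<otimes>\<^bsub>L\<^esub> (y \<otimes>\<^bsub>L\<^esub> z) = (x \<otimes>\<^bsub>L\<^esub> y) \<otimes>\<^bsub>L\<^esub> z \<oplus>\<^bsub>L\<^esub> y \<otimes>\<^bsub>L\<^esub> (x \<otimes>\<^bsub>L\<^esub> z)"
proof -
  have "y \<otimes>\<^bsub>L\<^esub> (z \<otimes>\<^bsub>L\<^esub> x) = \<ominus>\<^bsub>L\<^esub> (y \<otimes>\<^bsub>L\<^esub> (x \<otimes>\<^bsub>L\<^esub> z))"
    using anticommutative[OF z x] x y z by (simp add: prod_minus_right)
  moreover have "z \<otimes>\<^bsub>L\<^esub> (x \<otimes>\<^bsub>L\<^esub> y) = \<ominus>\<^bsub>L\<^esub> ((x \<otimes>\<^bsub>L\<^esub> y) \<otimes>\<^bsub>L\<^esub> z)"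
    using anticommutative[of z "x \<otimes>\<^bsub>L\<^esub> y"] x y z by simp
  ultimately have "x \<otimes>\<^bsub>L\<^esub> (y \<otimes>\<^bsub>L\<^esub> z) \<oplus>\<^bsub>L\<^esub> \<ominus>\<^bsub>L\<^esub> (y \<otimes>\<^bsub>L\<^esub> (x \<otimes>\<^bsub>L\<^esub> z)) \<oplus>\<^bsub>L\<^esub> \<ominus>\<^bsub>L\<^esub> ((x \<otimes>\<^bsub>L\<^esub> y) \<otimes>\<^bsub>L\<^esub> z) = \<zero>\<^bsub>L\<^esub>"
    using jacobi[OF x y z] by simp
  then have "x \<otimes>\<^bsub>L\<^esub> (y \<otimes>\<^bsub>L\<^esub> z) \<ominus>\<^bsub>L\<^esub> ((x \<otimes>\<^bsub>L\<^esub> y) \<otimes>\<^bsub>L\<^esub> z \<oplus>\<^bsub>L\<^esub> y \<otimes>\<^bsub>L\<^esub> (x \<otimes>\<^bsub>L\<^esub> z)) = \<zero>\<^bsub>L\<^esub>"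
    using x y z by (simp add: a_minus_def M.minus_add M.a_ac)
  then show ?thesis using x y z by simp
qed

end

text \<open>The notions of ideal and quotient refer to unextended records; this locale fixes the record
  type accordingly.\<close>

locale fd_algebra_module = fd_algebra F L
  for F and L :: "('a, 'b) module"

sublocale leibniz_algebra \<subseteq> fd_algebra_module ..

sublocale lie_algebra \<subseteq> fd_algebra_module ..

lemma (in leibniz_algebra) leibniz_rule:
  "x \<in> carrier L \<Longrightarrow> y \<in> carrier L \<Longrightarrow> z \<in> carrier L \<Longrightarrow>
    x \<otimes>\<^bsub>L\<^esub> (y \<otimes>\<^bsub>L\<^esub> z) = (x \<otimes>\<^bsub>L\<^esub> y) \<otimes>\<^bsub>L\<^esub> z \<oplus>\<^bsub>L\<^esub> y \<otimes>\<^bsub>L\<^esub> (x \<otimes>\<^bsub>L\<^esub> z)"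
  using left_mult_derivation[of x] by (simp add: derivation_def)

lemma (in lie_algebra) leibniz: "leibniz_algebra F L"
proof (intro leibniz_algebra.intro leibniz_algebra_axioms.intro fd_algebra_axioms)
  fix a assume a: "a \<in> carrier L"
  have "(\<lambda>x. a \<otimes>\<^bsub>L\<^esub> x) \<in> module_hom F L L"
    by (rule module_homI) (simp_all add: a prod_add_right prod_smult_right)
  then show "derivation F L (\<lambda>x. a \<otimes>\<^bsub>L\<^esub> x)"
    unfolding derivation_def using leibniz_rule[OF a] by blast
qed

lemma (in fd_algebra_module) lie_algebraI:
  assumes alt: "\<And>x. x \<in> carrier L \<Longrightarrow> x \<otimes>\<^bsub>L\<^esub> x = \<zero>\<^bsub>L\<^esub>"
    and leib: "\<And>x y z. x \<in> carrier L \<Longrightarrow> y \<in> carrier L \<Longrightarrow> z \<in> carrier L \<Longrightarrow>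
      x \<otimes>\<^bsub>L\<^esub> (y \<otimes>\<^bsub>L\<^esub> z) = (x \<otimes>\<^bsub>L\<^esub> y) \<otimes>\<^bsub>L\<^esub> z \<oplus>\<^bsub>L\<^esub> y \<otimes>\<^bsub>L\<^esub> (x \<otimes>\<^bsub>L\<^esub> z)"
  shows "lie_algebra F L"
proof (intro lie_algebra.intro lie_algebra_axioms.intro fd_algebra_axioms alt)
  have anti: "x \<otimes>\<^bsub>L\<^esub> y = \<ominus>\<^bsub>L\<^esub> (y \<otimes>\<^bsub>L\<^esub> x)" if "x \<in> carrier L" "y \<in> carrier L" for x y
    using alt that by (intro alternating_imp_anticommutative ballI)
  fix x y z assume x: "x \<in> carrier L" and y: "y \<in> carrier L" and z: "z \<in> carrier L"
  have "y \<otimes>\<^bsub>L\<^esub> (z \<otimes>\<^bsub>L\<^esub> x) = \<ominus>\<^bsub>L\<^esub> (y \<otimes>\<^bsub>L\<^esub> (x \<otimes>\<^bsub>L\<^esub> z))"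
    using anti[OF z x] x y z by (simp add: prod_minus_right)
  moreover have "z \<otimes>\<^bsub>L\<^esub> (x \<otimes>\<^bsub>L\<^esub> y) = \<ominus>\<^bsub>L\<^esub> ((x \<otimes>\<^bsub>L\<^esub> y) \<otimes>\<^bsub>L\<^esub> z)"
    using anti[of z "x \<otimes>\<^bsub>L\<^esub> y"] x y z by simp
  ultimately show "(x \<otimes>\<^bsub>L\<^esub> (y \<otimes>\<^bsub>L\<^esub> z)) \<oplus>\<^bsub>L\<^esub> (y \<otimes>\<^bsub>L\<^esub> (z \<otimes>\<^bsub>L\<^esub> x)) \<oplus>\<^bsub>L\<^esub> (z \<otimes>\<^bsub>L\<^esub> (x \<otimes>\<^bsub>L\<^esub> y)) = \<zero>\<^bsub>L\<^esub>"
    using leib[OF x y z] x y z by (simp add: M.a_assoc M.r_neg)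
qed

section \<open>Representations of Lie algebras\<close>

text \<open>The acting algebra is a subalgebra \<open>M\<close> of a fixed Lie algebra, so that an induction over
  subalgebras need not change the ambient record.\<close>

locale lie_representation = L: lie_algebra F L + V: vectorspace F V
  for F and L :: "('a, 'b) module" and M and V :: "('a, 'c) module" and \<rho> :: "'b \<Rightarrow> 'c \<Rightarrow> 'c" +
  assumes subspace_M: "subspace F M L"
    and mult_M: "x \<in> M \<Longrightarrow> y \<in> M \<Longrightarrow> x \<otimes>\<^bsub>L\<^esub> y \<in> M"
    and act_hom: "x \<in> M \<Longrightarrow> \<rho> x \<in> module_hom F V V"
    and act_add: "x \<in> M \<Longrightarrow> y \<in> M \<Longrightarrow> v \<in> carrier V \<Longrightarrow> \<rho> (x \<oplus>\<^bsub>L\<^esub> y) v = \<rho> x v \<oplus>\<^bsub>V\<^esub> \<rho> y v"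
    and act_smult: "c \<in> carrier F \<Longrightarrow> x \<in> M \<Longrightarrow> v \<in> carrier V \<Longrightarrow> \<rho> (c \<odot>\<^bsub>L\<^esub> x) v = c \<odot>\<^bsub>V\<^esub> \<rho> x v"
    and act_mult: "x \<in> M \<Longrightarrow> y \<in> M \<Longrightarrow> v \<in> carrier V \<Longrightarrow>
      \<rho> (x \<otimes>\<^bsub>L\<^esub> y) v \<oplus>\<^bsub>V\<^esub> \<rho> y (\<rho> x v) = \<rho> x (\<rho> y v)"
    and fin_dim_V: "V.fin_dim"
begin

lemmas act_closed [simp, intro] = module_hom_mem[OF act_hom]
  and act_add_right = module_hom_add[OF act_hom]
  and act_smult_right = module_hom_smult[OF act_hom]

lemma act_zero: "x \<in> M \<Longrightarrow> \<rho> x \<zero>\<^bsub>V\<^esub> = \<zero>\<^bsub>V\<^esub>"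
  by (rule linear_map.T0_is_0[OF linear_mapI[OF V.vectorspace_axioms V.vectorspace_axioms act_hom]])

end

section \<open>Coinduction from an ideal of codimension one\<close>

text \<open>A sequence \<open>w\<close> stands for the divided power series with coefficients \<open>w k\<close> in a variable
  \<open>t\<close>. On such series \<open>m\<close> acts as \<open>\<rho> (exp (t D) m)\<close>, and this is its \<open>k\<close>-th coefficient.\<close>

primrec coinduced :: "('c, 'd) ring_scheme \<Rightarrow> ('b \<Rightarrow> 'b) \<Rightarrow> ('b \<Rightarrow> 'c \<Rightarrow> 'c) \<Rightarrow> nat \<Rightarrow> 'b \<Rightarrow> (nat \<Rightarrow> 'c) \<Rightarrow> 'c"
  where
    "coinduced V D \<rho> 0 m w = \<rho> m (w 0)"
  | "coinduced V D \<rho> (Suc k) m w = coinduced V D \<rho> k (D m) w \<oplus>\<^bsub>V\<^esub> coinduced V D \<rho> k m (\<lambda>j. w (Suc j))"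

text \<open>Here \<open>N = M + F x\<close>, and \<open>l\<close> gives the coefficient of \<open>x\<close>; its kernel \<open>M\<close> is an ideal of \<open>N\<close>
  because \<open>l\<close> vanishes on products.\<close>

locale coinduction = lie_representation F L M V \<rho>
  for F and L :: "('a, 'b) module" and M and V :: "('a, 'c) module" and \<rho> +
  fixes x N l
  assumes subspace_N: "subspace F N L"
    and mult_N: "y \<in> N \<Longrightarrow> z \<in> N \<Longrightarrow> y \<otimes>\<^bsub>L\<^esub> z \<in> N"
    and x_N: "x \<in> N"
    and l_closed: "y \<in> N \<Longrightarrow> l y \<in> carrier F"
    and l_add: "y \<in> N \<Longrightarrow> z \<in> N \<Longrightarrow> l (y \<oplus>\<^bsub>L\<^esub> z) = l y \<oplus>\<^bsub>F\<^esub> l z"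
    and l_smult: "c \<in> carrier F \<Longrightarrow> y \<in> N \<Longrightarrow> l (c \<odot>\<^bsub>L\<^esub> y) = c \<otimes>\<^bsub>F\<^esub> l y"
    and l_mult: "y \<in> N \<Longrightarrow> z \<in> N \<Longrightarrow> l (y \<otimes>\<^bsub>L\<^esub> z) = \<zero>\<^bsub>F\<^esub>"
    and l_x: "l x = \<one>\<^bsub>F\<^esub>"
    and M_kernel: "M = {y \<in> N. l y = \<zero>\<^bsub>F\<^esub>}"
begin

abbreviation "D m \<equiv> x \<otimes>\<^bsub>L\<^esub> m"
abbreviation "\<phi> \<equiv> coinduced V D \<rho>"

lemma N_mem: "y \<in> N \<Longrightarrow> y \<in> carrier L"
  by (rule L.subspace_mem[OF subspace_N])

lemma M_N: "m \<in> M \<Longrightarrow> m \<in> N"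
  by (simp add: M_kernel)

lemma M_mem: "m \<in> M \<Longrightarrow> m \<in> carrier L"
  by (rule N_mem[OF M_N])

lemmas M_add = L.subspace_add[OF subspace_M] and M_smult = L.subspace_smult[OF subspace_M]
  and M_zero = L.subspace_zero[OF subspace_M]

lemma D_M: "m \<in> M \<Longrightarrow> D m \<in> M"
  using mult_N[OF x_N M_N] l_mult[OF x_N M_N] by (simp add: M_kernel)

lemma D_pow_M: "m \<in> M \<Longrightarrow> (D ^^ n) m \<in> M"
  by (induction n) (simp_all add: D_M)

lemma D_add: "m \<in> M \<Longrightarrow> n \<in> M \<Longrightarrow> D (m \<oplus>\<^bsub>L\<^esub> n) = D m \<oplus>\<^bsub>L\<^esub> D n"
  using N_mem[OF x_N] M_mem by (intro L.prod_add_right)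

lemma D_smult: "c \<in> carrier F \<Longrightarrow> m \<in> M \<Longrightarrow> D (c \<odot>\<^bsub>L\<^esub> m) = c \<odot>\<^bsub>L\<^esub> D m"
  using N_mem[OF x_N] M_mem by (intro L.prod_smult_right)

lemma \<phi>_closed: "m \<in> M \<Longrightarrow> (\<And>j. w j \<in> carrier V) \<Longrightarrow> \<phi> k m w \<in> carrier V"
  by (induction k arbitrary: m w) (simp_all add: D_M)

lemma \<phi>_add_left: "m \<in> M \<Longrightarrow> n \<in> M \<Longrightarrow> (\<And>j. w j \<in> carrier V) \<Longrightarrow>
    \<phi> k (m \<oplus>\<^bsub>L\<^esub> n) w = \<phi> k m w \<oplus>\<^bsub>V\<^esub> \<phi> k n w"
  by (induction k arbitrary: m n w) (simp_all add: D_M D_add act_add \<phi>_closed V.M.a_ac)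

lemma \<phi>_smult_left: "c \<in> carrier F \<Longrightarrow> m \<in> M \<Longrightarrow> (\<And>j. w j \<in> carrier V) \<Longrightarrow>
    \<phi> k (c \<odot>\<^bsub>L\<^esub> m) w = c \<odot>\<^bsub>V\<^esub> \<phi> k m w"
  by (induction k arbitrary: m w)
    (simp_all add: D_M D_smult act_smult \<phi>_closed V.smult_r_distr)

lemma \<phi>_add_right: "m \<in> M \<Longrightarrow> (\<And>j. v j \<in> carrier V) \<Longrightarrow> (\<And>j. w j \<in> carrier V) \<Longrightarrow>
    \<phi> k m (\<lambda>j. v j \<oplus>\<^bsub>V\<^esub> w j) = \<phi> k m v \<oplus>\<^bsub>V\<^esub> \<phi> k m w"
  by (induction k arbitrary: m v w) (simp_all add: D_M act_add_right \<phi>_closed V.M.a_ac)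

lemma \<phi>_smult_right: "c \<in> carrier F \<Longrightarrow> m \<in> M \<Longrightarrow> (\<And>j. w j \<in> carrier V) \<Longrightarrow>
    \<phi> k m (\<lambda>j. c \<odot>\<^bsub>V\<^esub> w j) = c \<odot>\<^bsub>V\<^esub> \<phi> k m w"
  by (induction k arbitrary: m w)
    (simp_all add: D_M act_smult_right \<phi>_closed V.smult_r_distr)

lemma \<phi>_zero_left: "(\<And>j. w j \<in> carrier V) \<Longrightarrow> \<phi> k \<zero>\<^bsub>L\<^esub> w = \<zero>\<^bsub>V\<^esub>"
  using \<phi>_smult_left[of "\<zero>\<^bsub>F\<^esub>" "\<zero>\<^bsub>L\<^esub>" w k] \<phi>_closed[OF M_zero, of w k] M_zero by simp

lemma \<phi>_zero_right: "m \<in> M \<Longrightarrow> \<phi> k m (\<lambda>j. \<zero>\<^bsub>V\<^esub>) = \<zero>\<^bsub>V\<^esub>"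
  using \<phi>_smult_right[of "\<zero>\<^bsub>F\<^esub>" m "\<lambda>j. \<zero>\<^bsub>V\<^esub>" k] \<phi>_closed[of m "\<lambda>j. \<zero>\<^bsub>V\<^esub>" k] by simp

lemma \<phi>_sum_left:
  assumes "finite A" and "\<And>i. i \<in> A \<Longrightarrow> m i \<in> M" and "\<And>j. w j \<in> carrier V"
  shows "(\<Oplus>\<^bsub>L\<^esub>i\<in>A. m i) \<in> M \<and> \<phi> k (\<Oplus>\<^bsub>L\<^esub>i\<in>A. m i) w = (\<Oplus>\<^bsub>V\<^esub>i\<in>A. \<phi> k (m i) w)"
  using assms
proof (induction A rule: finite_induct)
  case empty
  then show ?case using M_zero \<phi>_zero_left by simp
next
  case (insert a A)
  have "m \<in> A \<rightarrow> carrier L" "m a \<in> carrier L" using insert.prems(1) M_mem by auto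
  moreover have "(\<lambda>i. \<phi> k (m i) w) \<in> A \<rightarrow> carrier V" "\<phi> k (m a) w \<in> carrier V"
    using insert.prems by (auto intro!: \<phi>_closed)
  ultimately show ?case using insert M_add \<phi>_add_left by simp
qed

lemma \<phi>_sum_right:
  assumes "finite A" and "m \<in> M" and "\<And>i j. i \<in> A \<Longrightarrow> u i j \<in> carrier V"
  shows "\<phi> k m (\<lambda>j. \<Oplus>\<^bsub>V\<^esub>i\<in>A. u i j) = (\<Oplus>\<^bsub>V\<^esub>i\<in>A. \<phi> k m (u i))"
  using assms
proof (induction A rule: finite_induct)
  case empty
  then show ?case using \<phi>_zero_right by simp
next
  case (insert a A)
  have *: "(\<lambda>i. u i j) \<in> A \<rightarrow> carrier V" "u a j \<in> carrier V" for j using insert.prems by auto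
  then have "\<phi> k m (\<lambda>j. \<Oplus>\<^bsub>V\<^esub>i\<in>insert a A. u i j) = \<phi> k m (\<lambda>j. u a j \<oplus>\<^bsub>V\<^esub> (\<Oplus>\<^bsub>V\<^esub>i\<in>A. u i j))"
    using insert.hyps by simp
  also have "\<dots> = \<phi> k m (u a) \<oplus>\<^bsub>V\<^esub> \<phi> k m (\<lambda>j. \<Oplus>\<^bsub>V\<^esub>i\<in>A. u i j)"
    using insert.prems(1) * by (intro \<phi>_add_right) (auto intro!: V.M.finsum_closed)
  also have "\<phi> k m (\<lambda>j. \<Oplus>\<^bsub>V\<^esub>i\<in>A. u i j) = (\<Oplus>\<^bsub>V\<^esub>i\<in>A. \<phi> k m (u i))"
    using insert by simp
  also have "\<phi> k m (u a) \<oplus>\<^bsub>V\<^esub> \<dots> = (\<Oplus>\<^bsub>V\<^esub>i\<in>insert a A. \<phi> k m (u i))"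
    using insert by (subst V.M.finsum_insert) (auto intro!: \<phi>_closed)
  finally show ?case .
qed

lemma D_mult:
  assumes m: "m \<in> M" and n: "n \<in> M"
  shows "D (m \<otimes>\<^bsub>L\<^esub> n) = D m \<otimes>\<^bsub>L\<^esub> n \<oplus>\<^bsub>L\<^esub> m \<otimes>\<^bsub>L\<^esub> D n"
  by (rule L.leibniz_rule) (use N_mem[OF x_N] M_mem m n in auto)

text \<open>For the constant terms this is the rule for \<open>\<rho>\<close>. The derivative of the claim is the sum of the
  claims for \<open>(D m, n, w)\<close>, \<open>(m, D n, w)\<close> and \<open>(m, n, w')\<close>, so each coefficient is reduced to the one
  before.\<close>

lemma \<phi>_mult:
  assumes "m \<in> M" and "n \<in> M" and "\<And>j. w j \<in> carrier V"
  shows "\<phi> k (m \<otimes>\<^bsub>L\<^esub> n) w \<oplus>\<^bsub>V\<^esub> \<phi> k n (\<lambda>j. \<phi> j m w) = \<phi> k m (\<lambda>j. \<phi> j n w)"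
  using assms
proof (induction k arbitrary: m n w)
  case 0
  then show ?case by (simp add: act_mult)
next
  case (Suc k)
  let ?S = "\<lambda>w j. w (Suc j)"
  note m = Suc.prems(1) and n = Suc.prems(2) and w = Suc.prems(3)
  note [simp] = \<phi>_closed D_M mult_M m n w
  have "\<phi> (Suc k) (m \<otimes>\<^bsub>L\<^esub> n) w \<oplus>\<^bsub>V\<^esub> \<phi> (Suc k) n (\<lambda>j. \<phi> j m w) =
      (\<phi> k (D m \<otimes>\<^bsub>L\<^esub> n) w \<oplus>\<^bsub>V\<^esub> \<phi> k (m \<otimes>\<^bsub>L\<^esub> D n) w \<oplus>\<^bsub>V\<^esub> \<phi> k (m \<otimes>\<^bsub>L\<^esub> n) (?S w)) \<oplus>\<^bsub>V\<^esub>
      (\<phi> k (D n) (\<lambda>j. \<phi> j m w) \<oplus>\<^bsub>V\<^esub> (\<phi> k n (\<lambda>j. \<phi> j (D m) w) \<oplus>\<^bsub>V\<^esub> \<phi> k n (\<lambda>j. \<phi> j m (?S w))))"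
    by (simp add: D_mult \<phi>_add_left \<phi>_add_right)
  also have "\<dots> = (\<phi> k (D m \<otimes>\<^bsub>L\<^esub> n) w \<oplus>\<^bsub>V\<^esub> \<phi> k n (\<lambda>j. \<phi> j (D m) w)) \<oplus>\<^bsub>V\<^esub>
      ((\<phi> k (m \<otimes>\<^bsub>L\<^esub> D n) w \<oplus>\<^bsub>V\<^esub> \<phi> k (D n) (\<lambda>j. \<phi> j m w)) \<oplus>\<^bsub>V\<^esub>
       (\<phi> k (m \<otimes>\<^bsub>L\<^esub> n) (?S w) \<oplus>\<^bsub>V\<^esub> \<phi> k n (\<lambda>j. \<phi> j m (?S w))))"
    by (simp add: V.M.a_ac)
  also have "\<dots> = \<phi> k (D m) (\<lambda>j. \<phi> j n w) \<oplus>\<^bsub>V\<^esub>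
      (\<phi> k m (\<lambda>j. \<phi> j (D n) w) \<oplus>\<^bsub>V\<^esub> \<phi> k m (\<lambda>j. \<phi> j n (?S w)))"
    by (simp add: Suc.IH)
  also have "\<dots> = \<phi> (Suc k) m (\<lambda>j. \<phi> j n w)"
    by (simp add: \<phi>_add_right)
  finally show ?case .
qed

text \<open>By its recursive definition \<open>\<phi>\<close> turns the shift of coefficients, which is \<open>d/dt\<close>, into a
  derivation of the pair \<open>(m, w)\<close>. In characteristic \<open>p\<close> its powers with exponent \<open>p\<^sup>i\<close> are
  derivations, too.\<close>

lemma \<phi>_prime_power:
  assumes char: "ring_characteristic F = p" "p \<noteq> 0" and m: "m \<in> M" and w: "\<And>j. w j \<in> carrier V"
  shows "\<phi> (k + p ^ i) m w = \<phi> k ((D ^^ (p ^ i)) m) w \<oplus>\<^bsub>V\<^esub> \<phi> k m (\<lambda>j. w (j + p ^ i))"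
proof -
  let ?g = "\<lambda>k a b. \<phi> k ((D ^^ a) m) (\<lambda>j. w (j + b))"
  have "?g (k + p ^ i) 0 0 = ?g k (0 + p ^ i) 0 \<oplus>\<^bsub>V\<^esub> ?g k 0 (0 + p ^ i)"
    by (rule V.M.pascal_array_prime_power[OF L.characteristic_prime[OF char] V.characteristic_annihilates[OF char(1)]])
      (use D_pow_M[OF m] w in \<open>auto intro!: \<phi>_closed\<close>)
  then show ?thesis by simp
qed

end

text \<open>The windows of length \<open>q\<close> of the sequence evolve by the companion map of the recurrence.\<close>

lemma (in vectorspace) ex_recurrent_sequence:
  fixes q r :: nat
  assumes c: "c \<in> {..<r} \<rightarrow> carrier K" and e: "\<And>i. i < r \<Longrightarrow> e i < q" and q: "0 < q" and v: "v \<in> carrier V"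
  obtains w where "\<forall>k. w k \<in> carrier V" and "w 0 = v"
    and "\<forall>k. w (k + q) = (\<Oplus>\<^bsub>V\<^esub>i\<in>{..<r}. c i \<odot>\<^bsub>V\<^esub> w (k + e i))"
proof -
  define T where "T u j = (if Suc j < q then u (Suc j) else \<Oplus>\<^bsub>V\<^esub>i\<in>{..<r}. c i \<odot>\<^bsub>V\<^esub> u (e i))" for u j
  define w where "w k = (T ^^ k) (\<lambda>_. v) 0" for k
  have Tc: "T u j \<in> carrier V" if "\<And>j. u j \<in> carrier V" for u j
    using that c by (auto simp: T_def intro!: M.finsum_closed)
  have Tkc: "(T ^^ k) (\<lambda>_. v) j \<in> carrier V" for k j
    by (induction k arbitrary: j) (auto simp: v intro: Tc)
  have window: "(T ^^ k) (\<lambda>_. v) j = w (k + j)" if "j < q" for k j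
    using that
  proof (induction j arbitrary: k)
    case (Suc j)
    then have "(T ^^ k) (\<lambda>_. v) (Suc j) = (T ^^ Suc k) (\<lambda>_. v) j" by (simp add: T_def)
    also have "\<dots> = w (Suc k + j)" using Suc.prems by (intro Suc.IH) simp
    finally show ?case by simp
  qed (simp add: w_def)
  show thesis
  proof (rule that, safe)
    show "w k \<in> carrier V" for k by (simp add: w_def Tkc)
    show "w 0 = v" by (simp add: w_def)
    fix k
    have "w (k + q) = (T ^^ Suc k) (\<lambda>_. v) (q - 1)"
      using window[of "q - 1" "Suc k"] q by simp
    also have "\<dots> = (\<Oplus>\<^bsub>V\<^esub>i\<in>{..<r}. c i \<odot>\<^bsub>V\<^esub> (T ^^ k) (\<lambda>_. v) (e i))"
      using q by (simp add: T_def)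
    also have "\<dots> = (\<Oplus>\<^bsub>V\<^esub>i\<in>{..<r}. c i \<odot>\<^bsub>V\<^esub> w (k + e i))"
      using c e Tkc window[symmetric] by (intro M.finsum_cong') auto
    finally show "w (k + q) = (\<Oplus>\<^bsub>V\<^esub>i\<in>{..<r}. c i \<odot>\<^bsub>V\<^esub> w (k + e i))" .
  qed
qed

text \<open>The coinduced module is cut down to the sequences that satisfy the given linear relation between
  powers of \<open>D\<close> with the shift in place of \<open>D\<close>. The exponents are powers of \<open>p\<close>, so that the
  combination of shifts commutes with the action of \<open>M\<close>.\<close>

locale truncated_coinduction = coinduction F L M V \<rho> x N l
  for F and L :: "('a, 'b) module" and M and V :: "('a, 'c) module" and \<rho> x N l +
  fixes p r :: nat and c
  assumes char: "ring_characteristic F = p" "p \<noteq> 0"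
    and coeff: "c \<in> {..<r} \<rightarrow> carrier F"
    and recurrence: "m \<in> M \<Longrightarrow> (D ^^ (p ^ r)) m = (\<Oplus>\<^bsub>L\<^esub>i\<in>{..<r}. c i \<odot>\<^bsub>L\<^esub> (D ^^ (p ^ i)) m)"
begin

definition Y :: "(nat \<Rightarrow> 'c) set"
  where "Y = {w. (\<forall>k. w k \<in> carrier V) \<and>
    (\<forall>k. w (k + p ^ r) = (\<Oplus>\<^bsub>V\<^esub>i\<in>{..<r}. c i \<odot>\<^bsub>V\<^esub> w (k + p ^ i)))}"

abbreviation W :: "('a, nat \<Rightarrow> 'c) module"
  where "W \<equiv> (seq_module V)\<lparr>carrier := Y\<rparr>"

text \<open>The element \<open>y = m + l(y) x\<close> of \<open>N\<close> acts as \<open>m\<close> together with \<open>l(y)\<close> times the shift.\<close>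

definition act :: "'b \<Rightarrow> (nat \<Rightarrow> 'c) \<Rightarrow> nat \<Rightarrow> 'c"
  where "act y w = (\<lambda>k. \<phi> k (y \<ominus>\<^bsub>L\<^esub> l y \<odot>\<^bsub>L\<^esub> x) w \<oplus>\<^bsub>V\<^esub> l y \<odot>\<^bsub>V\<^esub> w (Suc k))"

lemma coeff_closed [simp]: "i < r \<Longrightarrow> c i \<in> carrier F"
  using coeff by auto

lemma Y_closed: "w \<in> Y \<Longrightarrow> w k \<in> carrier V"
  by (simp add: Y_def)

lemma Y_rec: "w \<in> Y \<Longrightarrow> w (k + p ^ r) = (\<Oplus>\<^bsub>V\<^esub>i\<in>{..<r}. c i \<odot>\<^bsub>V\<^esub> w (k + p ^ i))"
  by (simp add: Y_def)

lemma Y_subspace: "subspace F Y (seq_module V)"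
proof -
  interpret S: vectorspace F "seq_module V" by (rule V.seq_vectorspace)
  show ?thesis
  proof (rule S.subspaceI)
    show "Y \<subseteq> carrier (seq_module V)" by (auto simp: Y_def)
    have "(\<Oplus>\<^bsub>V\<^esub>i\<in>{..<r}. c i \<odot>\<^bsub>V\<^esub> \<zero>\<^bsub>V\<^esub>) = (\<Oplus>\<^bsub>V\<^esub>i\<in>{..<r}. \<zero>\<^bsub>V\<^esub>)"
      by (rule V.M.finsum_cong') auto
    then show "\<zero>\<^bsub>seq_module V\<^esub> \<in> Y" by (simp add: Y_def)
  next
    fix v w assume v: "v \<in> Y" and w: "w \<in> Y"
    have "v (k + p ^ r) \<oplus>\<^bsub>V\<^esub> w (k + p ^ r) =
        (\<Oplus>\<^bsub>V\<^esub>i\<in>{..<r}. c i \<odot>\<^bsub>V\<^esub> v (k + p ^ i) \<oplus>\<^bsub>V\<^esub> c i \<odot>\<^bsub>V\<^esub> w (k + p ^ i))" for k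
      unfolding Y_rec[OF v] Y_rec[OF w]
      by (rule V.M.finsum_addf[symmetric]) (auto simp: Y_closed v w)
    also have "\<dots> k = (\<Oplus>\<^bsub>V\<^esub>i\<in>{..<r}. c i \<odot>\<^bsub>V\<^esub> (v (k + p ^ i) \<oplus>\<^bsub>V\<^esub> w (k + p ^ i)))" for k
      by (rule V.M.finsum_cong') (auto simp: Y_closed v w V.smult_r_distr)
    finally show "v \<oplus>\<^bsub>seq_module V\<^esub> w \<in> Y" using v w by (simp add: Y_def)
  next
    fix a w assume a: "a \<in> carrier F" and w: "w \<in> Y"
    have "a \<odot>\<^bsub>V\<^esub> w (k + p ^ r) = (\<Oplus>\<^bsub>V\<^esub>i\<in>{..<r}. a \<odot>\<^bsub>V\<^esub> (c i \<odot>\<^bsub>V\<^esub> w (k + p ^ i)))" for k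
      unfolding Y_rec[OF w] by (rule V.finsum_smult_ldistr) (auto simp: Y_closed w a)
    also have "\<dots> k = (\<Oplus>\<^bsub>V\<^esub>i\<in>{..<r}. c i \<odot>\<^bsub>V\<^esub> (a \<odot>\<^bsub>V\<^esub> w (k + p ^ i)))" for k
      by (rule V.M.finsum_cong')
        (auto simp: Y_closed w a L.R.m_comm simp flip: V.smult_assoc1)
    finally show "a \<odot>\<^bsub>seq_module V\<^esub> w \<in> Y" using a w by (simp add: Y_def)
  qed
qed

lemma W_vectorspace: "vectorspace F W"
  by (rule vectorspace.subspace_is_vs[OF V.seq_vectorspace Y_subspace])

lemma exponent_less: "i < r \<Longrightarrow> p ^ i < p ^ r"
  using prime_gt_1_nat[OF L.characteristic_prime[OF char]] by (rule power_strict_increasing[rotated])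

lemma W_fin_dim: "vectorspace.fin_dim F W"
proof (rule V.seq_subspace_fin_dim[OF fin_dim_V Y_subspace, of "p ^ r"])
  fix w assume w: "w \<in> Y" and 0: "\<And>k. k < p ^ r \<Longrightarrow> w k = \<zero>\<^bsub>V\<^esub>"
  have "w n = \<zero>\<^bsub>V\<^esub>" for n
  proof (induction n rule: less_induct)
    case (less n)
    show ?case
    proof (cases "n < p ^ r")
      case False
      then obtain k where k: "n = k + p ^ r" using le_Suc_ex by (metis add.commute not_le)
      have "w n = (\<Oplus>\<^bsub>V\<^esub>i\<in>{..<r}. \<zero>\<^bsub>V\<^esub>)"
        unfolding k Y_rec[OF w] using less exponent_less
        by (intro V.M.finsum_cong') (auto simp: k)
      then show ?thesis by simp
    qed (rule 0)
  qed
  then show "w = (\<lambda>k. \<zero>\<^bsub>V\<^esub>)" by blast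
qed

lemma shift_Y: "w \<in> Y \<Longrightarrow> (\<lambda>k. w (Suc k)) \<in> Y"
  using Y_rec[of w "Suc _"] by (simp add: Y_def)

text \<open>By \<open>\<phi>_prime_power\<close> the combination of shifts that defines \<open>Y\<close> behaves like a derivation of
  \<open>(m, w)\<close> whose effect on \<open>m\<close> is the corresponding combination of powers of \<open>D\<close>. The latter is zero,
  so the combination of shifts commutes with the action of \<open>m\<close>.\<close>

lemma \<phi>_Y:
  assumes m: "m \<in> M" and w: "w \<in> Y"
  shows "(\<lambda>k. \<phi> k m w) \<in> Y"
proof -
  note pp = \<phi>_prime_power[OF char _ Y_closed]
  note [simp] = Y_closed[OF w]
  have [simp]: "(D ^^ i) m \<in> M" for i by (rule D_pow_M[OF m])
  have "\<phi> (k + p ^ r) m w = (\<Oplus>\<^bsub>V\<^esub>i\<in>{..<r}. c i \<odot>\<^bsub>V\<^esub> \<phi> (k + p ^ i) m w)" for k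
  proof -
    have "\<phi> (k + p ^ r) m w = \<phi> k ((D ^^ (p ^ r)) m) w \<oplus>\<^bsub>V\<^esub> \<phi> k m (\<lambda>j. w (j + p ^ r))"
      by (rule pp[OF m w])
    also have "\<phi> k ((D ^^ (p ^ r)) m) w = (\<Oplus>\<^bsub>V\<^esub>i\<in>{..<r}. \<phi> k (c i \<odot>\<^bsub>L\<^esub> (D ^^ (p ^ i)) m) w)"
      unfolding recurrence[OF m] by (rule conjunct2[OF \<phi>_sum_left]) (auto intro: M_smult)
    also have "\<phi> k m (\<lambda>j. w (j + p ^ r)) = (\<Oplus>\<^bsub>V\<^esub>i\<in>{..<r}. \<phi> k m (\<lambda>j. c i \<odot>\<^bsub>V\<^esub> w (j + p ^ i)))"
      unfolding Y_rec[OF w] by (rule \<phi>_sum_right) (auto simp: m)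
    also have "(\<Oplus>\<^bsub>V\<^esub>i\<in>{..<r}. \<phi> k (c i \<odot>\<^bsub>L\<^esub> (D ^^ (p ^ i)) m) w) \<oplus>\<^bsub>V\<^esub>
        (\<Oplus>\<^bsub>V\<^esub>i\<in>{..<r}. \<phi> k m (\<lambda>j. c i \<odot>\<^bsub>V\<^esub> w (j + p ^ i))) =
        (\<Oplus>\<^bsub>V\<^esub>i\<in>{..<r}. \<phi> k (c i \<odot>\<^bsub>L\<^esub> (D ^^ (p ^ i)) m) w \<oplus>\<^bsub>V\<^esub> \<phi> k m (\<lambda>j. c i \<odot>\<^bsub>V\<^esub> w (j + p ^ i)))"
      by (rule V.M.finsum_addf[symmetric]) (auto intro!: \<phi>_closed M_smult simp: m)
    also have "\<dots> = (\<Oplus>\<^bsub>V\<^esub>i\<in>{..<r}. c i \<odot>\<^bsub>V\<^esub> \<phi> (k + p ^ i) m w)"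
      by (rule V.M.finsum_cong')
        (auto simp: pp[OF m w] \<phi>_smult_left \<phi>_smult_right V.smult_r_distr \<phi>_closed m)
    finally show ?thesis .
  qed
  then show ?thesis by (simp add: Y_def \<phi>_closed m)
qed

lemma project_M: "y \<in> N \<Longrightarrow> y \<ominus>\<^bsub>L\<^esub> l y \<odot>\<^bsub>L\<^esub> x \<in> M"
proof -
  assume y: "y \<in> N"
  have *: "y \<ominus>\<^bsub>L\<^esub> l y \<odot>\<^bsub>L\<^esub> x = y \<oplus>\<^bsub>L\<^esub> (\<ominus>\<^bsub>F\<^esub> l y) \<odot>\<^bsub>L\<^esub> x"
    using y l_closed N_mem x_N by (simp add: a_minus_def L.smult_l_minus)
  have "(\<ominus>\<^bsub>F\<^esub> l y) \<odot>\<^bsub>L\<^esub> x \<in> N" using L.subspace_smult[OF subspace_N] l_closed[OF y] x_N by simp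
  then show ?thesis
    unfolding * M_kernel using y l_closed[OF y] x_N
    by (simp add: L.subspace_add[OF subspace_N] l_add l_smult l_x L.R.r_neg)
qed

lemma decompose: "y \<in> N \<Longrightarrow> y = (y \<ominus>\<^bsub>L\<^esub> l y \<odot>\<^bsub>L\<^esub> x) \<oplus>\<^bsub>L\<^esub> l y \<odot>\<^bsub>L\<^esub> x"
  using N_mem x_N l_closed by simp

lemma project_add:
  assumes y: "y \<in> N" and z: "z \<in> N"
  shows "(y \<oplus>\<^bsub>L\<^esub> z) \<ominus>\<^bsub>L\<^esub> l (y \<oplus>\<^bsub>L\<^esub> z) \<odot>\<^bsub>L\<^esub> x =
    (y \<ominus>\<^bsub>L\<^esub> l y \<odot>\<^bsub>L\<^esub> x) \<oplus>\<^bsub>L\<^esub> (z \<ominus>\<^bsub>L\<^esub> l z \<odot>\<^bsub>L\<^esub> x)"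
  using N_mem[OF y] N_mem[OF z] N_mem[OF x_N] l_closed y z
  by (simp add: l_add a_minus_def L.smult_l_distr L.M.minus_add L.M.a_ac)

lemma project_smult:
  assumes a: "a \<in> carrier F" and y: "y \<in> N"
  shows "a \<odot>\<^bsub>L\<^esub> y \<ominus>\<^bsub>L\<^esub> l (a \<odot>\<^bsub>L\<^esub> y) \<odot>\<^bsub>L\<^esub> x = a \<odot>\<^bsub>L\<^esub> (y \<ominus>\<^bsub>L\<^esub> l y \<odot>\<^bsub>L\<^esub> x)"
  using N_mem[OF y] N_mem[OF x_N] l_closed[OF y] a y
  by (simp add: l_smult a_minus_def L.smult_r_distr L.smult_r_minus L.smult_assoc1)

text \<open>The identity \<open>(m + \<alpha> x)(n + \<beta> x) = m n + \<alpha> D n - \<beta> D m\<close>, with the negative term moved to the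
  left.\<close>

lemma project_mult:
  assumes y: "y \<in> N" and z: "z \<in> N"
  defines "m \<equiv> y \<ominus>\<^bsub>L\<^esub> l y \<odot>\<^bsub>L\<^esub> x" and "n \<equiv> z \<ominus>\<^bsub>L\<^esub> l z \<odot>\<^bsub>L\<^esub> x"
  shows "y \<otimes>\<^bsub>L\<^esub> z \<in> M"
    and "y \<otimes>\<^bsub>L\<^esub> z \<oplus>\<^bsub>L\<^esub> l z \<odot>\<^bsub>L\<^esub> D m = m \<otimes>\<^bsub>L\<^esub> n \<oplus>\<^bsub>L\<^esub> l y \<odot>\<^bsub>L\<^esub> D n"
proof -
  show "y \<otimes>\<^bsub>L\<^esub> z \<in> M" using mult_N[OF y z] l_mult[OF y z] by (simp add: M_kernel)
  have m: "m \<in> M" and n: "n \<in> M" unfolding m_def n_def using project_M y z by auto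
  note [simp] = M_mem[OF m] M_mem[OF n] N_mem[OF x_N] l_closed[OF y] l_closed[OF z]
  have "y \<otimes>\<^bsub>L\<^esub> z = (m \<oplus>\<^bsub>L\<^esub> l y \<odot>\<^bsub>L\<^esub> x) \<otimes>\<^bsub>L\<^esub> (n \<oplus>\<^bsub>L\<^esub> l z \<odot>\<^bsub>L\<^esub> x)"
    unfolding m_def n_def using decompose[OF y] decompose[OF z] by simp
  also have "\<dots> = m \<otimes>\<^bsub>L\<^esub> n \<oplus>\<^bsub>L\<^esub> l z \<odot>\<^bsub>L\<^esub> (m \<otimes>\<^bsub>L\<^esub> x) \<oplus>\<^bsub>L\<^esub> l y \<odot>\<^bsub>L\<^esub> D n"
    by (simp add: L.prod_add_left L.prod_add_right L.prod_smult_left L.prod_smult_right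
        L.alternating L.M.a_ac)
  also have "m \<otimes>\<^bsub>L\<^esub> x = \<ominus>\<^bsub>L\<^esub> D m" by (rule L.anticommutative) simp_all
  finally show "y \<otimes>\<^bsub>L\<^esub> z \<oplus>\<^bsub>L\<^esub> l z \<odot>\<^bsub>L\<^esub> D m = m \<otimes>\<^bsub>L\<^esub> n \<oplus>\<^bsub>L\<^esub> l y \<odot>\<^bsub>L\<^esub> D n"
    by (simp add: L.smult_r_minus L.M.a_ac L.M.r_neg1 L.M.r_neg2 L.M.l_neg L.M.r_neg)
qed

lemma act_Y:
  assumes y: "y \<in> N" and w: "w \<in> Y"
  shows "act y w \<in> Y"
proof -
  interpret S: vectorspace F "seq_module V" by (rule V.seq_vectorspace)
  have "(\<lambda>k. \<phi> k (y \<ominus>\<^bsub>L\<^esub> l y \<odot>\<^bsub>L\<^esub> x) w) \<oplus>\<^bsub>seq_module V\<^esub> l y \<odot>\<^bsub>seq_module V\<^esub> (\<lambda>k. w (Suc k)) \<in> Y"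
    by (intro S.subspace_add[OF Y_subspace] S.subspace_smult[OF Y_subspace]
        \<phi>_Y shift_Y project_M l_closed y w)
  then show ?thesis by (simp add: act_def)
qed

text \<open>The rule for products combines \<open>\<phi>_mult\<close> for the components in \<open>M\<close> with the product rule for the
  shift; the two terms with a double shift agree.\<close>

theorem truncated_coinduction: "lie_representation F L N W act"
proof -
  interpret W: vectorspace F W by (rule W_vectorspace)
  have W: "w \<in> carrier W \<longleftrightarrow> w \<in> Y" for w by simp
  note [simp] = \<phi>_closed Y_closed l_closed project_M D_M
  show ?thesis
  proof (intro lie_representation.intro lie_representation_axioms.intro
      L.lie_algebra_axioms W.vectorspace_axioms)
    fix y assume y: "y \<in> N"
    note [simp] = y
    show "act y \<in> module_hom F W W"
    proof (rule module_homI)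
      show "act y w \<in> carrier W" if "w \<in> carrier W" for w
        using act_Y[OF y] that by simp
    next
      fix v w assume "v \<in> carrier W" "w \<in> carrier W"
      then have [simp]: "v \<in> Y" "w \<in> Y" by auto
      show "act y (v \<oplus>\<^bsub>W\<^esub> w) = act y v \<oplus>\<^bsub>W\<^esub> act y w"
        by (simp add: act_def fun_eq_iff \<phi>_add_right V.smult_r_distr V.M.a_ac)
    next
      fix a w assume [simp]: "a \<in> carrier F" and "w \<in> carrier W"
      then have [simp]: "w \<in> Y" by auto
      show "act y (a \<odot>\<^bsub>W\<^esub> w) = a \<odot>\<^bsub>W\<^esub> act y w"
        by (simp add: act_def fun_eq_iff \<phi>_smult_right V.smult_r_distr L.R.m_comm
            flip: V.smult_assoc1)
    qed
  next
    fix y z w assume [simp]: "y \<in> N" "z \<in> N" and "w \<in> carrier W"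
    then have [simp]: "w \<in> Y" by auto
    show "act (y \<oplus>\<^bsub>L\<^esub> z) w = act y w \<oplus>\<^bsub>W\<^esub> act z w"
      unfolding act_def project_add[OF \<open>y \<in> N\<close> \<open>z \<in> N\<close>]
      by (simp add: fun_eq_iff \<phi>_add_left l_add V.smult_l_distr V.M.a_ac)
  next
    fix a y w assume [simp]: "a \<in> carrier F" "y \<in> N" and "w \<in> carrier W"
    then have [simp]: "w \<in> Y" by auto
    show "act (a \<odot>\<^bsub>L\<^esub> y) w = a \<odot>\<^bsub>W\<^esub> act y w"
      unfolding act_def project_smult[OF \<open>a \<in> carrier F\<close> \<open>y \<in> N\<close>]
      by (simp add: fun_eq_iff \<phi>_smult_left l_smult V.smult_r_distr V.smult_assoc1)
  next
    fix y z w assume y: "y \<in> N" and z: "z \<in> N" and "w \<in> carrier W"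
    then have w: "w \<in> Y" by auto
    define m where "m = y \<ominus>\<^bsub>L\<^esub> l y \<odot>\<^bsub>L\<^esub> x"
    define n where "n = z \<ominus>\<^bsub>L\<^esub> l z \<odot>\<^bsub>L\<^esub> x"
    note yz = project_mult[OF y z, folded m_def n_def]
    have m: "m \<in> M" and n: "n \<in> M" unfolding m_def n_def using y z by auto
    note [simp] = y z w m n yz(1) M_smult mult_M
    let ?S = "\<lambda>w k. w (Suc k)"
    have "act (y \<otimes>\<^bsub>L\<^esub> z) w k \<oplus>\<^bsub>V\<^esub> act z (act y w) k = act y (act z w) k" for k
    proof -
      have 1: "act (y \<otimes>\<^bsub>L\<^esub> z) w k = \<phi> k (y \<otimes>\<^bsub>L\<^esub> z) w"
        using M_mem[OF yz(1)] N_mem[OF x_N]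
      by (simp add: act_def l_mult)
      have 2: "act z (act y w) k = \<phi> k n (\<lambda>k. \<phi> k m w) \<oplus>\<^bsub>V\<^esub> l y \<odot>\<^bsub>V\<^esub> \<phi> k n (?S w) \<oplus>\<^bsub>V\<^esub>
          (l z \<odot>\<^bsub>V\<^esub> \<phi> k (D m) w \<oplus>\<^bsub>V\<^esub> l z \<odot>\<^bsub>V\<^esub> \<phi> k m (?S w) \<oplus>\<^bsub>V\<^esub> (l z \<otimes>\<^bsub>F\<^esub> l y) \<odot>\<^bsub>V\<^esub> w (Suc (Suc k)))"
        unfolding act_def m_def[symmetric] n_def[symmetric]
        by (simp add: \<phi>_add_right \<phi>_smult_right V.smult_r_distr V.smult_assoc1)
      have 3: "act y (act z w) k = \<phi> k m (\<lambda>k. \<phi> k n w) \<oplus>\<^bsub>V\<^esub> l z \<odot>\<^bsub>V\<^esub> \<phi> k m (?S w) \<oplus>\<^bsub>V\<^esub>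
          (l y \<odot>\<^bsub>V\<^esub> \<phi> k (D n) w \<oplus>\<^bsub>V\<^esub> l y \<odot>\<^bsub>V\<^esub> \<phi> k n (?S w) \<oplus>\<^bsub>V\<^esub> (l z \<otimes>\<^bsub>F\<^esub> l y) \<odot>\<^bsub>V\<^esub> w (Suc (Suc k)))"
        unfolding act_def m_def[symmetric] n_def[symmetric]
        by (simp add: \<phi>_add_right \<phi>_smult_right V.smult_r_distr V.smult_assoc1 L.R.m_comm[of "l z" "l y"])
      have 4: "\<phi> k (y \<otimes>\<^bsub>L\<^esub> z) w \<oplus>\<^bsub>V\<^esub> l z \<odot>\<^bsub>V\<^esub> \<phi> k (D m) w = \<phi> k (m \<otimes>\<^bsub>L\<^esub> n) w \<oplus>\<^bsub>V\<^esub> l y \<odot>\<^bsub>V\<^esub> \<phi> k (D n) w"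
        using arg_cong[OF yz(2), of "\<lambda>y. \<phi> k y w"] by (simp add: \<phi>_add_left \<phi>_smult_left)
      have 5: "\<phi> k (m \<otimes>\<^bsub>L\<^esub> n) w \<oplus>\<^bsub>V\<^esub> \<phi> k n (\<lambda>j. \<phi> j m w) = \<phi> k m (\<lambda>j. \<phi> j n w)"
        by (rule \<phi>_mult) auto
      have "act (y \<otimes>\<^bsub>L\<^esub> z) w k \<oplus>\<^bsub>V\<^esub> act z (act y w) k =
          (\<phi> k (y \<otimes>\<^bsub>L\<^esub> z) w \<oplus>\<^bsub>V\<^esub> l z \<odot>\<^bsub>V\<^esub> \<phi> k (D m) w) \<oplus>\<^bsub>V\<^esub> (\<phi> k n (\<lambda>k. \<phi> k m w) \<oplus>\<^bsub>V\<^esub> (l y \<odot>\<^bsub>V\<^esub> \<phi> k n (?S w) \<oplus>\<^bsub>V\<^esub>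
          (l z \<odot>\<^bsub>V\<^esub> \<phi> k m (?S w) \<oplus>\<^bsub>V\<^esub> (l z \<otimes>\<^bsub>F\<^esub> l y) \<odot>\<^bsub>V\<^esub> w (Suc (Suc k)))))"
        unfolding 1 2 by (simp add: V.M.a_ac)
      also have "\<dots> = (\<phi> k (m \<otimes>\<^bsub>L\<^esub> n) w \<oplus>\<^bsub>V\<^esub> \<phi> k n (\<lambda>k. \<phi> k m w)) \<oplus>\<^bsub>V\<^esub> (l y \<odot>\<^bsub>V\<^esub> \<phi> k (D n) w \<oplus>\<^bsub>V\<^esub> (l y \<odot>\<^bsub>V\<^esub> \<phi> k n (?S w) \<oplus>\<^bsub>V\<^esub>
          (l z \<odot>\<^bsub>V\<^esub> \<phi> k m (?S w) \<oplus>\<^bsub>V\<^esub> (l z \<otimes>\<^bsub>F\<^esub> l y) \<odot>\<^bsub>V\<^esub> w (Suc (Suc k)))))"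
        unfolding 4 by (simp add: V.M.a_ac)
      also have "\<dots> = act y (act z w) k"
        unfolding 3 5 by (simp add: V.M.a_ac)
      finally show ?thesis .
    qed
    then show "act (y \<otimes>\<^bsub>L\<^esub> z) w \<oplus>\<^bsub>W\<^esub> act z (act y w) = act y (act z w)"
      by (simp add: fun_eq_iff)
  qed (use subspace_N mult_N W_fin_dim in auto)
qed

text \<open>Evaluation at \<open>0\<close> is a homomorphism of \<open>M\<close>-modules onto \<open>V\<close>. Hence an element of \<open>M\<close> that is not
  nilpotent on \<open>V\<close> is not nilpotent on the coinduced module.\<close>

lemma act_pow_at_0:
  assumes a: "a \<in> M" and w: "w \<in> Y"
  shows "(act a ^^ n) w \<in> Y" and "((act a ^^ n) w) 0 = (\<rho> a ^^ n) (w 0)"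
proof -
  show *: "(act a ^^ n) w \<in> Y" for n
    by (induction n) (auto simp: w act_Y[OF M_N[OF a]])
  have "act a v 0 = \<rho> a (v 0)" if "v \<in> Y" for v
    using a M_mem[OF a] N_mem[OF x_N] Y_closed[OF that] act_closed[OF a]
    by (simp add: act_def M_kernel)
  with * show "((act a ^^ n) w) 0 = (\<rho> a ^^ n) (w 0)" by (induction n) auto
qed

lemma Y_value_at_0:
  assumes "v \<in> carrier V"
  obtains w where "w \<in> Y" and "w 0 = v"
proof -
  have "0 < p ^ r" using char(2) by simp
  from V.ex_recurrent_sequence[OF coeff exponent_less this assms]
  obtain w where "\<forall>k. w k \<in> carrier V" "w 0 = v"
    "\<forall>k. w (k + p ^ r) = (\<Oplus>\<^bsub>V\<^esub>i\<in>{..<r}. c i \<odot>\<^bsub>V\<^esub> w (k + p ^ i))" .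
  then show thesis by (intro that[of w]) (auto simp: Y_def)
qed

end

section \<open>Representations in which a given element is not nilpotent\<close>

definition nilpotent_on :: "('a, 'b, 'c) module_scheme \<Rightarrow> ('b \<Rightarrow> 'b) \<Rightarrow> bool"
  where "nilpotent_on V f \<longleftrightarrow> (\<exists>n. \<forall>v\<in>carrier V. (f ^^ n) v = \<zero>\<^bsub>V\<^esub>)"

lemma module_hom_funpow_closed:
  "f \<in> module_hom K V V \<Longrightarrow> v \<in> carrier V \<Longrightarrow> (f ^^ n) v \<in> carrier V"
  by (induction n) (auto intro: module_hom_mem)

lemma module_hom_funpow: "f \<in> module_hom K V V \<Longrightarrow> f ^^ n \<in> module_hom K V V"
proof (induction n)
  case 0
  show ?case by (simp add: module_hom_def)
next
  case (Suc n)
  then show ?case unfolding funpow.simps by (intro module_hom_comp)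
qed

definition zero_product_algebra :: "('a, 'b, 'c) module_scheme \<Rightarrow> ('a, 'b) module"
  where "zero_product_algebra V = \<lparr>carrier = carrier V, monoid.mult = (\<lambda>_ _. \<zero>\<^bsub>V\<^esub>), one = \<zero>\<^bsub>V\<^esub>,
    zero = \<zero>\<^bsub>V\<^esub>, add = add V, smult = smult V\<rparr>"

text \<open>A vector space becomes an algebra under the zero product, so the corresponding fact for algebras
  applies.\<close>

lemma (in vectorspace) ex_isomorphic_space:
  assumes "fin_dim"
  obtains W :: "'a alg" and f where "vectorspace K W" and "vectorspace.fin_dim K W"
    and "f \<in> module_hom K V W" and "bij_betw f (carrier V) (carrier W)"
proof -
  define V0 where "V0 = zero_product_algebra V"
  note V0_def = V0_def zero_product_algebra_def
  have "abelian_group V0"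
  proof (rule abelian_groupI)
    show "\<exists>y\<in>carrier V0. y \<oplus>\<^bsub>V0\<^esub> x = \<zero>\<^bsub>V0\<^esub>" if "x \<in> carrier V0" for x
      by (rule bexI[of _ "\<ominus>\<^bsub>V\<^esub> x"]) (use that in \<open>auto simp: V0_def M.l_neg\<close>)
  qed (auto simp: V0_def M.a_ac)
  then have "module K V0"
    by (intro moduleI R.is_cring) (auto simp: V0_def smult_l_distr smult_r_distr smult_assoc1)
  then interpret V0: vectorspace K V0 by (intro vectorspace.intro field_axioms)
  have id: "linear_map K V V0 (\<lambda>x. x)"
    by (intro linear_mapI vectorspace_axioms V0.vectorspace_axioms module_homI) (auto simp: V0_def)
  have "V0.fin_dim"
    by (rule linear_map.surj_fin_dim[OF id assms]) (simp add: V0_def)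
  then have "fd_algebra K V0"
    by (intro fd_algebra.intro fd_algebra_axioms.intro V0.vectorspace_axioms) (auto simp: V0_def)
  from ex_isomorphic_fd_algebra[OF this] obtain W :: "'a alg" and f
    where W: "fd_algebra K W" and f: "f \<in> module_hom K V0 W" "bij_betw f (carrier V0) (carrier W)"
    unfolding algebra_isomorphic_def by blast
  show thesis
  proof (rule that)
    show "vectorspace K W" "vectorspace.fin_dim K W"
      using W by (auto simp: fd_algebra_def fd_algebra_axioms_def)
    show "f \<in> module_hom K V W" "bij_betw f (carrier V) (carrier W)"
      using f by (auto simp: module_hom_def V0_def)
  qed
qed

text \<open>Coinduction turns a module into a module of sequences, of a different type. An isomorphic copy of
  a fixed type makes the construction iterable.\<close>

lemma (in lie_representation) ex_isomorphic_representation: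
  obtains W :: "'a alg" and \<sigma> where "lie_representation F L M W \<sigma>"
    and "\<forall>a\<in>M. nilpotent_on W (\<sigma> a) \<longrightarrow> nilpotent_on V (\<rho> a)"
proof -
  obtain W :: "'a alg" and f where W: "vectorspace F W" "vectorspace.fin_dim F W"
    and f: "f \<in> module_hom F V W" and bij: "bij_betw f (carrier V) (carrier W)"
    using V.ex_isomorphic_space[OF fin_dim_V] .
  interpret W: vectorspace F W by (rule W(1))
  define g where "g = inv_into (carrier V) f"
  have g: "g w \<in> carrier V" "f (g w) = w" if "w \<in> carrier W" for w
    using bij that by (auto simp: g_def bij_betw_def inv_into_into f_inv_into_f)
  have gf: "g (f v) = v" if "v \<in> carrier V" for v
    using bij that by (simp add: g_def bij_betw_def)
  note fc = module_hom_mem[OF f] and fadd = module_hom_add[OF f] and fsm = module_hom_smult[OF f]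
  have gadd: "g (v \<oplus>\<^bsub>W\<^esub> w) = g v \<oplus>\<^bsub>V\<^esub> g w" if "v \<in> carrier W" "w \<in> carrier W" for v w
    using gf[of "g v \<oplus>\<^bsub>V\<^esub> g w"] that by (simp add: fadd g)
  have gsm: "g (c \<odot>\<^bsub>W\<^esub> w) = c \<odot>\<^bsub>V\<^esub> g w" if "c \<in> carrier F" "w \<in> carrier W" for c w
    using gf[of "c \<odot>\<^bsub>V\<^esub> g w"] that by (simp add: fsm g)
  have f0: "v = \<zero>\<^bsub>V\<^esub>" if "v \<in> carrier V" "f v = \<zero>\<^bsub>W\<^esub>" for v
    using bij that linear_map.T0_is_0[OF linear_mapI[OF V.vectorspace_axioms W(1) f]] V.M.zero_closed
    unfolding bij_betw_def inj_on_def by metis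
  define \<sigma> where "\<sigma> y w = f (\<rho> y (g w))" for y w
  have rep: "lie_representation F L M W \<sigma>"
  proof (intro lie_representation.intro lie_representation_axioms.intro L.lie_algebra_axioms W)
    show "\<sigma> x \<in> module_hom F W W" if "x \<in> M" for x
      using that by (intro module_homI)
        (simp_all add: \<sigma>_def g gadd gsm fc fadd fsm act_add_right act_smult_right)
  qed (simp_all add: \<sigma>_def g gf fc act_add act_smult flip: fadd fsm add: act_mult subspace_M mult_M)
  have pow: "(\<sigma> a ^^ n) (f v) = f ((\<rho> a ^^ n) v)" if "a \<in> M" "v \<in> carrier V" for a n v
    by (induction n) (simp_all add: \<sigma>_def gf module_hom_funpow_closed[OF act_hom] that)
  show thesis
  proof (rule that[OF rep], intro ballI impI)
    fix a assume a: "a \<in> M" and "nilpotent_on W (\<sigma> a)"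
    then obtain n where n: "\<And>w. w \<in> carrier W \<Longrightarrow> (\<sigma> a ^^ n) w = \<zero>\<^bsub>W\<^esub>"
      by (auto simp: nilpotent_on_def)
    have "(\<rho> a ^^ n) v = \<zero>\<^bsub>V\<^esub>" if v: "v \<in> carrier V" for v
      using n[OF fc[OF v]] pow[OF a v] f0 module_hom_funpow_closed[OF act_hom[OF a] v] by metis
    then show "nilpotent_on V (\<rho> a)" by (auto simp: nilpotent_on_def)
  qed
qed

text \<open>A linear functional that vanishes on products is a one-dimensional representation.\<close>

lemma (in lie_algebra) functional_representation:
  assumes N: "subspace F N L" and mult: "\<And>y z. y \<in> N \<Longrightarrow> z \<in> N \<Longrightarrow> y \<otimes>\<^bsub>L\<^esub> z \<in> N"
    and hom: "l \<in> module_hom F L (scalar_module F)"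
    and prods: "\<And>y z. y \<in> N \<Longrightarrow> z \<in> N \<Longrightarrow> l (y \<otimes>\<^bsub>L\<^esub> z) = \<zero>\<^bsub>F\<^esub>"
  obtains V :: "('a, 'a) module" and \<rho> where "lie_representation F L N V \<rho>"
    and "\<forall>a\<in>N. nilpotent_on V (\<rho> a) \<longrightarrow> l a = \<zero>\<^bsub>F\<^esub>"
proof -
  have l: "l y \<in> carrier F" "z \<in> N \<Longrightarrow> l (y \<oplus>\<^bsub>L\<^esub> z) = l y \<oplus>\<^bsub>F\<^esub> l z"
    "c \<in> carrier F \<Longrightarrow> l (c \<odot>\<^bsub>L\<^esub> y) = c \<otimes>\<^bsub>F\<^esub> l y" if "y \<in> N" for y z c
    using subspace_mem[OF N] that hom by (auto simp: module_hom_def)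
  define V where "V = scalar_module F"
  have "abelian_group V"
  proof (rule abelian_groupI)
    show "\<exists>y\<in>carrier V. y \<oplus>\<^bsub>V\<^esub> x = \<zero>\<^bsub>V\<^esub>" if "x \<in> carrier V" for x
      by (rule bexI[of _ "\<ominus>\<^bsub>F\<^esub> x"]) (use that in \<open>auto simp: V_def R.l_neg\<close>)
  qed (auto simp: V_def R.a_ac)
  then have "module F V"
    by (intro moduleI R.is_cring) (auto simp: V_def R.l_distr R.r_distr R.m_assoc)
  then interpret V: vectorspace F V by (intro vectorspace.intro field_axioms)
  have one: "{\<one>\<^bsub>F\<^esub>} \<subseteq> carrier V" by (simp add: V_def)
  have "v \<in> V.span {\<one>\<^bsub>F\<^esub>}" if "v \<in> carrier V" for v
  proof -
    have "v \<odot>\<^bsub>V\<^esub> \<one>\<^bsub>F\<^esub> \<in> V.span {\<one>\<^bsub>F\<^esub>}"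
      by (rule V.subspace_smult[OF V.span_is_subspace[OF one] _ V.span_generators[OF one]])
        (use that in \<open>auto simp: V_def\<close>)
    then show ?thesis using that by (simp add: V_def)
  qed
  then have "V.fin_dim"
    unfolding V.fin_dim_def using one V.span_closed[OF one] by (intro exI[of _ "{\<one>\<^bsub>F\<^esub>}"]) auto
  define \<rho> where "\<rho> y v = l y \<otimes>\<^bsub>F\<^esub> v" for y v
  have rep: "lie_representation F L N V \<rho>"
  proof (intro lie_representation.intro lie_representation_axioms.intro lie_algebra_axioms
      V.vectorspace_axioms N \<open>V.fin_dim\<close>)
    show "\<rho> x \<in> module_hom F V V" if "x \<in> N" for x
      using that by (intro module_homI) (simp_all add: \<rho>_def V_def l R.r_distr R.m_lcomm)
  qed (simp_all add: \<rho>_def V_def l prods mult R.l_distr R.m_assoc R.m_lcomm)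
  show thesis
  proof (rule that[OF rep], intro ballI impI)
    fix a assume a: "a \<in> N" and "nilpotent_on V (\<rho> a)"
    then obtain n where n: "(\<rho> a ^^ n) \<one>\<^bsub>F\<^esub> = \<zero>\<^bsub>F\<^esub>"
      by (auto simp: nilpotent_on_def V_def)
    show "l a = \<zero>\<^bsub>F\<^esub>"
    proof (rule ccontr)
      assume "l a \<noteq> \<zero>\<^bsub>F\<^esub>"
      then have "(\<rho> a ^^ k) \<one>\<^bsub>F\<^esub> \<in> carrier F - {\<zero>\<^bsub>F\<^esub>}" for k
        by (induction k) (use l(1)[OF a] integral in \<open>auto simp: \<rho>_def\<close>)
      with n show False by blast
    qed
  qed
qed

text \<open>A subspace spanned by products of its own elements is contained in every term of the derived
  series.\<close>

lemma (in lie_algebra) soluble_imp_not_perfect: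
  assumes sol: "soluble F L" and N: "subspace F N L" "N \<subseteq> span {x \<otimes>\<^bsub>L\<^esub> y | x y. x \<in> N \<and> y \<in> N}"
  shows "N = {\<zero>\<^bsub>L\<^esub>}"
proof -
  have "N \<subseteq> derived_series F L n" for n
  proof (induction n)
    case 0
    then show ?case using subspace_subset[OF N(1)] by simp
  next
    case (Suc n)
    have "span {x \<otimes>\<^bsub>L\<^esub> y | x y. x \<in> N \<and> y \<in> N} \<subseteq> derived_series F L (Suc n)"
      unfolding derived_series.simps by (rule span_is_monotone) (use Suc in blast)
    then show ?case using N(2) by blast
  qed
  moreover obtain n where "derived_series F L n = {\<zero>\<^bsub>L\<^esub>}" using sol by (auto simp: soluble_def)
  ultimately show ?thesis using subspace_zero[OF N(1)] by blast
qed

text \<open>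
  The induction runs over all subalgebras \<open>N\<close> that contain \<open>a\<close>. By solubility the products in \<open>N\<close> do
  not span \<open>N\<close>, so there is a non-zero functional \<open>l\<close> on \<open>N\<close> that vanishes on products. Either
  \<open>l a \<noteq> 0\<close> and \<open>l\<close> itself is the representation, or \<open>a\<close> lies in the kernel of \<open>l\<close>, a smaller
  subalgebra whose representation is coinduced to \<open>N\<close>.
\<close>

theorem (in lie_algebra) ex_nonnilpotent_representation:
  assumes char: "ring_characteristic F = p" "p \<noteq> 0" and sol: "soluble F L"
    and a: "a \<in> carrier L" "a \<noteq> \<zero>\<^bsub>L\<^esub>"
  obtains V :: "'a alg" and \<rho> where "lie_representation F L (carrier L) V \<rho>" and "\<not> nilpotent_on V (\<rho> a)"
proof -
  obtain \<mu> :: "'b set \<Rightarrow> nat"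
    where \<mu>: "\<And>A B. subspace F A L \<Longrightarrow> subspace F B L \<Longrightarrow> A \<subset> B \<Longrightarrow> \<mu> A < \<mu> B"
    using ex_dimension_function[OF finite_dimensional] by metis
  have "\<exists>(V :: 'a alg) \<rho>. lie_representation F L N V \<rho> \<and> \<not> nilpotent_on V (\<rho> a)"
    if "subspace F N L" "\<And>y z. y \<in> N \<Longrightarrow> z \<in> N \<Longrightarrow> y \<otimes>\<^bsub>L\<^esub> z \<in> N" "a \<in> N" for N
    using that
  proof (induction "\<mu> N" arbitrary: N rule: less_induct)
    case less
    note N = less.prems(1) and mult = less.prems(2)
    note mem = subspace_mem[OF N]
    let ?T = "span {x \<otimes>\<^bsub>L\<^esub> y | x y. x \<in> N \<and> y \<in> N}"
    have prods: "{x \<otimes>\<^bsub>L\<^esub> y | x y. x \<in> N \<and> y \<in> N} \<subseteq> carrier L" using mem by auto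
    have "\<not> N \<subseteq> ?T" using soluble_imp_not_perfect[OF sol N] a(2) less.prems(3) by blast
    then obtain x where x: "x \<in> N" "x \<notin> ?T" by blast
    obtain l where lhom: "l \<in> module_hom F L (scalar_module F)"
      and lT: "\<forall>v\<in>?T. l v = \<zero>\<^bsub>F\<^esub>" and lx: "l x = \<one>\<^bsub>F\<^esub>"
      by (rule ex_separating_functional[OF finite_dimensional span_is_subspace[OF prods] mem[OF x(1)] x(2)])
    note l = module_hom_mem[OF lhom, simplified] module_hom_add[OF lhom, simplified]
      module_hom_smult[OF lhom, simplified]
    have lm: "l (y \<otimes>\<^bsub>L\<^esub> z) = \<zero>\<^bsub>F\<^esub>" if "y \<in> N" "z \<in> N" for y z
      by (rule bspec[OF lT], rule span_generators[OF prods]) (use that in blast)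
    show ?case
    proof (cases "l a = \<zero>\<^bsub>F\<^esub>")
      case False
      obtain V :: "('a, 'a) module" and \<rho> where V: "lie_representation F L N V \<rho>"
        "\<forall>a\<in>N. nilpotent_on V (\<rho> a) \<longrightarrow> l a = \<zero>\<^bsub>F\<^esub>"
        by (rule functional_representation[OF N mult lhom lm])
      obtain V' :: "'a alg" and \<sigma> where "lie_representation F L N V' \<sigma>"
        "\<forall>a\<in>N. nilpotent_on V' (\<sigma> a) \<longrightarrow> nilpotent_on V (\<rho> a)"
        by (rule lie_representation.ex_isomorphic_representation[OF V(1)])
      then show ?thesis using V(2) False less.prems(3) by blast
    next
      case True
      define M where "M = {y \<in> N. l y = \<zero>\<^bsub>F\<^esub>}"
      have l0: "l \<zero>\<^bsub>L\<^esub> = \<zero>\<^bsub>F\<^esub>"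
        using l(3)[of "\<zero>\<^bsub>F\<^esub>" "\<zero>\<^bsub>L\<^esub>"] l(1)[of "\<zero>\<^bsub>L\<^esub>"] by simp
      have M: "subspace F M L"
        by (rule subspaceI)
          (use mem l l0 subspace_zero[OF N] subspace_add[OF N] subspace_smult[OF N] in \<open>auto simp: M_def\<close>)
      have multM: "y \<otimes>\<^bsub>L\<^esub> z \<in> M" if "y \<in> M" "z \<in> M" for y z
        using that mult lm by (auto simp: M_def)
      have "x \<notin> M" using lx by (simp add: M_def)
      then have "M \<subset> N" using x(1) by (auto simp: M_def)
      moreover have aM: "a \<in> M" using True less.prems(3) by (simp add: M_def)
      ultimately obtain V :: "'a alg" and \<rho> where V: "lie_representation F L M V \<rho>" "\<not> nilpotent_on V (\<rho> a)"
        using less.hyps[OF \<mu>[OF M N] M multM] by blast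
      have xL: "x \<in> carrier L" by (rule mem[OF x(1)])
      have D: "(\<lambda>m. x \<otimes>\<^bsub>L\<^esub> m) ^^ n \<in> module_hom F L L" for n
        by (intro module_hom_funpow module_homI)
          (use xL in \<open>auto simp: prod_add_right prod_smult_right\<close>)
      obtain r c where c: "c \<in> {..<r} \<rightarrow> carrier F" and rec: "\<And>m. m \<in> carrier L \<Longrightarrow>
          ((\<lambda>m. x \<otimes>\<^bsub>L\<^esub> m) ^^ (p ^ r)) m = (\<Oplus>\<^bsub>L\<^esub>i\<in>{..<r::nat}. c i \<odot>\<^bsub>L\<^esub> ((\<lambda>m. x \<otimes>\<^bsub>L\<^esub> m) ^^ (p ^ i)) m)"
        by (rule ex_operator_recurrence[OF finite_dimensional, of "\<lambda>i. (\<lambda>m. x \<otimes>\<^bsub>L\<^esub> m) ^^ (p ^ i)"])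
          (use D in auto)
      interpret T: truncated_coinduction F L M V \<rho> x N l p r c
      proof (intro truncated_coinduction.intro coinduction.intro coinduction_axioms.intro
          truncated_coinduction_axioms.intro V(1) N x(1) lx M_def char c)
        show "y \<otimes>\<^bsub>L\<^esub> z \<in> N" if "y \<in> N" "z \<in> N" for y z by (rule mult[OF that])
        show "l y \<in> carrier F" if "y \<in> N" for y by (rule l(1)[OF mem[OF that]])
        show "l (y \<oplus>\<^bsub>L\<^esub> z) = l y \<oplus>\<^bsub>F\<^esub> l z" if "y \<in> N" "z \<in> N" for y z
          by (rule l(2)[OF mem[OF that(1)] mem[OF that(2)]])
        show "l (b \<odot>\<^bsub>L\<^esub> y) = b \<otimes>\<^bsub>F\<^esub> l y" if "b \<in> carrier F" "y \<in> N" for b y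
          by (rule l(3)[OF that(1) mem[OF that(2)]])
        show "l (y \<otimes>\<^bsub>L\<^esub> z) = \<zero>\<^bsub>F\<^esub>" if "y \<in> N" "z \<in> N" for y z by (rule lm[OF that])
        show "((\<lambda>m. x \<otimes>\<^bsub>L\<^esub> m) ^^ (p ^ r)) m = (\<Oplus>\<^bsub>L\<^esub>i\<in>{..<r}. c i \<odot>\<^bsub>L\<^esub> ((\<lambda>m. x \<otimes>\<^bsub>L\<^esub> m) ^^ (p ^ i)) m)"
          if "m \<in> M" for m
          by (rule rec[OF subspace_mem[OF M that]])
      qed
      have "\<not> nilpotent_on T.W (T.act a)"
      proof
        assume "nilpotent_on T.W (T.act a)"
        then obtain n where n: "\<And>w. w \<in> T.Y \<Longrightarrow> (T.act a ^^ n) w = (\<lambda>k. \<zero>\<^bsub>V\<^esub>)"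
          by (auto simp: nilpotent_on_def)
        have "(\<rho> a ^^ n) v = \<zero>\<^bsub>V\<^esub>" if "v \<in> carrier V" for v
        proof -
          obtain w where "w \<in> T.Y" "w 0 = v" using T.Y_value_at_0[OF \<open>v \<in> carrier V\<close>] .
          then show ?thesis using T.act_pow_at_0(2)[OF aM, of w n] n by simp
        qed
        then show False using V(2) by (auto simp: nilpotent_on_def)
      qed
      moreover obtain V' :: "'a alg" and \<sigma> where "lie_representation F L N V' \<sigma>"
        "\<forall>a\<in>N. nilpotent_on V' (\<sigma> a) \<longrightarrow> nilpotent_on T.W (T.act a)"
        by (rule lie_representation.ex_isomorphic_representation[OF T.truncated_coinduction])
      ultimately show ?thesis using less.prems(3) by blast
    qed
  qed
  from this[OF subspace_carrier prod_closed a(1)] that show thesis by blast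
qed

section \<open>Homomorphisms, ideals and quotients of algebras\<close>

definition surjective_hom ::
    "('a, 'm) ring_scheme \<Rightarrow> ('a, 'b) module \<Rightarrow> ('a, 'c) module \<Rightarrow> ('b \<Rightarrow> 'c) \<Rightarrow> bool"
  where "surjective_hom F L M f \<longleftrightarrow> f \<in> module_hom F L M \<and>
    (\<forall>x\<in>carrier L. \<forall>y\<in>carrier L. f (x \<otimes>\<^bsub>L\<^esub> y) = f x \<otimes>\<^bsub>M\<^esub> f y) \<and>
    f ` carrier L = carrier M"

lemma surjective_homD:
  assumes "surjective_hom F L M f"
  shows "f \<in> module_hom F L M"
    and "x \<in> carrier L \<Longrightarrow> f x \<in> carrier M"
    and "x \<in> carrier L \<Longrightarrow> y \<in> carrier L \<Longrightarrow> f (x \<oplus>\<^bsub>L\<^esub> y) = f x \<oplus>\<^bsub>M\<^esub> f y"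
    and "c \<in> carrier F \<Longrightarrow> x \<in> carrier L \<Longrightarrow> f (c \<odot>\<^bsub>L\<^esub> x) = c \<odot>\<^bsub>M\<^esub> f x"
    and "x \<in> carrier L \<Longrightarrow> y \<in> carrier L \<Longrightarrow> f (x \<otimes>\<^bsub>L\<^esub> y) = f x \<otimes>\<^bsub>M\<^esub> f y"
    and "f ` carrier L = carrier M"
  using assms by (auto simp: surjective_hom_def module_hom_def)

lemma surjective_hom_comp:
  assumes "surjective_hom F L M f" and "surjective_hom F M N g"
  shows "surjective_hom F L N (\<lambda>x. g (f x))"
proof -
  have "(\<lambda>x. g (f x)) ` carrier L = carrier N"
    using surjective_homD(6)[OF assms(1)] surjective_homD(6)[OF assms(2)] by (simp flip: image_image)
  then show ?thesis
    unfolding surjective_hom_def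
    by (auto intro!: module_homI simp: surjective_homD[OF assms(1)] surjective_homD[OF assms(2)])
qed

lemma algebra_isomorphic_iff:
  "algebra_isomorphic F L M \<longleftrightarrow> (\<exists>f. surjective_hom F L M f \<and> inj_on f (carrier L))"
  by (auto simp: algebra_isomorphic_def surjective_hom_def bij_betw_def)

lemma algebra_isomorphic_trans:
  assumes "algebra_isomorphic F L M" and "algebra_isomorphic F M N"
  shows "algebra_isomorphic F L N"
proof -
  obtain f g where f: "surjective_hom F L M f" "inj_on f (carrier L)"
    and g: "surjective_hom F M N g" "inj_on g (carrier M)"
    using assms unfolding algebra_isomorphic_iff by blast
  have "inj_on (\<lambda>x. g (f x)) (carrier L)"
    using comp_inj_on[of f "carrier L" g] f g surjective_homD(6)[OF f(1)] by (simp add: comp_def)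
  then show ?thesis
    using surjective_hom_comp[OF f(1) g(1)] unfolding algebra_isomorphic_iff by blast
qed

text \<open>Two homomorphic images with the same fibres are isomorphic. Stated for arbitrary records \<open>M\<close> and \<open>N\<close>,
  this applies to quotients before they are known to be algebras.\<close>

lemma isomorphic_images:
  assumes f: "surjective_hom F L M f" and g: "surjective_hom F L N g"
    and eq: "\<And>x y. x \<in> carrier L \<Longrightarrow> y \<in> carrier L \<Longrightarrow> f x = f y \<longleftrightarrow> g x = g y"
    and closed: "\<And>x y. x \<in> carrier L \<Longrightarrow> y \<in> carrier L \<Longrightarrow> x \<oplus>\<^bsub>L\<^esub> y \<in> carrier L"
      "\<And>c x. c \<in> carrier F \<Longrightarrow> x \<in> carrier L \<Longrightarrow> c \<odot>\<^bsub>L\<^esub> x \<in> carrier L"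
      "\<And>x y. x \<in> carrier L \<Longrightarrow> y \<in> carrier L \<Longrightarrow> x \<otimes>\<^bsub>L\<^esub> y \<in> carrier L"
  shows "algebra_isomorphic F M N"
proof -
  define h where "h m = g (inv_into (carrier L) f m)" for m
  have hf: "h (f x) = g x" if "x \<in> carrier L" for x
  proof -
    have "inv_into (carrier L) f (f x) \<in> carrier L" "f (inv_into (carrier L) f (f x)) = f x"
      using that by (auto intro: inv_into_into f_inv_into_f)
    then show ?thesis using eq that by (simp add: h_def)
  qed
  have M: "\<exists>x\<in>carrier L. m = f x" if "m \<in> carrier M" for m
    using that surjective_homD(6)[OF f] by blast
  note fD = surjective_homD[OF f] and gD = surjective_homD[OF g]
  have "h \<in> module_hom F M N"
  proof (rule module_homI)
    show "h m \<in> carrier N" if "m \<in> carrier M" for m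
      using M[OF that] gD(2) hf by auto
  next
    fix m n assume "m \<in> carrier M" "n \<in> carrier M"
    then obtain x y where xy: "x \<in> carrier L" "y \<in> carrier L" "m = f x" "n = f y" using M by blast
    then show "h (m \<oplus>\<^bsub>M\<^esub> n) = h m \<oplus>\<^bsub>N\<^esub> h n"
      using hf[OF closed(1)[OF xy(1,2)]] by (simp add: hf fD(3) gD(3))
  next
    fix c m assume c: "c \<in> carrier F" and "m \<in> carrier M"
    then obtain x where x: "x \<in> carrier L" "m = f x" using M by blast
    then show "h (c \<odot>\<^bsub>M\<^esub> m) = c \<odot>\<^bsub>N\<^esub> h m"
      using hf[OF closed(2)[OF c x(1)]] c by (simp add: hf fD(4) gD(4))
  qed
  moreover have "h (m \<otimes>\<^bsub>M\<^esub> n) = h m \<otimes>\<^bsub>N\<^esub> h n"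
    if m: "m \<in> carrier M" and n: "n \<in> carrier M" for m n
  proof -
    obtain x y where xy: "x \<in> carrier L" "y \<in> carrier L" "m = f x" "n = f y"
      using M[OF m] M[OF n] by blast
    then show ?thesis
      using hf[OF closed(3)[OF xy(1,2)]] by (simp add: hf fD(5) gD(5))
  qed
  moreover have "h ` carrier M = carrier N"
  proof -
    have "h ` carrier M = (\<lambda>x. h (f x)) ` carrier L" by (simp flip: fD(6) add: image_image)
    also have "\<dots> = g ` carrier L" using hf by (intro image_cong) auto
    finally show ?thesis using gD(6) by simp
  qed
  moreover have "inj_on h (carrier M)"
  proof (rule inj_onI)
    fix m n assume mn: "m \<in> carrier M" "n \<in> carrier M" "h m = h n"
    then obtain x y where "x \<in> carrier L" "y \<in> carrier L" "m = f x" "n = f y" using M by blast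
    then show "m = n" using mn(3) eq by (simp add: hf)
  qed
  ultimately show ?thesis unfolding algebra_isomorphic_iff surjective_hom_def by blast
qed

context fd_algebra_module
begin

lemma ideal_subspace: "algebra_ideal F L A \<Longrightarrow> subspace F A L"
  and ideal_mult_left: "algebra_ideal F L A \<Longrightarrow> x \<in> carrier L \<Longrightarrow> a \<in> A \<Longrightarrow> x \<otimes>\<^bsub>L\<^esub> a \<in> A"
  and ideal_mult_right: "algebra_ideal F L A \<Longrightarrow> x \<in> carrier L \<Longrightarrow> a \<in> A \<Longrightarrow> a \<otimes>\<^bsub>L\<^esub> x \<in> A"
  by (auto simp: algebra_ideal_def)

end

lemma quotient_algebra_simps:
  "carrier (quotient_algebra L A) = (\<lambda>x. A +>\<^bsub>L\<^esub> x) ` carrier L"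
  "x \<oplus>\<^bsub>quotient_algebra L A\<^esub> y = set_add L x y"
  "x \<otimes>\<^bsub>quotient_algebra L A\<^esub> y = rcoset_mult L A x y"
  "c \<odot>\<^bsub>quotient_algebra L A\<^esub> x = (\<Union>z\<in>x. A +>\<^bsub>L\<^esub> (c \<odot>\<^bsub>L\<^esub> z))"
  by (auto simp: quotient_algebra_def A_RCOSETS_def')

text \<open>Membership in a coset as congruence modulo \<open>A\<close> reduces the operations on cosets to the
  compatibility of the congruence with the operations of \<open>L\<close>.\<close>

lemma (in fd_algebra_module) mem_coset_iff:
  assumes A: "subspace F A L" and x: "x \<in> carrier L"
  shows "y \<in> A +>\<^bsub>L\<^esub> x \<longleftrightarrow> y \<in> carrier L \<and> y \<ominus>\<^bsub>L\<^esub> x \<in> A"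
proof
  assume "y \<in> A +>\<^bsub>L\<^esub> x"
  then obtain a where a: "a \<in> A" "y = a \<oplus>\<^bsub>L\<^esub> x" by (auto simp: a_r_coset_def')
  moreover have "a \<in> carrier L" by (rule subspace_mem[OF A a(1)])
  ultimately show "y \<in> carrier L \<and> y \<ominus>\<^bsub>L\<^esub> x \<in> A"
    using x by (simp add: a_minus_def M.a_assoc M.r_neg)
next
  assume "y \<in> carrier L \<and> y \<ominus>\<^bsub>L\<^esub> x \<in> A"
  moreover from this have "y = (y \<ominus>\<^bsub>L\<^esub> x) \<oplus>\<^bsub>L\<^esub> x" using x by simp
  ultimately show "y \<in> A +>\<^bsub>L\<^esub> x" by (auto simp: a_r_coset_def')
qed

lemma (in fd_algebra_module) coset_eq_iff:
  assumes A: "subspace F A L" and x: "x \<in> carrier L" and y: "y \<in> carrier L"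
  shows "A +>\<^bsub>L\<^esub> x = A +>\<^bsub>L\<^esub> y \<longleftrightarrow> x \<ominus>\<^bsub>L\<^esub> y \<in> A"
proof
  have "x \<in> A +>\<^bsub>L\<^esub> x" using x subspace_zero[OF A] by (simp add: mem_coset_iff[OF A])
  moreover assume "A +>\<^bsub>L\<^esub> x = A +>\<^bsub>L\<^esub> y"
  ultimately show "x \<ominus>\<^bsub>L\<^esub> y \<in> A" using mem_coset_iff[OF A y, of x] by simp
next
  assume xy: "x \<ominus>\<^bsub>L\<^esub> y \<in> A"
  have yx: "y \<ominus>\<^bsub>L\<^esub> x \<in> A"
    using subspace_minus[OF A subspace_zero[OF A] xy] x y by (simp add: a_minus_def M.minus_add M.a_comm)
  have "z \<ominus>\<^bsub>L\<^esub> x \<in> A \<longleftrightarrow> z \<ominus>\<^bsub>L\<^esub> y \<in> A" if z: "z \<in> carrier L" for z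
    using subspace_add[OF A _ xy, of "z \<ominus>\<^bsub>L\<^esub> x"] subspace_add[OF A _ yx, of "z \<ominus>\<^bsub>L\<^esub> y"]
    by (auto simp: minus_add_cancel_middle x y z)
  then show "A +>\<^bsub>L\<^esub> x = A +>\<^bsub>L\<^esub> y"
    by (auto simp: mem_coset_iff[OF A] x y)
qed

lemma (in fd_algebra_module) coset_map_surjective_hom:
  assumes I: "algebra_ideal F L A"
  shows "surjective_hom F L (quotient_algebra L A) (\<lambda>x. A +>\<^bsub>L\<^esub> x)"
proof -
  note A = ideal_subspace[OF I]
  note mc = mem_coset_iff[OF A] and ce = coset_eq_iff[OF A]
  have self: "x \<in> A +>\<^bsub>L\<^esub> x" if "x \<in> carrier L" for x
    using that subspace_zero[OF A] by (simp add: mc)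
  have add: "A +>\<^bsub>L\<^esub> (x \<oplus>\<^bsub>L\<^esub> y) = set_add L (A +>\<^bsub>L\<^esub> x) (A +>\<^bsub>L\<^esub> y)"
    if x: "x \<in> carrier L" and y: "y \<in> carrier L" for x y
  proof
    show "A +>\<^bsub>L\<^esub> (x \<oplus>\<^bsub>L\<^esub> y) \<subseteq> set_add L (A +>\<^bsub>L\<^esub> x) (A +>\<^bsub>L\<^esub> y)"
    proof
      fix z assume "z \<in> A +>\<^bsub>L\<^esub> (x \<oplus>\<^bsub>L\<^esub> y)"
      then obtain a where a: "a \<in> A" "z = a \<oplus>\<^bsub>L\<^esub> (x \<oplus>\<^bsub>L\<^esub> y)" by (auto simp: a_r_coset_def')
      then have "z = (a \<oplus>\<^bsub>L\<^esub> x) \<oplus>\<^bsub>L\<^esub> y" using subspace_mem[OF A] x y by (simp add: M.a_assoc)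
      moreover have "a \<oplus>\<^bsub>L\<^esub> x \<in> A +>\<^bsub>L\<^esub> x" using a(1) by (auto simp: a_r_coset_def')
      ultimately show "z \<in> set_add L (A +>\<^bsub>L\<^esub> x) (A +>\<^bsub>L\<^esub> y)"
        using self[OF y] by (auto simp: set_add_def')
    qed
    show "set_add L (A +>\<^bsub>L\<^esub> x) (A +>\<^bsub>L\<^esub> y) \<subseteq> A +>\<^bsub>L\<^esub> (x \<oplus>\<^bsub>L\<^esub> y)"
    proof
      fix z assume "z \<in> set_add L (A +>\<^bsub>L\<^esub> x) (A +>\<^bsub>L\<^esub> y)"
      then obtain a b where ab: "a \<in> A" "b \<in> A" "z = (a \<oplus>\<^bsub>L\<^esub> x) \<oplus>\<^bsub>L\<^esub> (b \<oplus>\<^bsub>L\<^esub> y)"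
        by (auto simp: set_add_def' a_r_coset_def')
      then have "z = (a \<oplus>\<^bsub>L\<^esub> b) \<oplus>\<^bsub>L\<^esub> (x \<oplus>\<^bsub>L\<^esub> y)"
        using subspace_mem[OF A] x y by (simp add: M.a_ac)
      then show "z \<in> A +>\<^bsub>L\<^esub> (x \<oplus>\<^bsub>L\<^esub> y)"
        using subspace_add[OF A ab(1,2)] by (auto simp: a_r_coset_def')
    qed
  qed
  have mult: "A +>\<^bsub>L\<^esub> (x \<otimes>\<^bsub>L\<^esub> y) = rcoset_mult L A (A +>\<^bsub>L\<^esub> x) (A +>\<^bsub>L\<^esub> y)"
    if x: "x \<in> carrier L" and y: "y \<in> carrier L" for x y
  proof -
    have "A +>\<^bsub>L\<^esub> (u \<otimes>\<^bsub>L\<^esub> v) = A +>\<^bsub>L\<^esub> (x \<otimes>\<^bsub>L\<^esub> y)"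
      if "u \<in> A +>\<^bsub>L\<^esub> x" "v \<in> A +>\<^bsub>L\<^esub> y" for u v
    proof -
      have uv: "u \<in> carrier L" "u \<ominus>\<^bsub>L\<^esub> x \<in> A" "v \<in> carrier L" "v \<ominus>\<^bsub>L\<^esub> y \<in> A"
        using that by (auto simp: mc x y)
      have "u \<otimes>\<^bsub>L\<^esub> (v \<ominus>\<^bsub>L\<^esub> y) \<oplus>\<^bsub>L\<^esub> (u \<ominus>\<^bsub>L\<^esub> x) \<otimes>\<^bsub>L\<^esub> y \<in> A"
        by (intro subspace_add[OF A] ideal_mult_left[OF I] ideal_mult_right[OF I] uv y)
      also have "u \<otimes>\<^bsub>L\<^esub> (v \<ominus>\<^bsub>L\<^esub> y) = u \<otimes>\<^bsub>L\<^esub> v \<ominus>\<^bsub>L\<^esub> u \<otimes>\<^bsub>L\<^esub> y"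
        using uv y by (simp add: a_minus_def prod_add_right prod_minus_right)
      also have "(u \<ominus>\<^bsub>L\<^esub> x) \<otimes>\<^bsub>L\<^esub> y = u \<otimes>\<^bsub>L\<^esub> y \<ominus>\<^bsub>L\<^esub> x \<otimes>\<^bsub>L\<^esub> y"
        using uv x y by (simp add: a_minus_def prod_add_left prod_minus_left)
      finally show ?thesis
        using uv x y by (simp add: ce minus_add_cancel_middle)
    qed
    moreover have "A +>\<^bsub>L\<^esub> x \<noteq> {}" "A +>\<^bsub>L\<^esub> y \<noteq> {}" using self[OF x] self[OF y] by blast+
    ultimately show ?thesis by (simp add: rcoset_mult_def cong: SUP_cong_simp)
  qed
  have smult: "A +>\<^bsub>L\<^esub> (c \<odot>\<^bsub>L\<^esub> x) = (\<Union>z\<in>A +>\<^bsub>L\<^esub> x. A +>\<^bsub>L\<^esub> (c \<odot>\<^bsub>L\<^esub> z))"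
    if c: "c \<in> carrier F" and x: "x \<in> carrier L" for c x
  proof -
    have "A +>\<^bsub>L\<^esub> (c \<odot>\<^bsub>L\<^esub> u) = A +>\<^bsub>L\<^esub> (c \<odot>\<^bsub>L\<^esub> x)" if "u \<in> A +>\<^bsub>L\<^esub> x" for u
    proof -
      have u: "u \<in> carrier L" "u \<ominus>\<^bsub>L\<^esub> x \<in> A" using that by (auto simp: mc x)
      have "c \<odot>\<^bsub>L\<^esub> (u \<ominus>\<^bsub>L\<^esub> x) \<in> A" by (rule subspace_smult[OF A c u(2)])
      also have "c \<odot>\<^bsub>L\<^esub> (u \<ominus>\<^bsub>L\<^esub> x) = c \<odot>\<^bsub>L\<^esub> u \<ominus>\<^bsub>L\<^esub> c \<odot>\<^bsub>L\<^esub> x"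
        using u c x by (simp add: a_minus_def smult_r_distr smult_r_minus)
      finally show ?thesis using u c x by (simp add: ce)
    qed
    moreover have "A +>\<^bsub>L\<^esub> x \<noteq> {}" using self[OF x] by blast
    ultimately show ?thesis by (simp cong: SUP_cong_simp)
  qed
  show ?thesis
    unfolding surjective_hom_def
    by (intro conjI module_homI ballI) (auto simp: quotient_algebra_simps add mult smult)
qed

lemma (in fd_algebra_module) isomorphic_images:
  assumes "surjective_hom F L M f" and "surjective_hom F L N g"
    and "\<And>x y. x \<in> carrier L \<Longrightarrow> y \<in> carrier L \<Longrightarrow> f x = f y \<longleftrightarrow> g x = g y"
  shows "algebra_isomorphic F M N"
  by (rule isomorphic_images[OF assms]) auto

lemma (in fd_algebra_module) image_ideal:
  assumes f: "surjective_hom F L M f" and M: "fd_algebra F M" and A: "algebra_ideal F L A"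
  shows "algebra_ideal F M (f ` A)"
proof -
  interpret M: fd_algebra_module F M by (rule fd_algebra_module.intro[OF M])
  note fD = surjective_homD[OF f]
  note sub = ideal_subspace[OF A]
  note mem = subspace_mem[OF sub]
  have "subspace F (f ` A) M"
    by (rule linear_map.image_subspace[OF linear_mapI[OF vectorspace_axioms M.vectorspace_axioms fD(1)] sub])
  moreover have "x \<otimes>\<^bsub>M\<^esub> b \<in> f ` A \<and> b \<otimes>\<^bsub>M\<^esub> x \<in> f ` A" if "x \<in> carrier M" "b \<in> f ` A" for x b
  proof -
    obtain y a where "y \<in> carrier L" "a \<in> A" "x = f y" "b = f a" using \<open>x \<in> carrier M\<close> \<open>b \<in> f ` A\<close> fD(6) by blast
    then show ?thesis
      using ideal_mult_left[OF A, of y a] ideal_mult_right[OF A, of y a] mem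
      by (auto simp flip: fD(5))
  qed
  ultimately show ?thesis by (simp add: algebra_ideal_def)
qed

text \<open>The third isomorphism theorem: both quotients are images of \<open>L\<close> with the same fibres. The
  isomorphism is stated in both directions because each is used to transport membership in a class.\<close>

lemma (in fd_algebra_module) quotient_by_ideal_containing_kernel:
  assumes f: "surjective_hom F L M f" and M: "fd_algebra F M" and A: "algebra_ideal F L A"
    and ker: "\<And>x. x \<in> carrier L \<Longrightarrow> f x = \<zero>\<^bsub>M\<^esub> \<Longrightarrow> x \<in> A"
  shows "algebra_isomorphic F (quotient_algebra L A) (quotient_algebra M (f ` A))"
    and "algebra_isomorphic F (quotient_algebra M (f ` A)) (quotient_algebra L A)"
    and "\<And>x. x \<in> carrier L \<Longrightarrow> f x \<in> f ` A \<Longrightarrow> x \<in> A"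
proof -
  interpret M: fd_algebra_module F M by (rule fd_algebra_module.intro[OF M])
  interpret f: linear_map F L M f
    by (rule linear_mapI[OF vectorspace_axioms M.vectorspace_axioms surjective_homD(1)[OF f]])
  note I = image_ideal[OF f M A]
  note sub = ideal_subspace[OF A]
  show mem: "x \<in> A" if x: "x \<in> carrier L" and "f x \<in> f ` A" for x
  proof -
    obtain a where a: "a \<in> A" "f x = f a" using \<open>f x \<in> f ` A\<close> by blast
    have aL: "a \<in> carrier L" by (rule subspace_mem[OF sub a(1)])
    have "x \<ominus>\<^bsub>L\<^esub> a \<in> A" using x aL a(2) by (intro ker) auto
    from subspace_add[OF sub this a(1)] show "x \<in> A" using x aL by simp
  qed
  let ?g = "\<lambda>x. f ` A +>\<^bsub>M\<^esub> f x"
  have g: "surjective_hom F L (quotient_algebra M (f ` A)) ?g"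
    by (rule surjective_hom_comp[OF f M.coset_map_surjective_hom[OF I]])
  have eq: "A +>\<^bsub>L\<^esub> x = A +>\<^bsub>L\<^esub> y \<longleftrightarrow> ?g x = ?g y" if x: "x \<in> carrier L" and y: "y \<in> carrier L" for x y
  proof -
    have "?g x = ?g y \<longleftrightarrow> f (x \<ominus>\<^bsub>L\<^esub> y) \<in> f ` A"
      using x y surjective_homD(2)[OF f] M.coset_eq_iff[OF M.ideal_subspace[OF I]] by simp
    also have "\<dots> \<longleftrightarrow> x \<ominus>\<^bsub>L\<^esub> y \<in> A" using mem x y by blast
    finally show ?thesis using coset_eq_iff[OF sub x y] by simp
  qed
  show "algebra_isomorphic F (quotient_algebra L A) (quotient_algebra M (f ` A))"
    by (rule isomorphic_images[OF coset_map_surjective_hom[OF A] g eq])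
  show "algebra_isomorphic F (quotient_algebra M (f ` A)) (quotient_algebra L A)"
    by (rule isomorphic_images[OF g coset_map_surjective_hom[OF A]]) (simp add: eq)
qed

text \<open>An algebra isomorphic to \<open>L/A\<close> is the same as an image of \<open>L\<close> with kernel \<open>A\<close>.\<close>

lemma (in fd_algebra_module) in_class_quotientD:
  assumes "in_class F \<KK> (quotient_algebra L A)" and A: "algebra_ideal F L A"
    and "\<forall>M\<in>\<KK>. fd_algebra F M"
  obtains M f where "M \<in> \<KK>" and "surjective_hom F L M f"
    and "\<forall>x\<in>carrier L. \<forall>y\<in>carrier L. f x = f y \<longleftrightarrow> x \<ominus>\<^bsub>L\<^esub> y \<in> A"
    and "\<forall>x\<in>A. f x = \<zero>\<^bsub>M\<^esub>"
proof -
  obtain M g where M: "M \<in> \<KK>" and g: "surjective_hom F (quotient_algebra L A) M g"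
    "inj_on g (carrier (quotient_algebra L A))"
    using assms(1) unfolding in_class_def algebra_isomorphic_iff by blast
  interpret M: fd_algebra_module F M
    by (rule fd_algebra_module.intro) (use assms(3) M in blast)
  note sub = ideal_subspace[OF A]
  let ?f = "\<lambda>x. g (A +>\<^bsub>L\<^esub> x)"
  have f: "surjective_hom F L M ?f"
    by (rule surjective_hom_comp[OF coset_map_surjective_hom[OF A] g(1)])
  have eq: "?f x = ?f y \<longleftrightarrow> x \<ominus>\<^bsub>L\<^esub> y \<in> A" if x: "x \<in> carrier L" and y: "y \<in> carrier L" for x y
  proof -
    have "?f x = ?f y \<longleftrightarrow> A +>\<^bsub>L\<^esub> x = A +>\<^bsub>L\<^esub> y"
      by (rule inj_on_eq_iff[OF g(2)]) (use x y in \<open>auto simp: quotient_algebra_simps\<close>)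
    then show ?thesis using coset_eq_iff[OF sub x y] by simp
  qed
  have "?f \<zero>\<^bsub>L\<^esub> = \<zero>\<^bsub>M\<^esub>"
    by (rule linear_map.T0_is_0[OF linear_mapI[OF vectorspace_axioms M.vectorspace_axioms surjective_homD(1)[OF f]]])
  then have "?f x = \<zero>\<^bsub>M\<^esub>" if "x \<in> A" for x
    using eq[of x "\<zero>\<^bsub>L\<^esub>"] subspace_mem[OF sub that] that by simp
  then show thesis using that[OF M f] eq by blast
qed

lemma (in lie_algebra) surjective_image_lie:
  assumes f: "surjective_hom F L M f" and M: "fd_algebra F M"
  shows "lie_algebra F M"
proof -
  interpret M: fd_algebra_module F M by (rule fd_algebra_module.intro[OF M])
  interpret f: linear_map F L M f
    by (rule linear_mapI[OF vectorspace_axioms M.vectorspace_axioms surjective_homD(1)[OF f]])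
  note fD = surjective_homD[OF f]
  have ex: "\<exists>l\<in>carrier L. x = f l" if "x \<in> carrier M" for x using that fD(6) by blast
  show ?thesis
  proof (rule M.lie_algebraI)
    fix x assume "x \<in> carrier M"
    then obtain l where "l \<in> carrier L" "x = f l" using ex by blast
    then show "x \<otimes>\<^bsub>M\<^esub> x = \<zero>\<^bsub>M\<^esub>" using fD(5)[of l l] by (simp add: alternating)
  next
    fix x y z assume "x \<in> carrier M" "y \<in> carrier M" "z \<in> carrier M"
    then obtain a b c where "a \<in> carrier L" "b \<in> carrier L" "c \<in> carrier L" "x = f a" "y = f b" "z = f c"
      using ex by metis
    then show "x \<otimes>\<^bsub>M\<^esub> (y \<otimes>\<^bsub>M\<^esub> z) = (x \<otimes>\<^bsub>M\<^esub> y) \<otimes>\<^bsub>M\<^esub> z \<oplus>\<^bsub>M\<^esub> y \<otimes>\<^bsub>M\<^esub> (x \<otimes>\<^bsub>M\<^esub> z)"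
      using arg_cong[OF leibniz_rule[of a b c], of f] by (simp add: fD(3,5))
  qed
qed

section \<open>Split extensions\<close>

definition semidirect :: "('a, 'b) module \<Rightarrow> ('a, 'c) module \<Rightarrow> ('b \<Rightarrow> 'c \<Rightarrow> 'c) \<Rightarrow> ('a, 'b \<times> 'c) module"
  where "semidirect L V \<rho> = \<lparr>carrier = carrier L \<times> carrier V,
    monoid.mult = (\<lambda>p q. (fst p \<otimes>\<^bsub>L\<^esub> fst q, \<rho> (fst p) (snd q) \<ominus>\<^bsub>V\<^esub> \<rho> (fst q) (snd p))),
    one = (\<zero>\<^bsub>L\<^esub>, \<zero>\<^bsub>V\<^esub>), zero = (\<zero>\<^bsub>L\<^esub>, \<zero>\<^bsub>V\<^esub>),
    add = (\<lambda>p q. (fst p \<oplus>\<^bsub>L\<^esub> fst q, snd p \<oplus>\<^bsub>V\<^esub> snd q)),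
    smult = (\<lambda>c p. (c \<odot>\<^bsub>L\<^esub> fst p, c \<odot>\<^bsub>V\<^esub> snd p))\<rparr>"

lemma semidirect_simps [simp]:
  "carrier (semidirect L V \<rho>) = carrier L \<times> carrier V"
  "\<zero>\<^bsub>semidirect L V \<rho>\<^esub> = (\<zero>\<^bsub>L\<^esub>, \<zero>\<^bsub>V\<^esub>)"
  "(x, u) \<otimes>\<^bsub>semidirect L V \<rho>\<^esub> (y, v) = (x \<otimes>\<^bsub>L\<^esub> y, \<rho> x v \<ominus>\<^bsub>V\<^esub> \<rho> y u)"
  "(x, u) \<oplus>\<^bsub>semidirect L V \<rho>\<^esub> (y, v) = (x \<oplus>\<^bsub>L\<^esub> y, u \<oplus>\<^bsub>V\<^esub> v)"
  "c \<odot>\<^bsub>semidirect L V \<rho>\<^esub> (x, u) = (c \<odot>\<^bsub>L\<^esub> x, c \<odot>\<^bsub>V\<^esub> u)"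
  by (simp_all add: semidirect_def)

locale lie_module = lie_representation F L "carrier L" V \<rho>
  for F and L :: "('a, 'b) module" and V :: "('a, 'c) module" and \<rho>
begin

abbreviation X where "X \<equiv> semidirect L V \<rho>"

lemma act_minus_right:
  "x \<in> carrier L \<Longrightarrow> u \<in> carrier V \<Longrightarrow> v \<in> carrier V \<Longrightarrow> \<rho> x (u \<ominus>\<^bsub>V\<^esub> v) = \<rho> x u \<ominus>\<^bsub>V\<^esub> \<rho> x v"
  by (rule linear_map.T_minus[OF linear_mapI[OF V.vectorspace_axioms V.vectorspace_axioms act_hom]])

lemma act_product:
  assumes "x \<in> carrier L" and "y \<in> carrier L" and "v \<in> carrier V"
  shows "\<rho> (x \<otimes>\<^bsub>L\<^esub> y) v = \<rho> x (\<rho> y v) \<ominus>\<^bsub>V\<^esub> \<rho> y (\<rho> x v)"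
proof -
  have "\<rho> x (\<rho> y v) \<ominus>\<^bsub>V\<^esub> \<rho> y (\<rho> x v) = (\<rho> (x \<otimes>\<^bsub>L\<^esub> y) v \<oplus>\<^bsub>V\<^esub> \<rho> y (\<rho> x v)) \<ominus>\<^bsub>V\<^esub> \<rho> y (\<rho> x v)"
    by (simp only: act_mult[OF assms])
  also have "\<dots> = \<rho> (x \<otimes>\<^bsub>L\<^esub> y) v"
    using assms by (simp add: a_minus_def V.M.a_assoc V.M.r_neg)
  finally show ?thesis by (rule sym)
qed

lemma X_vectorspace: "vectorspace F X"
proof -
  have "abelian_group X"
  proof (rule abelian_groupI)
    show "\<exists>q\<in>carrier X. q \<oplus>\<^bsub>X\<^esub> p = \<zero>\<^bsub>X\<^esub>" if "p \<in> carrier X" for p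
      by (rule bexI[of _ "(\<ominus>\<^bsub>L\<^esub> fst p, \<ominus>\<^bsub>V\<^esub> snd p)"])
        (use that in \<open>auto simp: L.M.l_neg V.M.l_neg\<close>)
  qed (auto simp: L.M.a_ac V.M.a_ac)
  then have "module F X"
    by (intro moduleI L.R.is_cring)
      (auto simp: L.smult_l_distr L.smult_r_distr L.smult_assoc1 V.smult_l_distr V.smult_r_distr V.smult_assoc1)
  then show ?thesis by (intro vectorspace.intro L.field_axioms)
qed

lemma X_fin_dim: "vectorspace.fin_dim F X"
proof -
  interpret X: vectorspace F X by (rule X_vectorspace)
  let ?i = "\<lambda>x. (x, \<zero>\<^bsub>V\<^esub>)" and ?j = "\<lambda>v. (\<zero>\<^bsub>L\<^esub>, v)"
  have i: "linear_map F L X ?i"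
    by (intro linear_mapI L.vectorspace_axioms X_vectorspace module_homI) auto
  have j: "linear_map F V X ?j"
    by (intro linear_mapI V.vectorspace_axioms X_vectorspace module_homI) auto
  obtain A where A: "finite A" "A \<subseteq> carrier L" "L.span A = carrier L"
    using L.finite_dimensional unfolding L.fin_dim_def by blast
  obtain B where B: "finite B" "B \<subseteq> carrier V" "V.span B = carrier V"
    using fin_dim_V unfolding V.fin_dim_def by blast
  let ?C = "?i ` A \<union> ?j ` B"
  have C: "?C \<subseteq> carrier X" using A(2) B(2) by auto
  have "p \<in> X.span ?C" if "p \<in> carrier X" for p
  proof -
    have p: "fst p \<in> carrier L" "snd p \<in> carrier V" using that by auto
    have "?i (fst p) \<in> X.span (?i ` A)"
      by (rule linear_map.image_span_in_span_image[OF i A(2)]) (simp add: A(3) p)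
    then have 1: "?i (fst p) \<in> X.span ?C" using X.span_is_monotone[OF Un_upper1] by blast
    have "?j (snd p) \<in> X.span (?j ` B)"
      by (rule linear_map.image_span_in_span_image[OF j B(2)]) (simp add: B(3) p)
    then have 2: "?j (snd p) \<in> X.span ?C" using X.span_is_monotone[OF Un_upper2] by blast
    have "?i (fst p) \<oplus>\<^bsub>X\<^esub> ?j (snd p) \<in> X.span ?C"
      by (rule X.subspace_add[OF X.span_is_subspace[OF C] 1 2])
    also have "?i (fst p) \<oplus>\<^bsub>X\<^esub> ?j (snd p) = p" using p by (simp add: prod_eq_iff)
    finally show ?thesis .
  qed
  then show ?thesis
    unfolding X.fin_dim_def using A(1) B(1) C X.span_is_subset2[OF C] by (intro exI[of _ ?C]) auto
qed

lemma X_fd_algebra: "fd_algebra F X"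
  by (intro fd_algebra.intro fd_algebra_axioms.intro X_vectorspace X_fin_dim)
    (auto simp: L.prod_add_left L.prod_add_right L.prod_smult_left L.prod_smult_right
      act_add act_smult act_add_right act_smult_right a_minus_def
      V.smult_r_distr V.smult_r_minus V.M.minus_add V.M.a_ac)

lemma X_lie_algebra: "lie_algebra F X"
proof -
  interpret X: fd_algebra_module F X by (rule fd_algebra_module.intro[OF X_fd_algebra])
  \<comment> \<open>The variables stand for the six iterated actions, such as \<open>p = x (y w)\<close>, that occur in the
    second component of the Leibniz rule.\<close>
  have cancel: "((p \<ominus>\<^bsub>V\<^esub> q) \<ominus>\<^bsub>V\<^esub> (s \<ominus>\<^bsub>V\<^esub> m)) \<oplus>\<^bsub>V\<^esub> ((q \<ominus>\<^bsub>V\<^esub> t) \<ominus>\<^bsub>V\<^esub> (r \<ominus>\<^bsub>V\<^esub> s)) = (p \<ominus>\<^bsub>V\<^esub> r) \<ominus>\<^bsub>V\<^esub> (t \<ominus>\<^bsub>V\<^esub> m)"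
    if *: "p \<in> carrier V" "q \<in> carrier V" "r \<in> carrier V" "s \<in> carrier V" "t \<in> carrier V" "m \<in> carrier V"
    for p q r s t m
  proof -
    have "((p \<ominus>\<^bsub>V\<^esub> q) \<ominus>\<^bsub>V\<^esub> (s \<ominus>\<^bsub>V\<^esub> m)) \<oplus>\<^bsub>V\<^esub> ((q \<ominus>\<^bsub>V\<^esub> t) \<ominus>\<^bsub>V\<^esub> (r \<ominus>\<^bsub>V\<^esub> s)) =
        q \<oplus>\<^bsub>V\<^esub> (\<ominus>\<^bsub>V\<^esub> q \<oplus>\<^bsub>V\<^esub> (s \<oplus>\<^bsub>V\<^esub> (\<ominus>\<^bsub>V\<^esub> s \<oplus>\<^bsub>V\<^esub> ((p \<ominus>\<^bsub>V\<^esub> r) \<ominus>\<^bsub>V\<^esub> (t \<ominus>\<^bsub>V\<^esub> m)))))"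
      using * by (simp add: a_minus_def V.M.minus_add V.M.a_ac)
    also have "\<dots> = (p \<ominus>\<^bsub>V\<^esub> r) \<ominus>\<^bsub>V\<^esub> (t \<ominus>\<^bsub>V\<^esub> m)"
      using * by (simp only: V.M.r_neg2 V.M.minus_closed V.M.a_inv_closed V.M.a_closed)
    finally show ?thesis .
  qed
  show ?thesis
  proof (rule X.lie_algebraI)
    show "p \<otimes>\<^bsub>X\<^esub> p = \<zero>\<^bsub>X\<^esub>" if "p \<in> carrier X" for p
      using that by (cases p) (simp add: L.alternating)
  next
    fix p q r assume "p \<in> carrier X" "q \<in> carrier X" "r \<in> carrier X"
    then obtain x y z u v w where *: "p = (x, u)" "q = (y, v)" "r = (z, w)"
      and [simp]: "x \<in> carrier L" "y \<in> carrier L" "z \<in> carrier L"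
        "u \<in> carrier V" "v \<in> carrier V" "w \<in> carrier V"
      by auto
    have "(\<rho> (x \<otimes>\<^bsub>L\<^esub> y) w \<ominus>\<^bsub>V\<^esub> \<rho> z (\<rho> x v \<ominus>\<^bsub>V\<^esub> \<rho> y u)) \<oplus>\<^bsub>V\<^esub> (\<rho> y (\<rho> x w \<ominus>\<^bsub>V\<^esub> \<rho> z u) \<ominus>\<^bsub>V\<^esub> \<rho> (x \<otimes>\<^bsub>L\<^esub> z) v)
        = \<rho> x (\<rho> y w \<ominus>\<^bsub>V\<^esub> \<rho> z v) \<ominus>\<^bsub>V\<^esub> \<rho> (y \<otimes>\<^bsub>L\<^esub> z) u"
      by (simp add: act_product act_minus_right cancel)
    then show "p \<otimes>\<^bsub>X\<^esub> (q \<otimes>\<^bsub>X\<^esub> r) = (p \<otimes>\<^bsub>X\<^esub> q) \<otimes>\<^bsub>X\<^esub> r \<oplus>\<^bsub>X\<^esub> q \<otimes>\<^bsub>X\<^esub> (p \<otimes>\<^bsub>X\<^esub> r)"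
      by (simp add: * L.leibniz_rule[of x y z])
  qed
qed

lemma fst_surjective_hom: "surjective_hom F X L fst"
  unfolding surjective_hom_def
proof (intro conjI ballI)
  show "fst \<in> module_hom F X L"
  proof (rule module_homI)
    show "fst (p \<oplus>\<^bsub>X\<^esub> q) = fst p \<oplus>\<^bsub>L\<^esub> fst q" for p q by (cases p; cases q) simp
    show "fst (c \<odot>\<^bsub>X\<^esub> p) = c \<odot>\<^bsub>L\<^esub> fst p" for c p by (cases p) simp
  qed (simp add: mem_Times_iff)
  show "fst (p \<otimes>\<^bsub>X\<^esub> q) = fst p \<otimes>\<^bsub>L\<^esub> fst q" for p q by (cases p; cases q) simp
  have "carrier V \<noteq> {}" using V.M.zero_closed by blast
  then show "fst ` carrier X = carrier L" by simp
qed

lemma kernel_abelian: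
  assumes "p \<in> carrier X" "q \<in> carrier X" "fst p = \<zero>\<^bsub>L\<^esub>" "fst q = \<zero>\<^bsub>L\<^esub>"
  shows "p \<otimes>\<^bsub>X\<^esub> q = \<zero>\<^bsub>X\<^esub>"
proof -
  have "\<rho> \<zero>\<^bsub>L\<^esub> v = \<zero>\<^bsub>V\<^esub>" if "v \<in> carrier V" for v
  proof -
    have "\<rho> \<zero>\<^bsub>L\<^esub> v = \<rho> (\<zero>\<^bsub>F\<^esub> \<odot>\<^bsub>L\<^esub> \<zero>\<^bsub>L\<^esub>) v"
      by simp
    also have "\<dots> = \<zero>\<^bsub>F\<^esub> \<odot>\<^bsub>V\<^esub> \<rho> \<zero>\<^bsub>L\<^esub> v" by (rule act_smult) (use that in auto)
    also have "\<dots> = \<zero>\<^bsub>V\<^esub>" using that by simp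
    finally show ?thesis .
  qed
  then show ?thesis using assms by (cases p; cases q) auto
qed

lemma left_mult_pow:
  assumes "a \<in> carrier L" and "v \<in> carrier V"
  shows "((\<lambda>q. (a, \<zero>\<^bsub>V\<^esub>) \<otimes>\<^bsub>X\<^esub> q) ^^ n) (\<zero>\<^bsub>L\<^esub>, v) = (\<zero>\<^bsub>L\<^esub>, (\<rho> a ^^ n) v)"
proof (induction n)
  case (Suc n)
  have "(\<rho> a ^^ n) v \<in> carrier V" by (rule module_hom_funpow_closed[OF act_hom[OF assms(1)] assms(2)])
  then show ?case using Suc assms act_zero[OF L.M.zero_closed] by simp
qed simp

end

text \<open>\<open>X\<close> is the split extension of \<open>L\<close> by a module on which \<open>a\<close> is not nilpotent, and \<open>b\<close> is \<open>a\<close> in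
  the complement. An isomorphic copy of the semidirect product has the type of algebras that classes
  consist of.\<close>

lemma (in lie_algebra) ex_extension_with_nonnilpotent_lift:
  assumes char: "ring_characteristic F = p" "p \<noteq> 0" and sol: "soluble F L"
    and a: "a \<in> carrier L" "a \<noteq> \<zero>\<^bsub>L\<^esub>"
  obtains X :: "'a alg" and f b where "lie_algebra F X" and "surjective_hom F X L f"
    and "\<forall>x\<in>carrier X. \<forall>y\<in>carrier X. f x = \<zero>\<^bsub>L\<^esub> \<longrightarrow> f y = \<zero>\<^bsub>L\<^esub> \<longrightarrow> x \<otimes>\<^bsub>X\<^esub> y = \<zero>\<^bsub>X\<^esub>"
    and "b \<in> carrier X" and "f b = a" and "\<not> nilpotent_on X (\<lambda>x. b \<otimes>\<^bsub>X\<^esub> x)"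
proof -
  obtain V :: "'a alg" and \<rho> where V: "lie_representation F L (carrier L) V \<rho>" and nn: "\<not> nilpotent_on V (\<rho> a)"
    using ex_nonnilpotent_representation[OF char sol a] .
  interpret V: lie_module F L V \<rho> by (rule lie_module.intro[OF V])
  interpret S: lie_algebra F V.X by (rule V.X_lie_algebra)
  obtain X :: "'a alg" where X: "fd_algebra F X" and iso: "algebra_isomorphic F V.X X"
    using ex_isomorphic_fd_algebra[OF V.X_fd_algebra] by blast
  obtain i where i: "surjective_hom F V.X X i" "inj_on i (carrier V.X)"
    using iso unfolding algebra_isomorphic_iff by blast
  have "surjective_hom F V.X V.X (\<lambda>x. x)" by (auto simp: surjective_hom_def intro!: module_homI)
  then have "algebra_isomorphic F X V.X"
    by (rule S.isomorphic_images[OF i(1)]) (rule inj_on_eq_iff[OF i(2)])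
  then obtain g where g: "surjective_hom F X V.X g" "inj_on g (carrier X)"
    unfolding algebra_isomorphic_iff by blast
  interpret X: lie_algebra F X by (rule S.surjective_image_lie[OF i(1) X])
  note gD = surjective_homD[OF g(1)]
  have g0: "g \<zero>\<^bsub>X\<^esub> = \<zero>\<^bsub>V.X\<^esub>"
    by (rule linear_map.T0_is_0[OF linear_mapI[OF X.vectorspace_axioms S.vectorspace_axioms gD(1)]])
  have "(a, \<zero>\<^bsub>V\<^esub>) \<in> carrier V.X" using a(1) by simp
  then obtain b where b: "b \<in> carrier X" "g b = (a, \<zero>\<^bsub>V\<^esub>)"
    using gD(6) by (metis imageE)
  show thesis
  proof (rule that[of X "\<lambda>x. fst (g x)" b])
    show "lie_algebra F X" ..
    show "surjective_hom F X L (\<lambda>x. fst (g x))"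
      by (rule surjective_hom_comp[OF g(1) V.fst_surjective_hom])
    show "b \<in> carrier X" "fst (g b) = a" using b by auto
    have "x \<otimes>\<^bsub>X\<^esub> y = \<zero>\<^bsub>X\<^esub>"
      if "x \<in> carrier X" "y \<in> carrier X" "fst (g x) = \<zero>\<^bsub>L\<^esub>" "fst (g y) = \<zero>\<^bsub>L\<^esub>" for x y
    proof -
      have "g (x \<otimes>\<^bsub>X\<^esub> y) = g \<zero>\<^bsub>X\<^esub>"
        unfolding g0 gD(5)[OF that(1,2)] by (rule V.kernel_abelian) (use that gD(2) in auto)
      then show ?thesis using that(1,2) inj_on_eq_iff[OF g(2)] by simp
    qed
    then show "\<forall>x\<in>carrier X. \<forall>y\<in>carrier X. fst (g x) = \<zero>\<^bsub>L\<^esub> \<longrightarrow> fst (g y) = \<zero>\<^bsub>L\<^esub> \<longrightarrow> x \<otimes>\<^bsub>X\<^esub> y = \<zero>\<^bsub>X\<^esub>"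
      by blast
    show "\<not> nilpotent_on X (\<lambda>x. b \<otimes>\<^bsub>X\<^esub> x)"
    proof
      assume "nilpotent_on X (\<lambda>x. b \<otimes>\<^bsub>X\<^esub> x)"
      then obtain n where n: "\<And>x. x \<in> carrier X \<Longrightarrow> ((\<lambda>x. b \<otimes>\<^bsub>X\<^esub> x) ^^ n) x = \<zero>\<^bsub>X\<^esub>"
        by (auto simp: nilpotent_on_def)
      have pow: "((\<lambda>x. b \<otimes>\<^bsub>X\<^esub> x) ^^ k) x \<in> carrier X \<and>
          g (((\<lambda>x. b \<otimes>\<^bsub>X\<^esub> x) ^^ k) x) = ((\<lambda>q. (a, \<zero>\<^bsub>V\<^esub>) \<otimes>\<^bsub>V.X\<^esub> q) ^^ k) (g x)"
        if "x \<in> carrier X" for k x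
        by (induction k) (use that b in \<open>auto simp: gD(5)\<close>)
      have "(\<rho> a ^^ n) v = \<zero>\<^bsub>V\<^esub>" if v: "v \<in> carrier V" for v
      proof -
        have "(\<zero>\<^bsub>L\<^esub>, v) \<in> g ` carrier X" unfolding gD(6) using v by simp
        then obtain x where x: "x \<in> carrier X" "g x = (\<zero>\<^bsub>L\<^esub>, v)" by (metis imageE)
        have "(\<zero>\<^bsub>L\<^esub>, (\<rho> a ^^ n) v) = (\<zero>\<^bsub>L\<^esub>, \<zero>\<^bsub>V\<^esub>)"
          using conjunct2[OF pow[OF x(1), of n]] n[OF x(1)] V.left_mult_pow[OF a(1) v, of n] g0 x(2) by simp
        then show ?thesis by simp
      qed
      then show False using nn by (auto simp: nilpotent_on_def)
    qed
  qed
qed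

section \<open>Chief factors\<close>

context leibniz_algebra
begin

lemma leibniz_left:
  assumes x: "x \<in> carrier L" and y: "y \<in> carrier L" and z: "z \<in> carrier L"
  shows "(x \<otimes>\<^bsub>L\<^esub> y) \<otimes>\<^bsub>L\<^esub> z = x \<otimes>\<^bsub>L\<^esub> (y \<otimes>\<^bsub>L\<^esub> z) \<ominus>\<^bsub>L\<^esub> y \<otimes>\<^bsub>L\<^esub> (x \<otimes>\<^bsub>L\<^esub> z)"
  unfolding leibniz_rule[OF x y z] using x y z by (simp add: a_minus_def M.a_assoc M.r_neg)

text \<open>The Leibniz rule expresses the products of \<open>x y\<close> and \<open>y x\<close> with \<open>h \<in> H\<close> by products of \<open>x\<close> with
  \<open>h\<close>, \<open>y h\<close> and \<open>h y\<close>, some of them multiplied by \<open>y\<close>.\<close>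

lemma centraliser_ideal:
  assumes H: "algebra_ideal F L H" and K: "algebra_ideal F L K"
  shows "algebra_ideal F L (factor_centraliser L H K)"
proof -
  let ?C = "factor_centraliser L H K"
  note subH = ideal_subspace[OF H] and subK = ideal_subspace[OF K]
  note memH = subspace_mem[OF subH]
  have C: "x \<in> carrier L" "h \<in> H \<Longrightarrow> x \<otimes>\<^bsub>L\<^esub> h \<in> K" "h \<in> H \<Longrightarrow> h \<otimes>\<^bsub>L\<^esub> x \<in> K" if "x \<in> ?C" for x h
    using that by (auto simp: factor_centraliser_def)
  have sub: "subspace F ?C L"
  proof (rule subspaceI)
    show "?C \<subseteq> carrier L" using C(1) by blast
    show "\<zero>\<^bsub>L\<^esub> \<in> ?C" using memH subspace_zero[OF subK] by (simp add: factor_centraliser_def)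
  next
    fix x y assume x: "x \<in> ?C" and y: "y \<in> ?C"
    have "(x \<oplus>\<^bsub>L\<^esub> y) \<otimes>\<^bsub>L\<^esub> h \<in> K \<and> h \<otimes>\<^bsub>L\<^esub> (x \<oplus>\<^bsub>L\<^esub> y) \<in> K" if h: "h \<in> H" for h
      unfolding prod_add_left[OF C(1)[OF x] C(1)[OF y] memH[OF h]]
        prod_add_right[OF memH[OF h] C(1)[OF x] C(1)[OF y]]
      using C(2,3)[OF x h] C(2,3)[OF y h] subspace_add[OF subK] by blast
    then show "x \<oplus>\<^bsub>L\<^esub> y \<in> ?C" using C(1)[OF x] C(1)[OF y] by (simp add: factor_centraliser_def)
  next
    fix c x assume c: "c \<in> carrier F" and x: "x \<in> ?C"
    have "(c \<odot>\<^bsub>L\<^esub> x) \<otimes>\<^bsub>L\<^esub> h \<in> K \<and> h \<otimes>\<^bsub>L\<^esub> (c \<odot>\<^bsub>L\<^esub> x) \<in> K" if h: "h \<in> H" for h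
      unfolding prod_smult_left[OF c C(1)[OF x] memH[OF h]] prod_smult_right[OF c memH[OF h] C(1)[OF x]]
      using C(2,3)[OF x h] subspace_smult[OF subK c] by blast
    then show "c \<odot>\<^bsub>L\<^esub> x \<in> ?C" using C(1)[OF x] c by (simp add: factor_centraliser_def)
  qed
  have "y \<otimes>\<^bsub>L\<^esub> x \<in> ?C \<and> x \<otimes>\<^bsub>L\<^esub> y \<in> ?C" if y: "y \<in> carrier L" and x: "x \<in> ?C" for x y
  proof -
    note xL = C(1)[OF x]
    have "(y \<otimes>\<^bsub>L\<^esub> x) \<otimes>\<^bsub>L\<^esub> h \<in> K \<and> h \<otimes>\<^bsub>L\<^esub> (y \<otimes>\<^bsub>L\<^esub> x) \<in> K \<and> (x \<otimes>\<^bsub>L\<^esub> y) \<otimes>\<^bsub>L\<^esub> h \<in> K \<and> h \<otimes>\<^bsub>L\<^esub> (x \<otimes>\<^bsub>L\<^esub> y) \<in> K"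
      if h: "h \<in> H" for h
    proof -
      note hL = memH[OF h]
      have yh: "y \<otimes>\<^bsub>L\<^esub> h \<in> H" "h \<otimes>\<^bsub>L\<^esub> y \<in> H"
        using ideal_mult_left[OF H y h] ideal_mult_right[OF H y h] by auto
      show ?thesis
        unfolding leibniz_left[OF y xL hL] leibniz_left[OF xL y hL]
          leibniz_rule[OF hL y xL] leibniz_rule[OF hL xL y]
        by (intro conjI subspace_minus[OF subK] subspace_add[OF subK]
            ideal_mult_left[OF K y] ideal_mult_right[OF K y] C(2,3)[OF x] h yh)
    qed
    then show ?thesis using xL y by (simp add: factor_centraliser_def)
  qed
  then show ?thesis using sub by (simp add: algebra_ideal_def)
qed

lemma chief_factorD:
  assumes "chief_factor F L H K"
  shows "algebra_ideal F L H" and "algebra_ideal F L K"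
    and "algebra_ideal F L J \<Longrightarrow> K \<subseteq> J \<Longrightarrow> J \<subseteq> H \<Longrightarrow> J = K \<or> J = H"
  using assms by (auto simp: chief_factor_def)

text \<open>
  The elements \<open>u h + h u\<close> with \<open>u \<in> L\<close>, \<open>h \<in> H\<close> annihilate \<open>L\<close> from the left by the Leibniz rule, and
  together with \<open>K\<close> they span an ideal \<open>J\<close> between \<open>K\<close> and \<open>H\<close>. If \<open>J = H\<close>, then \<open>H\<close> annihilates \<open>L\<close> from
  the left modulo \<open>K\<close>. If \<open>J = K\<close>, then \<open>h (x x) = x (h x) + (h x) x\<close> lies in \<open>K\<close>. In both cases
  \<open>h (x x) \<in> K\<close>, while \<open>(x x) h = 0\<close> always.
\<close>

lemma square_centralises_chief_factor:
  assumes cf: "chief_factor F L H K" and x: "x \<in> carrier L"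
  shows "x \<otimes>\<^bsub>L\<^esub> x \<in> factor_centraliser L H K"
proof -
  note H = chief_factorD(1)[OF cf] and K = chief_factorD(2)[OF cf]
  note subH = ideal_subspace[OF H] and subK = ideal_subspace[OF K]
  note memH = subspace_mem[OF subH] and memK = subspace_mem[OF subK]
  have KH: "K \<subseteq> H" using cf by (auto simp: chief_factor_def)
  define S where "S = {u \<otimes>\<^bsub>L\<^esub> h \<oplus>\<^bsub>L\<^esub> h \<otimes>\<^bsub>L\<^esub> u | u h. u \<in> carrier L \<and> h \<in> H}"
  define J where "J = span (K \<union> S)"
  have S_kills: "s \<otimes>\<^bsub>L\<^esub> y = \<zero>\<^bsub>L\<^esub>" if "s \<in> S" and y: "y \<in> carrier L" for s y
  proof -
    obtain u h where u: "u \<in> carrier L" and h: "h \<in> H" and s: "s = u \<otimes>\<^bsub>L\<^esub> h \<oplus>\<^bsub>L\<^esub> h \<otimes>\<^bsub>L\<^esub> u"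
      using \<open>s \<in> S\<close> by (auto simp: S_def)
    note hL = memH[OF h]
    have "s \<otimes>\<^bsub>L\<^esub> y = (u \<otimes>\<^bsub>L\<^esub> (h \<otimes>\<^bsub>L\<^esub> y) \<ominus>\<^bsub>L\<^esub> h \<otimes>\<^bsub>L\<^esub> (u \<otimes>\<^bsub>L\<^esub> y)) \<oplus>\<^bsub>L\<^esub> (h \<otimes>\<^bsub>L\<^esub> (u \<otimes>\<^bsub>L\<^esub> y) \<ominus>\<^bsub>L\<^esub> u \<otimes>\<^bsub>L\<^esub> (h \<otimes>\<^bsub>L\<^esub> y))"
      using u hL y by (simp add: s prod_add_left leibniz_left)
    then show ?thesis using u hL y by (simp add: minus_add_cancel_middle)
  qed
  have SH: "S \<subseteq> H"
    using ideal_mult_left[OF H] ideal_mult_right[OF H] subspace_add[OF subH] by (auto simp: S_def)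
  have KSL: "K \<union> S \<subseteq> carrier L" using KH SH memH by blast
  have subJ: "subspace F J L" unfolding J_def by (rule span_is_subspace[OF KSL])
  have gen: "g \<in> J" if "g \<in> K \<union> S" for g unfolding J_def by (rule span_generators[OF KSL that])
  have J: "algebra_ideal F L J"
  proof -
    have "y \<otimes>\<^bsub>L\<^esub> j \<in> J \<and> j \<otimes>\<^bsub>L\<^esub> y \<in> J" if y: "y \<in> carrier L" and j: "j \<in> J" for y j
    proof -
      let ?P = "{j \<in> carrier L. y \<otimes>\<^bsub>L\<^esub> j \<in> J \<and> j \<otimes>\<^bsub>L\<^esub> y \<in> J}"
      have "subspace F ?P L"
        by (rule subspaceI)
          (use y subspace_zero[OF subJ] subspace_add[OF subJ] subspace_smult[OF subJ] in
            \<open>auto simp: prod_add_left prod_add_right prod_smult_left prod_smult_right\<close>)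
      moreover have "k \<in> ?P" if "k \<in> K" for k
        using ideal_mult_left[OF K y that] ideal_mult_right[OF K y that] gen memK[OF that] by simp
      moreover have "s \<in> ?P" if s: "s \<in> S" for s
      proof -
        obtain u h where u: "u \<in> carrier L" and h: "h \<in> H" and s_eq: "s = u \<otimes>\<^bsub>L\<^esub> h \<oplus>\<^bsub>L\<^esub> h \<otimes>\<^bsub>L\<^esub> u"
          using s by (auto simp: S_def)
        note hL = memH[OF h]
        have "y \<otimes>\<^bsub>L\<^esub> s = ((y \<otimes>\<^bsub>L\<^esub> u) \<otimes>\<^bsub>L\<^esub> h \<oplus>\<^bsub>L\<^esub> h \<otimes>\<^bsub>L\<^esub> (y \<otimes>\<^bsub>L\<^esub> u)) \<oplus>\<^bsub>L\<^esub> (u \<otimes>\<^bsub>L\<^esub> (y \<otimes>\<^bsub>L\<^esub> h) \<oplus>\<^bsub>L\<^esub> (y \<otimes>\<^bsub>L\<^esub> h) \<otimes>\<^bsub>L\<^esub> u)"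
        proof -
          have "y \<otimes>\<^bsub>L\<^esub> s = y \<otimes>\<^bsub>L\<^esub> (u \<otimes>\<^bsub>L\<^esub> h) \<oplus>\<^bsub>L\<^esub> y \<otimes>\<^bsub>L\<^esub> (h \<otimes>\<^bsub>L\<^esub> u)"
            using u hL y by (simp add: s_eq prod_add_right)
          then show ?thesis
            unfolding leibniz_rule[OF y u hL] leibniz_rule[OF y hL u] using u hL y by (simp add: M.a_ac)
        qed
        moreover have "(y \<otimes>\<^bsub>L\<^esub> u) \<otimes>\<^bsub>L\<^esub> h \<oplus>\<^bsub>L\<^esub> h \<otimes>\<^bsub>L\<^esub> (y \<otimes>\<^bsub>L\<^esub> u) \<in> J"
          by (rule gen) (use y u h in \<open>auto simp: S_def\<close>)
        moreover have "u \<otimes>\<^bsub>L\<^esub> (y \<otimes>\<^bsub>L\<^esub> h) \<oplus>\<^bsub>L\<^esub> (y \<otimes>\<^bsub>L\<^esub> h) \<otimes>\<^bsub>L\<^esub> u \<in> J"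
          by (rule gen) (use u ideal_mult_left[OF H y h] in \<open>auto simp: S_def\<close>)
        ultimately have "y \<otimes>\<^bsub>L\<^esub> s \<in> J" using subspace_add[OF subJ] by simp
        then show ?thesis
          using S_kills[OF s y] subspace_zero[OF subJ] SH memH s by auto
      qed
      ultimately have "J \<subseteq> ?P" unfolding J_def by (intro span_subset_subspace) auto
      then show ?thesis using j by blast
    qed
    then show ?thesis using subJ by (simp add: algebra_ideal_def)
  qed
  have "J \<subseteq> H" unfolding J_def using KH SH by (intro span_subset_subspace[OF subH]) blast
  then have cases: "J = K \<or> J = H" using chief_factorD(3)[OF cf J] gen by blast
  have right: "h \<otimes>\<^bsub>L\<^esub> (x \<otimes>\<^bsub>L\<^esub> x) \<in> K" if h: "h \<in> H" for h
    using cases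
  proof
    assume "J = K"
    moreover have "x \<otimes>\<^bsub>L\<^esub> (h \<otimes>\<^bsub>L\<^esub> x) \<oplus>\<^bsub>L\<^esub> (h \<otimes>\<^bsub>L\<^esub> x) \<otimes>\<^bsub>L\<^esub> x \<in> J"
      by (rule gen) (use x ideal_mult_right[OF H x h] in \<open>auto simp: S_def\<close>)
    moreover have "h \<otimes>\<^bsub>L\<^esub> (x \<otimes>\<^bsub>L\<^esub> x) = x \<otimes>\<^bsub>L\<^esub> (h \<otimes>\<^bsub>L\<^esub> x) \<oplus>\<^bsub>L\<^esub> (h \<otimes>\<^bsub>L\<^esub> x) \<otimes>\<^bsub>L\<^esub> x"
      unfolding leibniz_rule[OF memH[OF h] x x] using x memH[OF h] by (simp add: M.a_comm)
    ultimately show ?thesis by simp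
  next
    assume JH: "J = H"
    let ?P = "{j \<in> carrier L. j \<otimes>\<^bsub>L\<^esub> (x \<otimes>\<^bsub>L\<^esub> x) \<in> K}"
    have "subspace F ?P L"
      by (rule subspaceI)
        (use x subspace_zero[OF subK] subspace_add[OF subK] subspace_smult[OF subK] in
          \<open>auto simp: prod_add_left prod_smult_left\<close>)
    moreover have "K \<union> S \<subseteq> ?P"
      using KSL ideal_mult_right[OF K, of "x \<otimes>\<^bsub>L\<^esub> x"] S_kills subspace_zero[OF subK] x by auto
    ultimately have "J \<subseteq> ?P" unfolding J_def by (rule span_subset_subspace)
    then show ?thesis using h JH by blast
  qed
  have "(x \<otimes>\<^bsub>L\<^esub> x) \<otimes>\<^bsub>L\<^esub> h \<in> K" if "h \<in> H" for h
    using leibniz_left[OF x x memH[OF that]] x memH[OF that] subspace_zero[OF subK] by simp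
  then show ?thesis using right x by (simp add: factor_centraliser_def)
qed

text \<open>The ideal \<open>J = K + (A \<inter> H)\<close> equals \<open>K\<close> or \<open>H\<close>. In the first case \<open>A H \<subseteq> A \<inter> H \<subseteq> K\<close>. In the second
  \<open>A H \<subseteq> A K + A A \<subseteq> K\<close>.\<close>

lemma abelian_ideal_centralises_chief_factor:
  assumes cf: "chief_factor F L H K" and A: "algebra_ideal F L A"
    and abelian: "\<And>x y. x \<in> A \<Longrightarrow> y \<in> A \<Longrightarrow> x \<otimes>\<^bsub>L\<^esub> y = \<zero>\<^bsub>L\<^esub>"
  shows "A \<subseteq> factor_centraliser L H K"
proof
  fix a assume a: "a \<in> A"
  note H = chief_factorD(1)[OF cf] and K = chief_factorD(2)[OF cf]
  note subH = ideal_subspace[OF H] and subK = ideal_subspace[OF K] and subA = ideal_subspace[OF A]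
  note memH = subspace_mem[OF subH] and memK = subspace_mem[OF subK] and memA = subspace_mem[OF subA]
  have KH: "K \<subseteq> H" using cf by (auto simp: chief_factor_def)
  define J where "J = {k \<oplus>\<^bsub>L\<^esub> b | k b. k \<in> K \<and> b \<in> A \<inter> H}"
  have "J = subspace_sum K (A \<inter> H)" by (auto simp: J_def submodule_sum_def image_def)
  then have subJ: "subspace F J L" using sum_is_subspace[OF subK subspace_Int[OF subA subH]] by simp
  have "y \<otimes>\<^bsub>L\<^esub> j \<in> J \<and> j \<otimes>\<^bsub>L\<^esub> y \<in> J" if y: "y \<in> carrier L" and "j \<in> J" for y j
  proof -
    obtain k b where k: "k \<in> K" and b: "b \<in> A" "b \<in> H" and j: "j = k \<oplus>\<^bsub>L\<^esub> b"
      using \<open>j \<in> J\<close> by (auto simp: J_def)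
    have "y \<otimes>\<^bsub>L\<^esub> j = y \<otimes>\<^bsub>L\<^esub> k \<oplus>\<^bsub>L\<^esub> y \<otimes>\<^bsub>L\<^esub> b" "j \<otimes>\<^bsub>L\<^esub> y = k \<otimes>\<^bsub>L\<^esub> y \<oplus>\<^bsub>L\<^esub> b \<otimes>\<^bsub>L\<^esub> y"
      using y memK[OF k] memA[OF b(1)] by (simp_all add: j prod_add_left prod_add_right)
    moreover have "y \<otimes>\<^bsub>L\<^esub> k \<in> K" "k \<otimes>\<^bsub>L\<^esub> y \<in> K" "y \<otimes>\<^bsub>L\<^esub> b \<in> A \<inter> H" "b \<otimes>\<^bsub>L\<^esub> y \<in> A \<inter> H"
      using ideal_mult_left[OF K y k] ideal_mult_right[OF K y k] ideal_mult_left[OF A y b(1)]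
        ideal_mult_right[OF A y b(1)] ideal_mult_left[OF H y b(2)] ideal_mult_right[OF H y b(2)] by auto
    ultimately show ?thesis unfolding J_def by blast
  qed
  then have J: "algebra_ideal F L J" using subJ by (simp add: algebra_ideal_def)
  have "k \<in> J" if k: "k \<in> K" for k
  proof -
    have "k = k \<oplus>\<^bsub>L\<^esub> \<zero>\<^bsub>L\<^esub>" using memK[OF k] by simp
    then show ?thesis unfolding J_def using k subspace_zero[OF subA] subspace_zero[OF subH] by blast
  qed
  moreover have "J \<subseteq> H" using KH subspace_add[OF subH] by (auto simp: J_def)
  ultimately have cases: "J = K \<or> J = H" using chief_factorD(3)[OF cf J] by blast
  have "a \<otimes>\<^bsub>L\<^esub> h \<in> K \<and> h \<otimes>\<^bsub>L\<^esub> a \<in> K" if h: "h \<in> H" for h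
    using cases
  proof
    assume JK: "J = K"
    have "b \<in> K" if b: "b \<in> A \<inter> H" for b
    proof -
      have "b = \<zero>\<^bsub>L\<^esub> \<oplus>\<^bsub>L\<^esub> b" using memA b by simp
      then have "b \<in> J" unfolding J_def using b subspace_zero[OF subK] by blast
      then show ?thesis using JK by blast
    qed
    then show ?thesis
      using ideal_mult_left[OF H memA[OF a] h] ideal_mult_right[OF H memA[OF a] h]
        ideal_mult_left[OF A memH[OF h] a] ideal_mult_right[OF A memH[OF h] a] by blast
  next
    assume "J = H"
    then have "h \<in> J" using h by simp
    then obtain k b where k: "k \<in> K" and b: "b \<in> A" and h_eq: "h = k \<oplus>\<^bsub>L\<^esub> b"
      by (auto simp: J_def)
    have "a \<otimes>\<^bsub>L\<^esub> h = a \<otimes>\<^bsub>L\<^esub> k" "h \<otimes>\<^bsub>L\<^esub> a = k \<otimes>\<^bsub>L\<^esub> a"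
      using memA[OF a] memA[OF b] memK[OF k] abelian[OF a b] abelian[OF b a]
      by (simp_all add: h_eq prod_add_left prod_add_right)
    then show ?thesis
      using ideal_mult_left[OF K memA[OF a] k] ideal_mult_right[OF K memA[OF a] k] by simp
  qed
  then show "a \<in> factor_centraliser L H K" using memA[OF a] by (simp add: factor_centraliser_def)
qed

text \<open>\<open>H\<close> is a minimal ideal on which left multiplication by \<open>a\<close> is not nilpotent and \<open>K\<close> is a maximal
  ideal properly contained in \<open>H\<close>. If \<open>a\<close> maps \<open>H\<close> into \<open>K\<close>, then it is nilpotent on \<open>H\<close>, because it is
  nilpotent on \<open>K\<close>.\<close>

lemma ex_chief_factor_not_centralised:
  assumes a: "a \<in> carrier L" and nn: "\<not> nilpotent_on L (\<lambda>x. a \<otimes>\<^bsub>L\<^esub> x)"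
  obtains H K where "chief_factor F L H K" and "a \<notin> factor_centraliser L H K"
proof -
  let ?f = "\<lambda>x. a \<otimes>\<^bsub>L\<^esub> x"
  define nil where "nil U \<longleftrightarrow> (\<exists>n. \<forall>u\<in>U. (?f ^^ n) u = \<zero>\<^bsub>L\<^esub>)" for U
  have "algebra_ideal F L (carrier L)" by (simp add: algebra_ideal_def subspace_carrier)
  moreover have "\<not> nil (carrier L)" using nn by (simp add: nil_def nilpotent_on_def)
  ultimately obtain H where H: "algebra_ideal F L H \<and> \<not> nil H"
    and H_min: "\<And>C. algebra_ideal F L C \<and> \<not> nil C \<Longrightarrow> \<not> C \<subset> H"
    using ex_minimal_subspace[OF finite_dimensional, of "\<lambda>A. algebra_ideal F L A \<and> \<not> nil A" "carrier L"]
      ideal_subspace by metis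
  have "algebra_ideal F L {\<zero>\<^bsub>L\<^esub>}" by (simp add: algebra_ideal_def subspace_zero_space)
  moreover have "nil {\<zero>\<^bsub>L\<^esub>}" unfolding nil_def by (rule exI[of _ 0]) simp
  then have "{\<zero>\<^bsub>L\<^esub>} \<subset> H" using H subspace_zero[OF ideal_subspace] by blast
  ultimately obtain K where K: "algebra_ideal F L K \<and> K \<subset> H"
    and K_max: "\<And>C. algebra_ideal F L C \<and> C \<subset> H \<Longrightarrow> \<not> K \<subset> C"
    using ex_maximal_subspace[OF finite_dimensional, of "\<lambda>A. algebra_ideal F L A \<and> A \<subset> H" "{\<zero>\<^bsub>L\<^esub>}"]
      ideal_subspace by metis
  have cf: "chief_factor F L H K" unfolding chief_factor_def using H K K_max by blast
  obtain n where n: "\<And>k. k \<in> K \<Longrightarrow> (?f ^^ n) k = \<zero>\<^bsub>L\<^esub>"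
    using H_min[of K] K unfolding nil_def by blast
  have "a \<notin> factor_centraliser L H K"
  proof
    assume "a \<in> factor_centraliser L H K"
    then have "(?f ^^ Suc n) h = \<zero>\<^bsub>L\<^esub>" if "h \<in> H" for h
      using n that unfolding funpow_Suc_right by (simp add: factor_centraliser_def)
    then show False using H unfolding nil_def by blast
  qed
  then show thesis by (rule that[OF cf])
qed

end

section \<open>Soluble extensions\<close>

lemma (in fd_algebra_module) derived_series_subset: "derived_series F L n \<subseteq> carrier L"
proof (induction n)
  case (Suc n)
  then have "{x \<otimes>\<^bsub>L\<^esub> y | x y. x \<in> derived_series F L n \<and> y \<in> derived_series F L n} \<subseteq> carrier L" by auto
  then show ?case by (simp add: span_is_subset2)
qed simp

text \<open>The derived series of \<open>L\<close> maps into that of \<open>M\<close>, so it reaches the kernel, where all products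
  vanish.\<close>

lemma (in fd_algebra_module) soluble_extension:
  assumes f: "surjective_hom F L M f" and M: "fd_algebra F M" and sol: "soluble F M"
    and ker: "\<And>x y. x \<in> carrier L \<Longrightarrow> y \<in> carrier L \<Longrightarrow> f x = \<zero>\<^bsub>M\<^esub> \<Longrightarrow> f y = \<zero>\<^bsub>M\<^esub> \<Longrightarrow> x \<otimes>\<^bsub>L\<^esub> y = \<zero>\<^bsub>L\<^esub>"
  shows "soluble F L"
proof -
  interpret M: fd_algebra_module F M by (rule fd_algebra_module.intro[OF M])
  have lin: "linear_map F L M f"
    by (rule linear_mapI[OF vectorspace_axioms M.vectorspace_axioms surjective_homD(1)[OF f]])
  let ?D = "\<lambda>n. {x \<otimes>\<^bsub>L\<^esub> y | x y. x \<in> derived_series F L n \<and> y \<in> derived_series F L n}"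
  let ?E = "\<lambda>n. {x \<otimes>\<^bsub>M\<^esub> y | x y. x \<in> derived_series F M n \<and> y \<in> derived_series F M n}"
  have image: "derived_series F L n \<subseteq> {x \<in> carrier L. f x \<in> derived_series F M n}" for n
  proof (induction n)
    case 0
    then show ?case using surjective_homD(2)[OF f] by auto
  next
    case (Suc n)
    have E: "?E n \<subseteq> carrier M" using M.derived_series_subset[of n] by auto
    have "?D n \<subseteq> {x \<in> carrier L. f x \<in> M.span (?E n)}"
    proof
      fix z assume "z \<in> ?D n"
      then obtain x y where *: "x \<in> derived_series F L n" "y \<in> derived_series F L n" "z = x \<otimes>\<^bsub>L\<^esub> y" by blast
      then have "x \<in> carrier L" "y \<in> carrier L" "f x \<in> derived_series F M n" "f y \<in> derived_series F M n"
        using Suc by auto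
      moreover from this have "f x \<otimes>\<^bsub>M\<^esub> f y \<in> M.span (?E n)"
        by (intro M.span_generators[OF E]) blast
      ultimately show "z \<in> {x \<in> carrier L. f x \<in> M.span (?E n)}"
        using *(3) surjective_homD(5)[OF f] by simp
    qed
    then show ?case
      unfolding derived_series.simps
      by (rule span_subset_subspace[OF linear_map.preimage_subspace[OF lin M.span_is_subspace[OF E]]])
  qed
  obtain n where n: "derived_series F M n = {\<zero>\<^bsub>M\<^esub>}" using sol by (auto simp: soluble_def)
  have "?D n \<subseteq> {\<zero>\<^bsub>L\<^esub>}" using image[of n] ker unfolding n by auto
  then have "derived_series F L (Suc n) \<subseteq> {\<zero>\<^bsub>L\<^esub>}"
    unfolding derived_series.simps by (rule span_subset_subspace[OF subspace_zero_space])
  moreover have "\<zero>\<^bsub>L\<^esub> \<in> derived_series F L (Suc n)" unfolding derived_series.simps by (rule span_zero)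
  ultimately show ?thesis unfolding soluble_def by blast
qed

section \<open>Formations\<close>

lemma formationD:
  assumes "formation_of_soluble \<A> F \<KK>"
  shows "\<KK> \<noteq> {}"
    and "L \<in> \<KK> \<Longrightarrow> \<A> L" and "L \<in> \<KK> \<Longrightarrow> soluble F L"
    and "L \<in> \<KK> \<Longrightarrow> \<A> M \<Longrightarrow> algebra_isomorphic F L M \<Longrightarrow> M \<in> \<KK>"
    and "L \<in> \<KK> \<Longrightarrow> algebra_ideal F L A \<Longrightarrow> in_class F \<KK> (quotient_algebra L A)"
    and "\<A> L \<Longrightarrow> algebra_ideal F L A \<Longrightarrow> algebra_ideal F L B \<Longrightarrow>
      in_class F \<KK> (quotient_algebra L A) \<Longrightarrow> in_class F \<KK> (quotient_algebra L B) \<Longrightarrow>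
      in_class F \<KK> (quotient_algebra L (A \<inter> B))"
proof -
  note fm = assms[unfolded formation_of_soluble_def]
  show "\<KK> \<noteq> {}" using fm by (elim conjE)
  show "\<A> L" "soluble F L" if "L \<in> \<KK>" using fm that by blast+
  show "M \<in> \<KK>" if "L \<in> \<KK>" "\<A> M" "algebra_isomorphic F L M" using fm that by (elim conjE) blast
  show "in_class F \<KK> (quotient_algebra L A)" if "L \<in> \<KK>" "algebra_ideal F L A"
    using fm that by (elim conjE) blast
  have "\<forall>L A B. \<A> L \<and> algebra_ideal F L A \<and> algebra_ideal F L B \<and>
      in_class F \<KK> (quotient_algebra L A) \<and> in_class F \<KK> (quotient_algebra L B) \<longrightarrow>
      in_class F \<KK> (quotient_algebra L (A \<inter> B))"
    using fm by (elim conjE)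
  then show "in_class F \<KK> (quotient_algebra L (A \<inter> B))"
    if "\<A> L" "algebra_ideal F L A" "algebra_ideal F L B"
      "in_class F \<KK> (quotient_algebra L A)" "in_class F \<KK> (quotient_algebra L B)"
    using that by blast
qed

lemma in_class_isomorphic:
  "algebra_isomorphic F L M \<Longrightarrow> in_class F \<KK> M \<Longrightarrow> in_class F \<KK> L"
  unfolding in_class_def using algebra_isomorphic_trans by blast

text \<open>Any member has itself as an ideal, with zero quotient.\<close>

lemma formation_contains_zero_algebra:
  assumes fm: "formation_of_soluble \<A> F \<KK>" and fd: "\<And>L. \<A> L \<Longrightarrow> fd_algebra F L"
  obtains Z where "Z \<in> \<KK>" and "carrier Z = {\<zero>\<^bsub>Z\<^esub>}"
proof -
  have all_fd: "\<forall>M\<in>\<KK>. fd_algebra F M" using formationD(2)[OF fm] fd by blast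
  obtain M where M: "M \<in> \<KK>" using formationD(1)[OF fm] by blast
  interpret M: fd_algebra_module F M
    using all_fd M by (intro fd_algebra_module.intro) blast
  have ideal: "algebra_ideal F M (carrier M)" by (simp add: algebra_ideal_def M.subspace_carrier)
  obtain Z f where Z: "Z \<in> \<KK>" and f: "surjective_hom F M Z f" and f0: "\<forall>x\<in>carrier M. f x = \<zero>\<^bsub>Z\<^esub>"
    by (rule M.in_class_quotientD[OF formationD(5)[OF fm M ideal] ideal all_fd])
  have "carrier Z = f ` carrier M" using surjective_homD(6)[OF f] by simp
  also have "\<dots> = (\<lambda>x. \<zero>\<^bsub>Z\<^esub>) ` carrier M" using f0 by (intro image_cong) auto
  also have "\<dots> = {\<zero>\<^bsub>Z\<^esub>}" using M.M.zero_closed by blast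
  finally show thesis by (rule that[OF Z])
qed

definition lie_part :: "('a, 'm) ring_scheme \<Rightarrow> 'a alg set \<Rightarrow> 'a alg set"
  where "lie_part F \<KK> = {L \<in> \<KK>. lie_algebra F L}"

lemma lie_quotient_in_lie_part:
  assumes L: "lie_algebra F L" and A: "algebra_ideal F L A"
    and fd: "\<forall>M\<in>\<KK>. fd_algebra F M" and q: "in_class F \<KK> (quotient_algebra L A)"
  shows "in_class F (lie_part F \<KK>) (quotient_algebra L A)"
proof -
  interpret L: lie_algebra F L by (rule L)
  obtain M where M: "M \<in> \<KK>" and iso: "algebra_isomorphic F (quotient_algebra L A) M"
    using q unfolding in_class_def by blast
  obtain g where g: "surjective_hom F (quotient_algebra L A) M g"
    using iso unfolding algebra_isomorphic_iff by blast
  have "lie_algebra F M"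
    by (rule L.surjective_image_lie[OF surjective_hom_comp[OF L.coset_map_surjective_hom[OF A] g]])
      (use fd M in blast)
  then show ?thesis using M iso by (auto simp: in_class_def lie_part_def)
qed

lemma in_class_mono: "in_class F \<KK> L \<Longrightarrow> \<KK> \<subseteq> \<KK>' \<Longrightarrow> in_class F \<KK>' L"
  by (auto simp: in_class_def)

lemma lie_part_formation:
  fixes F :: "('a, 'm) ring_scheme"
  assumes fm: "leibniz_formation F \<KK>"
  shows "lie_formation F (lie_part F \<KK>)"
proof -
  note fm' = fm[unfolded leibniz_formation_def]
  have fd: "\<forall>M\<in>\<KK>. fd_algebra F M" using formationD(2)[OF fm'] leibniz_algebra.axioms(1) by blast
  have sub: "lie_part F \<KK> \<subseteq> \<KK>" by (auto simp: lie_part_def)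
  obtain Z where Z: "Z \<in> \<KK>" "carrier Z = {\<zero>\<^bsub>Z\<^esub>}"
    by (rule formation_contains_zero_algebra[OF fm' leibniz_algebra.axioms(1)])
  interpret Z: fd_algebra_module F Z using fd Z(1) by (intro fd_algebra_module.intro) blast
  have "lie_algebra F Z"
    by (rule Z.lie_algebraI) (simp_all add: Z(2))
  then have "lie_part F \<KK> \<noteq> {}" using Z(1) by (auto simp: lie_part_def)
  moreover have "M \<in> lie_part F \<KK>"
    if "L \<in> lie_part F \<KK>" "lie_algebra F M" "algebra_isomorphic F L M" for L M
    using formationD(4)[OF fm', of L M] that lie_algebra.leibniz[OF that(2)] by (simp add: lie_part_def)
  moreover have "in_class F (lie_part F \<KK>) (quotient_algebra L A)"
    if "L \<in> lie_part F \<KK>" "algebra_ideal F L A" for L A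
    by (rule lie_quotient_in_lie_part[OF _ that(2) fd])
      (use that formationD(5)[OF fm'] in \<open>auto simp: lie_part_def\<close>)
  moreover have "in_class F (lie_part F \<KK>) (quotient_algebra L (A \<inter> B))"
    if L: "lie_algebra F L" and A: "algebra_ideal F L A" and B: "algebra_ideal F L B"
      and "in_class F (lie_part F \<KK>) (quotient_algebra L A)"
      and "in_class F (lie_part F \<KK>) (quotient_algebra L B)" for L :: "'a alg" and A B
  proof -
    interpret L: lie_algebra F L by (rule L)
    have "algebra_ideal F L (A \<inter> B)"
      using A B L.subspace_Int by (auto simp: algebra_ideal_def)
    moreover have "in_class F \<KK> (quotient_algebra L (A \<inter> B))"
      by (rule formationD(6)[OF fm' L.leibniz A B]; rule in_class_mono[OF _ sub]; fact)
    ultimately show ?thesis by (intro lie_quotient_in_lie_part[OF L _ fd])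
  qed
  ultimately show ?thesis
    unfolding lie_formation_def formation_of_soluble_def
    using formationD(3)[OF fm'] by (auto simp: lie_part_def)
qed

text \<open>A Leibniz algebra whose squares vanish is a Lie algebra, and the squares of \<open>L\<close> vanish modulo the
  centraliser of a chief factor.\<close>

lemma Loc_lie_part:
  fixes F :: "('a, 'm) ring_scheme"
  assumes fm: "leibniz_formation F \<KK>"
  shows "Loc F (lie_part F \<KK>) = Loc F \<KK>"
proof -
  note fm' = fm[unfolded leibniz_formation_def]
  have fd: "\<forall>M\<in>\<KK>. fd_algebra F M" using formationD(2)[OF fm'] leibniz_algebra.axioms(1) by blast
  have "in_class F (lie_part F \<KK>) (quotient_algebra L (factor_centraliser L H K)) \<longleftrightarrow>
      in_class F \<KK> (quotient_algebra L (factor_centraliser L H K))"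
    if L: "leibniz_algebra F L" and cf: "chief_factor F L H K" for L :: "'a alg" and H K
  proof
    assume "in_class F (lie_part F \<KK>) (quotient_algebra L (factor_centraliser L H K))"
    then show "in_class F \<KK> (quotient_algebra L (factor_centraliser L H K))"
      by (rule in_class_mono) (auto simp: lie_part_def)
  next
    interpret L: leibniz_algebra F L by (rule L)
    let ?C = "factor_centraliser L H K"
    have C: "algebra_ideal F L ?C"
      by (rule L.centraliser_ideal[OF L.chief_factorD(1,2)[OF cf]])
    assume "in_class F \<KK> (quotient_algebra L ?C)"
    then obtain M where M: "M \<in> \<KK>" and iso: "algebra_isomorphic F (quotient_algebra L ?C) M"
      unfolding in_class_def by blast
    then have "in_class F {M} (quotient_algebra L ?C)" by (simp add: in_class_def)
    moreover have "\<forall>N\<in>{M}. fd_algebra F N" using fd M by simp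
    ultimately obtain N f where N: "N \<in> {M}" and f: "surjective_hom F L N f" and f0: "\<forall>x\<in>?C. f x = \<zero>\<^bsub>N\<^esub>"
      by (rule L.in_class_quotientD[OF _ C])
    then have f: "surjective_hom F L M f" and f0: "\<forall>x\<in>?C. f x = \<zero>\<^bsub>M\<^esub>" by auto
    interpret M: leibniz_algebra F M by (rule formationD(2)[OF fm' M])
    have "lie_algebra F M"
    proof (rule M.lie_algebraI[OF _ M.leibniz_rule])
      fix y assume "y \<in> carrier M"
      then obtain x where x: "x \<in> carrier L" "y = f x" using surjective_homD(6)[OF f] by blast
      have "f (x \<otimes>\<^bsub>L\<^esub> x) = \<zero>\<^bsub>M\<^esub>" using f0 L.square_centralises_chief_factor[OF cf x(1)] by blast
      then show "y \<otimes>\<^bsub>M\<^esub> y = \<zero>\<^bsub>M\<^esub>" using x surjective_homD(5)[OF f] by simp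
    qed
    then show "in_class F (lie_part F \<KK>) (quotient_algebra L ?C)"
      using M iso by (auto simp: in_class_def lie_part_def)
  qed
  then show ?thesis unfolding Loc_def by blast
qed

text \<open>The kernel of \<open>f\<close> is an abelian ideal. It is therefore contained in the centraliser \<open>C\<close> of each
  chief factor, and \<open>X/C\<close> is isomorphic to the quotient of \<open>L\<close> by the image of \<open>C\<close>.\<close>

lemma extension_in_Loc:
  assumes fm: "lie_formation F \<KK>" and L: "L \<in> \<KK>"
    and X: "lie_algebra F X" and f: "surjective_hom F X L f"
    and abelian: "\<forall>x\<in>carrier X. \<forall>y\<in>carrier X. f x = \<zero>\<^bsub>L\<^esub> \<longrightarrow> f y = \<zero>\<^bsub>L\<^esub> \<longrightarrow> x \<otimes>\<^bsub>X\<^esub> y = \<zero>\<^bsub>X\<^esub>"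
  shows "X \<in> Loc F \<KK>"
    and "chief_factor F X H K \<Longrightarrow> x \<in> carrier X \<Longrightarrow> f x = \<zero>\<^bsub>L\<^esub> \<Longrightarrow> x \<in> factor_centraliser X H K"
proof -
  note fm' = fm[unfolded lie_formation_def]
  interpret L: lie_algebra F L by (rule formationD(2)[OF fm' L])
  interpret X: lie_algebra F X by (rule X)
  interpret XL: leibniz_algebra F X by (rule X.leibniz)
  interpret f: linear_map F X L f
    by (rule linear_mapI[OF X.vectorspace_axioms L.vectorspace_axioms surjective_homD(1)[OF f]])
  have "subspace F {x \<in> carrier X. f x \<in> {\<zero>\<^bsub>L\<^esub>}} X"
    by (rule f.preimage_subspace[OF L.subspace_zero_space])
  then have ker: "algebra_ideal F X {x \<in> carrier X. f x = \<zero>\<^bsub>L\<^esub>}"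
    using surjective_homD(2,5)[OF f] by (auto simp: algebra_ideal_def)
  have kerC: "x \<in> factor_centraliser X H K"
    if "chief_factor F X H K" "x \<in> carrier X" "f x = \<zero>\<^bsub>L\<^esub>" for H K x
    using XL.abelian_ideal_centralises_chief_factor[OF that(1) ker] abelian that(2,3) by blast
  then show "chief_factor F X H K \<Longrightarrow> x \<in> carrier X \<Longrightarrow> f x = \<zero>\<^bsub>L\<^esub> \<Longrightarrow> x \<in> factor_centraliser X H K" .
  have "in_class F \<KK> (quotient_algebra X (factor_centraliser X H K))" if cf: "chief_factor F X H K" for H K
  proof -
    have C: "algebra_ideal F X (factor_centraliser X H K)"
      by (rule XL.centraliser_ideal[OF XL.chief_factorD(1,2)[OF cf]])
    have "in_class F \<KK> (quotient_algebra L (f ` factor_centraliser X H K))"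
      by (rule formationD(5)[OF fm' L X.image_ideal[OF f L.fd_algebra_axioms C]])
    then show ?thesis
      by (rule in_class_isomorphic[rotated])
        (rule X.quotient_by_ideal_containing_kernel(1)[OF f L.fd_algebra_axioms C kerC[OF cf]])
  qed
  moreover have "soluble F X"
    by (rule X.soluble_extension[OF f L.fd_algebra_axioms formationD(3)[OF fm' L]]) (use abelian in blast)
  ultimately show "X \<in> Loc F \<KK>" using X.leibniz by (simp add: Loc_def)
qed

text \<open>
  Each \<open>a \<noteq> 0\<close> in \<open>L \<in> \<KK>\<^sub>1\<close> lies outside some ideal \<open>J\<close> of \<open>L\<close> with \<open>L/J \<in> \<KK>\<^sub>2\<close>: such a \<open>J\<close> is the image
  of the centraliser of a chief factor in an extension of \<open>L\<close>, which belongs to \<open>Loc \<KK>\<^sub>1\<close>. Since \<open>\<KK>\<^sub>2\<close>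
  is closed under subdirect products, a minimal such ideal is contained in all others and is zero.
\<close>

lemma lie_formation_mono_Loc:
  fixes F :: "('a, 'm) ring_scheme"
  assumes char: "ring_characteristic F = p" "p \<noteq> 0"
    and fm1: "lie_formation F \<KK>\<^sub>1" and fm2: "lie_formation F \<KK>\<^sub>2" and Loc: "Loc F \<KK>\<^sub>1 \<subseteq> Loc F \<KK>\<^sub>2"
  shows "\<KK>\<^sub>1 \<subseteq> \<KK>\<^sub>2"
proof
  note fm1' = fm1[unfolded lie_formation_def] and fm2' = fm2[unfolded lie_formation_def]
  have fd2: "\<forall>M\<in>\<KK>\<^sub>2. fd_algebra F M" using formationD(2)[OF fm2'] lie_algebra.axioms(1) by blast
  fix L assume L: "L \<in> \<KK>\<^sub>1"
  interpret L: lie_algebra F L by (rule formationD(2)[OF fm1' L])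
  have separate: "\<exists>J. algebra_ideal F L J \<and> a \<notin> J \<and> in_class F \<KK>\<^sub>2 (quotient_algebra L J)"
    if a: "a \<in> carrier L" "a \<noteq> \<zero>\<^bsub>L\<^esub>" for a
  proof -
    obtain X :: "'a alg" and f b where X: "lie_algebra F X" and f: "surjective_hom F X L f"
      and abelian: "\<forall>x\<in>carrier X. \<forall>y\<in>carrier X. f x = \<zero>\<^bsub>L\<^esub> \<longrightarrow> f y = \<zero>\<^bsub>L\<^esub> \<longrightarrow> x \<otimes>\<^bsub>X\<^esub> y = \<zero>\<^bsub>X\<^esub>"
      and b: "b \<in> carrier X" "f b = a" and nn: "\<not> nilpotent_on X (\<lambda>x. b \<otimes>\<^bsub>X\<^esub> x)"
      by (rule L.ex_extension_with_nonnilpotent_lift[OF char formationD(3)[OF fm1' L] a])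
    interpret X: lie_algebra F X by (rule X)
    interpret XL: leibniz_algebra F X by (rule X.leibniz)
    obtain H K where cf: "chief_factor F X H K" and bC: "b \<notin> factor_centraliser X H K"
      by (rule XL.ex_chief_factor_not_centralised[OF b(1) nn])
    let ?C = "factor_centraliser X H K"
    have C: "algebra_ideal F X ?C"
      by (rule XL.centraliser_ideal[OF XL.chief_factorD(1,2)[OF cf]])
    have iso: "algebra_isomorphic F (quotient_algebra L (f ` ?C)) (quotient_algebra X ?C)"
      by (rule X.quotient_by_ideal_containing_kernel(2)[OF f L.fd_algebra_axioms C])
        (rule extension_in_Loc(2)[OF fm1 L X f abelian cf])
    have reflect: "x \<in> ?C" if "x \<in> carrier X" "f x \<in> f ` ?C" for x
      by (rule X.quotient_by_ideal_containing_kernel(3)[OF f L.fd_algebra_axioms C _ that])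
        (rule extension_in_Loc(2)[OF fm1 L X f abelian cf])
    have "X \<in> Loc F \<KK>\<^sub>2" using extension_in_Loc(1)[OF fm1 L X f abelian] Loc by blast
    then have "in_class F \<KK>\<^sub>2 (quotient_algebra X ?C)" using cf by (simp add: Loc_def)
    then have "in_class F \<KK>\<^sub>2 (quotient_algebra L (f ` ?C))" by (rule in_class_isomorphic[OF iso])
    moreover have "algebra_ideal F L (f ` ?C)" by (rule X.image_ideal[OF f L.fd_algebra_axioms C])
    moreover have "a \<notin> f ` ?C" using reflect[OF b(1)] bC b(2) by blast
    ultimately show ?thesis by blast
  qed
  let ?P = "\<lambda>J. algebra_ideal F L J \<and> in_class F \<KK>\<^sub>2 (quotient_algebra L J)"
  \<comment> \<open>The quotient by \<open>L\<close> itself belongs to the class, so a minimal ideal exists.\<close>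
  have whole: "algebra_ideal F L (carrier L)" by (simp add: algebra_ideal_def L.subspace_carrier)
  obtain Z where Z: "Z \<in> \<KK>\<^sub>2" "carrier Z = {\<zero>\<^bsub>Z\<^esub>}"
    by (rule formation_contains_zero_algebra[OF fm2' lie_algebra.axioms(1)])
  interpret Z: lie_algebra F Z by (rule formationD(2)[OF fm2' Z(1)])
  have "surjective_hom F L Z (\<lambda>x. \<zero>\<^bsub>Z\<^esub>)"
    unfolding surjective_hom_def
  proof (intro conjI ballI module_homI)
    show "(\<lambda>x. \<zero>\<^bsub>Z\<^esub>) ` carrier L = carrier Z" using Z(2) L.M.zero_closed by blast
  qed simp_all
  then have "algebra_isomorphic F (quotient_algebra L (carrier L)) Z"
    by (rule L.isomorphic_images[OF L.coset_map_surjective_hom[OF whole]])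
      (simp add: L.coset_eq_iff[OF L.subspace_carrier])
  then have "?P (carrier L)" using whole Z(1) by (auto simp: in_class_def)
  then obtain J where J: "?P J" and J_min: "\<And>C. ?P C \<Longrightarrow> \<not> C \<subset> J"
    using L.ex_minimal_subspace[OF L.finite_dimensional, of ?P "carrier L"] L.ideal_subspace by metis
  have subJ: "subspace F J L" using J L.ideal_subspace by blast
  have "a = \<zero>\<^bsub>L\<^esub>" if a: "a \<in> J" for a
  proof (rule ccontr)
    assume "a \<noteq> \<zero>\<^bsub>L\<^esub>"
    then obtain I where I: "algebra_ideal F L I" "a \<notin> I" "in_class F \<KK>\<^sub>2 (quotient_algebra L I)"
      using separate[of a] L.subspace_mem[OF subJ a] by blast
    have "algebra_ideal F L (J \<inter> I)"
      using J I(1) L.subspace_Int by (auto simp: algebra_ideal_def)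
    moreover have "in_class F \<KK>\<^sub>2 (quotient_algebra L (J \<inter> I))"
      by (rule formationD(6)[OF fm2' L.lie_algebra_axioms _ I(1) _ I(3)]) (use J in auto)
    ultimately have "\<not> J \<inter> I \<subset> J" by (intro J_min) simp
    then show False using a I(2) by blast
  qed
  then have J0: "J = {\<zero>\<^bsub>L\<^esub>}" using L.subspace_zero[OF subJ] by blast
  obtain M f where M: "M \<in> \<KK>\<^sub>2" and f: "surjective_hom F L M f"
    and eq: "\<forall>x\<in>carrier L. \<forall>y\<in>carrier L. f x = f y \<longleftrightarrow> x \<ominus>\<^bsub>L\<^esub> y \<in> {\<zero>\<^bsub>L\<^esub>}"
    using L.in_class_quotientD[of \<KK>\<^sub>2 "{\<zero>\<^bsub>L\<^esub>}"] J fd2 unfolding J0 by metis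
  have id: "surjective_hom F L L (\<lambda>x. x)" by (simp add: surjective_hom_def module_hom_def)
  have "algebra_isomorphic F M L"
    by (rule L.isomorphic_images[OF f id]) (simp add: eq)
  then show "L \<in> \<KK>\<^sub>2" by (rule formationD(4)[OF fm2' M L.lie_algebra_axioms])
qed

theorem theorem4p1:
  fixes F :: "'a ring" and p :: nat and \<FF> :: "'a alg set"
  assumes "field F"
    and "ring_characteristic F = p" and "p \<noteq> 0"
    and "\<exists>\<KK>. leibniz_formation F \<KK> \<and> \<FF> = Loc F \<KK>"
  shows "\<exists>!\<KK>\<^sub>0. lie_formation F \<KK>\<^sub>0 \<and> \<FF> = Loc F \<KK>\<^sub>0"
proof -
  obtain \<KK> where \<KK>: "leibniz_formation F \<KK>" "\<FF> = Loc F \<KK>" using assms(4) by blast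
  show ?thesis
  proof (rule ex1I)
    show "lie_formation F (lie_part F \<KK>) \<and> \<FF> = Loc F (lie_part F \<KK>)"
      using lie_part_formation[OF \<KK>(1)] Loc_lie_part[OF \<KK>(1)] \<KK>(2) by simp
  next
    fix \<KK>' assume "lie_formation F \<KK>' \<and> \<FF> = Loc F \<KK>'"
    then show "\<KK>' = lie_part F \<KK>"
      using lie_formation_mono_Loc[OF assms(2,3)] lie_part_formation[OF \<KK>(1)] Loc_lie_part[OF \<KK>(1)] \<KK>(2)
      by (intro equalityI) simp_all
  qed
qed

end
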